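(* Let $\tau>0$. Let $D=\{z=x+iy\in\mathbb{C} : |x-\frac{\pi}{2}|+|y|<\frac{\pi}{2}\}$ and let $\Phi^{\mathrm{H}}_\tau$ be the input-to-state map at time $\tau$ of the Hermite heat equation on $(0,\pi)$ with Dirichlet $L^2$-controls at both endpoints. Then $$\operatorname{Ran}(\Phi^{\mathrm{H}}_\tau)\subset A^2(D).$$
   Context: Hermite heat equation on $(0,\pi)$ with boundary control: $$\partial_t w-\partial_x^2 w+x^2w=0\ (t>0,\ x\in(0,\pi)),\quad w(t,0)=u_0(t),\ w(t,\pi)=u_\pi(t),\quad w(0,\cdot)=f.$$ For $f\in X:=W^{-1,2}(0,\pi)$ and $u=(u_0,u_\pi)\in L^2((0,\infty);\mathbb{C}^2)$, a solution is a function $w\in C([0,\infty);X)$ such that for every $t\ge 0$ and every $\psi\in W^{2,2}(0,\pi)\cap W^{1,2}_0(0,\pi)$ with $\psi''\in W^{1,2}_0(0,\pi)$, $$\langle w(t),\psi\rangle=\langle f,\psi\rangle+\int_0^t\langle w(s),\psi''-x^2\psi\rangle\,ds+\int_0^t u_0(s)\overline{\psi'(0)}\,ds-\int_0^t u_\pi(s)\overline{\psi'(\pi)}\,ds,$$ where $\langle\cdot,\cdot\rangle$ is the (sesquilinear) $W^{-1,2}(0,\pi)$–$W^{1,2}_0(0,\pi)$ duality. It is known that there is exactly one solution. The input-to-state map $\Phi^{\mathrm{H}}_\tau:L^2((0,\tau);\mathbb{C}^2)\to X$ sends $u$ to $w(\tau)$, where $w$ is the solution with $f=0$ and control $u$.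 For a domain $\Omega\subset\mathbb{C}$, the Bergman space $A^2(\Omega)$ is the set of holomorphic functions $h$ on $\Omega$ with $\int_\Omega|h(x+iy)|^2\,dx\,dy<\infty$. The inclusion means that each element of $\operatorname{Ran}(\Phi^{\mathrm{H}}_\tau)$ is (as a distribution on $(0,\pi)$) the restriction to $(0,\pi)$ of a function in $A^2(D)$. *)

theory Defs
  imports "HOL-Complex_Analysis.Complex_Analysis"
begin

text \<open>
  Functions stand for their classes modulo null sets. The open interval \<open>I\<close> carries Lebesgue measure.
\<close>

definition L2 :: "real set \<Rightarrow> (real \<Rightarrow> 'a::euclidean_space) set" where
  "L2 I = {f. f \<in> borel_measurable (lebesgue_on I) \<and>
              integrable (lebesgue_on I) (\<lambda>x. (norm (f x))\<^sup>2)}"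

definition locally_integrable :: "real set \<Rightarrow> (real \<Rightarrow> complex) \<Rightarrow> bool" where
  "locally_integrable I f \<longleftrightarrow> (\<forall>K. compact K \<and> K \<subseteq> I \<longrightarrow> integrable (lebesgue_on K) f)"

definition vderiv :: "(real \<Rightarrow> complex) \<Rightarrow> real \<Rightarrow> complex" where
  "vderiv f x = vector_derivative f (at x)"

definition test_functions :: "real set \<Rightarrow> (real \<Rightarrow> complex) set" where
  "test_functions I = {\<phi>. (\<forall>n x. ((vderiv ^^ n) \<phi>) differentiable (at x)) \<and>
                          (\<exists>K. compact K \<and> K \<subseteq> I \<and> (\<forall>x. x \<notin> K \<longrightarrow> \<phi> x = 0))}"

definition has_weak_deriv :: "real set \<Rightarrow> (real \<Rightarrow> complex) \<Rightarrow> (real \<Rightarrow> complex) \<Rightarrow> bool" where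
  "has_weak_deriv I f g \<longleftrightarrow> locally_integrable I f \<and> locally_integrable I g \<and>
     (\<forall>\<phi>\<in>test_functions I.
        (LINT x|lebesgue_on I. f x * vderiv \<phi> x) = - (LINT x|lebesgue_on I. g x * \<phi> x))"

text \<open>Weak derivatives are unique only up to null sets; \<open>weak_deriv\<close> picks a representative.\<close>

definition weak_deriv :: "real set \<Rightarrow> (real \<Rightarrow> complex) \<Rightarrow> real \<Rightarrow> complex" where
  "weak_deriv I f = (SOME g. has_weak_deriv I f g)"

text \<open>\<open>sobolev k I\<close> is \<open>W\<^sup>k\<^sup>,\<^sup>2(I)\<close> and \<open>sobolev_10 I\<close> is \<open>W\<^sup>1\<^sup>,\<^sup>2\<^sub>0(I)\<close>.\<close>

primrec sobolev :: "nat \<Rightarrow> real set \<Rightarrow> (real \<Rightarrow> complex) set" where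
  "sobolev 0 I = L2 I"
| "sobolev (Suc k) I = {f \<in> L2 I. \<exists>g\<in>sobolev k I. has_weak_deriv I f g}"

definition sobolev_norm :: "real set \<Rightarrow> (real \<Rightarrow> complex) \<Rightarrow> real" where
  "sobolev_norm I f = sqrt ((LINT x|lebesgue_on I. (cmod (f x))\<^sup>2) +
                            (LINT x|lebesgue_on I. (cmod (weak_deriv I f x))\<^sup>2))"

definition sobolev_10 :: "real set \<Rightarrow> (real \<Rightarrow> complex) set" where
  "sobolev_10 I = {f \<in> sobolev 1 I.
     \<exists>\<phi>. (\<forall>n. \<phi> n \<in> test_functions I) \<and>
         (\<lambda>n. sobolev_norm I (\<lambda>x. f x - \<phi> n x)) \<longlonglongrightarrow> 0}"

text \<open>
  \<open>dual_sobolev I\<close> is \<open>W\<^sup>-\<^sup>1\<^sup>,\<^sup>2(I)\<close>, as the bounded antilinear functionals on \<open>W\<^sup>1\<^sup>,\<^sup>2\<^sub>0(I)\<close>: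
  \<open>F \<psi>\<close> is the sesquilinear pairing of \<open>F\<close> with \<open>\<psi>\<close>. Boundedness makes \<open>F\<close> respect
  equality almost everywhere; the value 0 off \<open>W\<^sup>1\<^sup>,\<^sup>2\<^sub>0(I)\<close> is a normalisation making the
  representation of a functional unique.
\<close>

type_synonym functional = "(real \<Rightarrow> complex) \<Rightarrow> complex"

definition dual_sobolev :: "real set \<Rightarrow> functional set" where
  "dual_sobolev I = {F.
     (\<forall>\<phi>\<in>sobolev_10 I. \<forall>\<psi>\<in>sobolev_10 I. F (\<lambda>x. \<phi> x + \<psi> x) = F \<phi> + F \<psi>) \<and>
     (\<forall>c. \<forall>\<psi>\<in>sobolev_10 I. F (\<lambda>x. c * \<psi> x) = cnj c * F \<psi>) \<and>
     (\<exists>C. \<forall>\<psi>\<in>sobolev_10 I. cmod (F \<psi>) \<le> C * sobolev_norm I \<psi>) \<and>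
     (\<forall>\<psi>. \<psi> \<notin> sobolev_10 I \<longrightarrow> F \<psi> = 0)}"

definition dual_norm :: "real set \<Rightarrow> functional \<Rightarrow> real" where
  "dual_norm I F = (SUP \<psi>\<in>{\<psi> \<in> sobolev_10 I. sobolev_norm I \<psi> \<le> 1}. cmod (F \<psi>))"

definition continuous_dual_valued :: "real set \<Rightarrow> real set \<Rightarrow> (real \<Rightarrow> functional) \<Rightarrow> bool" where
  "continuous_dual_valued I T w \<longleftrightarrow>
     (\<forall>t\<in>T. w t \<in> dual_sobolev I) \<and>
     (\<forall>t\<in>T. ((\<lambda>s. dual_norm I (\<lambda>\<psi>. w s \<psi> - w t \<psi>)) \<longlongrightarrow> 0) (at t within T))"

text \<open>Value at \<open>p \<in> [a, b]\<close> of the representative of \<open>g\<close> that is continuous up to the boundary.\<close>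

definition trace_at :: "real \<Rightarrow> real \<Rightarrow> (real \<Rightarrow> complex) \<Rightarrow> real \<Rightarrow> complex" where
  "trace_at a b g p = (THE c. \<exists>h. continuous_on {a..b} h \<and>
                            (AE x in lebesgue_on {a<..<b}. h x = g x) \<and> h p = c)"

abbreviation J :: "real set" where "J \<equiv> {0<..<pi}"

definition hermite_test :: "(real \<Rightarrow> complex) set" where
  "hermite_test = {\<psi> \<in> sobolev 2 J \<inter> sobolev_10 J. weak_deriv J (weak_deriv J \<psi>) \<in> sobolev_10 J}"

definition hermite_solution ::
  "functional \<Rightarrow> (real \<Rightarrow> complex \<times> complex) \<Rightarrow> (real \<Rightarrow> functional) \<Rightarrow> bool" where
  "hermite_solution f u w \<longleftrightarrow> continuous_dual_valued J {0..} w \<and>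
     (\<forall>t\<ge>0. \<forall>\<psi>\<in>hermite_test.
        w t \<psi> = f \<psi>
          + (LINT s|lebesgue_on {0<..<t}.
               w s (\<lambda>x. weak_deriv J (weak_deriv J \<psi>) x - complex_of_real (x\<^sup>2) * \<psi> x))
          + (LINT s|lebesgue_on {0<..<t}. fst (u s) * cnj (trace_at 0 pi (weak_deriv J \<psi>) 0))
          - (LINT s|lebesgue_on {0<..<t}. snd (u s) * cnj (trace_at 0 pi (weak_deriv J \<psi>) pi)))"

text \<open>
  The graph of the input-to-state map. Controls on \<open>(0, \<tau>)\<close> are extended by 0; the values after time
  \<open>\<tau>\<close> do not affect the state at time \<open>\<tau>\<close>. The graph is single-valued and total on
  \<open>L2 {0<..<\<tau>}\<close> because the equation has exactly one solution for each control.
\<close>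

definition hermite_input_to_state :: "real \<Rightarrow> ((real \<Rightarrow> complex \<times> complex) \<times> functional) set" where
  "hermite_input_to_state \<tau> = {(u, w \<tau>) | u w. u \<in> L2 {0<..<\<tau>} \<and>
     hermite_solution (\<lambda>\<psi>. 0) (\<lambda>s. if 0 < s \<and> s < \<tau> then u s else 0) w}"

definition bergman_space :: "complex set \<Rightarrow> (complex \<Rightarrow> complex) set" where
  "bergman_space \<Omega> = {h. h holomorphic_on \<Omega> \<and>
                         integrable (lebesgue_on \<Omega>) (\<lambda>z. (cmod (h z))\<^sup>2)}"

text \<open>
  Functionals which as distributions on \<open>I\<close> are restrictions of members of \<open>H\<close>. The conjugate matches
  the antilinearity of the pairing in its second argument.
\<close>

definition restrictions :: "real set \<Rightarrow> (complex \<Rightarrow> complex) set \<Rightarrow> functional set" where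
  "restrictions I H = {F. \<exists>h\<in>H. \<forall>\<phi>\<in>test_functions I.
     F \<phi> = (LINT x|lebesgue_on I. h (complex_of_real x) * cnj (\<phi> x))}"

definition D :: "complex set" where
  "D = {z. \<bar>Re z - pi / 2\<bar> + \<bar>Im z\<bar> < pi / 2}"

end

theory Submission
  imports Defs
begin

text \<open>
  Put \<open>z = a (1 - \<i>)/2 + b (1 + \<i>)/2\<close> with \<open>0 < a, b < \<pi>\<close>; this parametrises \<open>D\<close>. If \<open>W(t, z)\<close> is entire in \<open>z\<close> and
  \<open>W\<^sub>t = W\<^sub>z\<^sub>z - z\<^sup>2 W\<close>, then \<open>\<partial>\<^sub>a \<partial>\<^sub>b \<bar>W\<bar>\<^sup>2 = Re (W\<^sub>z\<^sub>z cnj W)\<close>, and \<open>Re z\<^sup>2 = a b \<ge> 0\<close>, so integrating over the square gives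
  \<open>d/dt \<integral>\<^sub>D \<bar>W\<bar>\<^sup>2 \<le> \<bar>W(t, 0)\<bar>\<^sup>2 + \<bar>W(t, \<pi>)\<bar>\<^sup>2\<close>: the Bergman norm of the state is bounded by the \<open>L\<^sup>2\<close> norm of the
  boundary values. Extend the control by \<open>0\<close> to \<open>(-\<infinity>, 0)\<close> and approximate it by sums \<open>\<Sum>\<^sub>j\<^sub>\<ge>\<^sub>1 c\<^sub>j e\<^sup>j\<^sup>t\<close> (Weierstrass in
  \<open>e\<^sup>t\<close>). These are the boundary values of \<open>W = \<Sum>\<^sub>j e\<^sup>j\<^sup>t Z\<^sub>j(z)\<close> with \<open>Z\<^sub>j'' = (z\<^sup>2 + j) Z\<^sub>j\<close>, entire and vanishing at
  \<open>t = -\<infinity>\<close>; so the states \<open>W(\<tau>)\<close> converge in \<open>A\<^sup>2(D)\<close>.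

  To identify the limit with \<open>w(\<tau>)\<close>, test both equations with \<open>\<psi> = (l - \<partial>\<^sub>x\<^sup>2 + x\<^sup>2)\<^sup>-\<^sup>1 g\<close>, whose \<open>W\<^sup>1\<^sup>,\<^sup>2\<close> norm is bounded
  independently of \<open>l\<close>. The difference \<open>f\<close> of the pairings with \<open>g\<close> then satisfies
  \<open>\<integral>\<^sub>0\<^sup>\<tau> e\<^sup>l\<^sup>(\<^sup>\<tau>\<^sup>-\<^sup>t\<^sup>) f(t) dt = O(1)\<close> for \<open>l = 1, 2, ...\<close>, which forces \<open>f = 0\<close>.
\<close>

subsection \<open>Bump functions\<close>

text \<open>The states and the test space meet because of the shape of \<open>D\<close> at its real
  corners: a point x of the axis has distance comparable to min(x, pi - x) from the boundary, so
  |h(x)| is at most a constant times the Bergman norm divided by that distance. A function in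
  W^{1,2}_0 is bounded by the square root of the same distance, and the product is integrable. Hence
  restriction to the axis is bounded from A^2(D) to W^{-1,2}, although h need not be integrable up
  to the endpoints.

  The energy estimate needs W to be entire in z, which cannot be read off from a weak solution. Sums
  of modes are entire at every time, but a nonzero sum does not vanish at time 0. The prehistory on
  the negative half-line replaces the zero initial state: boundary values of size \<epsilon> e^t
  there leave a state of Bergman norm O(\<epsilon>) at time 0.

  In the comparison of the two evolutions the approximation errors are amplified by e^(l \<tau>).
  The approximation index therefore tends to infinity for each fixed l; what remains is bounded
  independently of l, and only then is l varied.\<close>

text \<open>Membership in \<open>test_functions\<close> asks for all iterated derivatives. A class
  that is stable under \<open>vderiv\<close> and consists of differentiable functions settles this
  without a formula for the n-th derivative.\<close>

lemma smooth_coinduct: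
  assumes "f \<in> S" and "\<And>g x. g \<in> S \<Longrightarrow> g differentiable (at x)" and "\<And>g. g \<in> S \<Longrightarrow> vderiv g \<in> S"
  shows "((vderiv ^^ n) f) differentiable (at x)"
proof -
  have "(vderiv ^^ n) f \<in> S" by (induction n) (use assms in auto)
  then show ?thesis using assms(2) by blast
qed

text \<open>The polynomial \<open>r\<close> and the power \<open>k\<close> close the family under
  differentiation. With \<open>r = 1\<close> and \<open>k = 0\<close> it is the usual smooth cutoff
  on \<open>(a, b)\<close>, which tends to \<open>1\<close> inside the interval as \<open>c\<close>
  tends to \<open>0\<close>.\<close>

definition bump :: "real \<Rightarrow> real \<Rightarrow> real \<Rightarrow> complex poly \<Rightarrow> nat \<Rightarrow> real \<Rightarrow> complex" where
  "bump a b c r k x = (if a < x \<and> x < b then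
      poly r (of_real x) * of_real (exp (- c / ((x - a) * (b - x))) / ((x - a) * (b - x)) ^ k) else 0)"

lemma has_vector_derivative_zero_of_quadratic:
  fixes f :: "real \<Rightarrow> complex"
  assumes b: "\<And>x. norm (f x) \<le> C * (x - p)\<^sup>2"
  shows "(f has_vector_derivative 0) (at p)"
proof -
  have fp: "f p = 0" using b[of p] by simp
  have "((\<lambda>h. norm (f (p + h) - f p - h *\<^sub>R 0) / norm h) \<longlongrightarrow> 0) (at 0)"
  proof (rule Lim_null_comparison)
    show "\<forall>\<^sub>F h in at 0. norm (norm (f (p + h) - f p - h *\<^sub>R 0) / norm h) \<le> C * \<bar>h\<bar>"
    proof (rule eventually_at_filter[THEN iffD2], rule always_eventually, safe)
      fix h :: real assume "h \<noteq> 0"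
      have "norm (f (p + h)) / \<bar>h\<bar> \<le> (C * h\<^sup>2) / \<bar>h\<bar>" using b[of "p + h"] by (intro divide_right_mono) auto
      also have "\<dots> = C * \<bar>h\<bar>" using \<open>h \<noteq> 0\<close> by (cases "h > 0") (simp_all add: power2_eq_square)
      finally show "norm (norm (f (p + h) - f p - h *\<^sub>R 0) / norm h) \<le> C * \<bar>h\<bar>" by (simp add: fp)
    qed
    show "((\<lambda>h. C * \<bar>h\<bar>) \<longlongrightarrow> 0) (at 0)" by (rule tendsto_eq_intros refl | simp)+
  qed
  then show ?thesis
    unfolding has_vector_derivative_def has_derivative_at by (simp add: bounded_linear_zero)
qed

text \<open>The exponential beats every pole: one term of its series gives
  \<open>exp (c / s) \<ge> (c / s) ^ (k + 2) / fact (k + 2)\<close> with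
  \<open>s = (x - a) * (b - x)\<close>. Cancelling \<open>s ^ k\<close> leaves a factor
  \<open>s ^ 2\<close>, which is quadratic at both ends and hence gives derivative zero
  there.\<close>

lemma bump_bound:
  assumes "a < b" "c > 0"
  obtains C where "\<And>x. norm (bump a b c r k x) \<le> C * (x - a)\<^sup>2" "\<And>x. norm (bump a b c r k x) \<le> C * (x - b)\<^sup>2"
proof -
  have "compact ((\<lambda>x. poly r (of_real x)) ` {a..b})"
    by (intro compact_continuous_image continuous_intros) auto
  then obtain M where M: "\<And>x. x \<in> {a..b} \<Longrightarrow> norm (poly r (of_real x)) \<le> M" "M > 0"
    by (metis compact_imp_bounded bounded_pos image_eqI)
  define F where "F = fact (k + 2) / c ^ (k + 2)"
  have "F > 0" unfolding F_def using assms by simp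
  have main: "norm (bump a b c r k x) \<le> M * F * ((x - a) * (b - x))\<^sup>2" if x: "a < x" "x < b" for x
  proof -
    define s where "s = (x - a) * (b - x)"
    have s: "s > 0" using x by (simp add: s_def)
    have "(c / s) ^ (k + 2) / fact (k + 2) \<le> exp (c / s)"
    proof -
      have "(\<Sum>i\<in>{k+2}. inverse (fact i) *\<^sub>R (c / s) ^ i) \<le> (\<Sum>i. inverse (fact i) *\<^sub>R (c / s) ^ i)"
        by (intro sum_le_suminf summable_exp_generic) (use assms s in auto)
      then show ?thesis by (simp add: exp_def divide_inverse mult.commute)
    qed
    then have "1 \<le> exp (c / s) * (fact (k + 2) / (c / s) ^ (k + 2))"
      using assms s by (simp add: pos_divide_le_eq divide_le_eq_1 del: fact_Suc power_Suc add_2_eq_Suc')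
    also have "\<dots> = exp (c / s) * (F * s ^ (k + 2))" using assms s by (simp add: F_def power_divide)
    finally have "exp (- c / s) \<le> F * s ^ (k + 2)" by (simp add: exp_minus field_simps)
    then have "exp (- c / s) / s ^ k \<le> F * s\<^sup>2"
      using s by (simp add: field_simps power_add power2_eq_square)
    then have "norm (poly r (of_real x)) * (exp (- c / s) / s ^ k) \<le> M * (F * s\<^sup>2)"
      using x s M(1)[of x] M(2) by (intro mult_mono) auto
    moreover have "norm (bump a b c r k x) = norm (poly r (of_real x)) * (exp (- c / s) / s ^ k)"
      unfolding bump_def using x s by (simp add: norm_mult s_def[symmetric] del: of_real_power of_real_divide)
    ultimately have "norm (bump a b c r k x) \<le> M * (F * s\<^sup>2)" by simp
    then show ?thesis by (simp add: s_def mult.assoc)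
  qed
  have ba: "norm (bump a b c r k x) \<le> M * F * (b - a)\<^sup>2 * (x - a)\<^sup>2" for x
  proof (cases "a < x \<and> x < b")
    case True
    have "((x - a) * (b - x))\<^sup>2 \<le> ((x - a) * (b - a))\<^sup>2" using True by (intro power_mono mult_left_mono) auto
    then have "M * F * ((x - a) * (b - x))\<^sup>2 \<le> M * F * ((x - a) * (b - a))\<^sup>2"
      using M(2) \<open>F > 0\<close> by (intro mult_left_mono) auto
    then show ?thesis using main[of x] True by (simp add: power_mult_distrib mult_ac)
  qed (use M(2) \<open>F > 0\<close> in \<open>auto simp: bump_def\<close>)
  have bb: "norm (bump a b c r k x) \<le> M * F * (b - a)\<^sup>2 * (x - b)\<^sup>2" for x
  proof (cases "a < x \<and> x < b")
    case True
    have "((x - a) * (b - x))\<^sup>2 \<le> ((b - a) * (b - x))\<^sup>2" using True by (intro power_mono mult_right_mono) auto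
    then have "M * F * ((x - a) * (b - x))\<^sup>2 \<le> M * F * ((b - a) * (b - x))\<^sup>2"
      using M(2) \<open>F > 0\<close> by (intro mult_left_mono) auto
    then show ?thesis using main[of x] True by (simp add: power_mult_distrib mult_ac power2_commute)
  qed (use M(2) \<open>F > 0\<close> in \<open>auto simp: bump_def\<close>)
  show ?thesis using that ba bb by blast
qed

text \<open>\<open>S\<close> is \<open>(x - a) * (b - x)\<close> as a polynomial. Differentiating
  \<open>r * exp (- c / S) / S ^ k\<close> and collecting over \<open>S ^ (k + 2)\<close> gives the
  new numerator; at \<open>a\<close> and \<open>b\<close> the quadratic bound takes over.\<close>

lemma bump_has_vector_derivative:
  assumes "a < b" "c > 0"
  defines "S \<equiv> [:- of_real (a * b), of_real (a + b), -1:] :: complex poly"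
  shows "(bump a b c r k has_vector_derivative
     bump a b c (pderiv r * S\<^sup>2 + smult (of_real c) (pderiv S * r) - smult (of_nat k) (S * pderiv S * r)) (k + 2) x) (at x)"
    (is "(_ has_vector_derivative bump a b c ?q _ x) _")
proof -
  consider "x = a" | "x = b" | "a < x" "x < b" | "x < a \<or> b < x" by linarith
  then show ?thesis
  proof cases
    case 1
    obtain C where "\<And>x. norm (bump a b c r k x) \<le> C * (x - a)\<^sup>2" using bump_bound[OF assms(1,2)] by metis
    moreover have "bump a b c ?q (k + 2) x = 0" using 1 by (simp add: bump_def)
    ultimately show ?thesis using has_vector_derivative_zero_of_quadratic[of "bump a b c r k" C x] 1 by simp
  next
    case 2
    obtain C where "\<And>x. norm (bump a b c r k x) \<le> C * (x - b)\<^sup>2" using bump_bound[OF assms(1,2)] by metis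
    moreover have "bump a b c ?q (k + 2) x = 0" using 2 by (simp add: bump_def)
    ultimately show ?thesis using has_vector_derivative_zero_of_quadratic[of "bump a b c r k" C x] 2 by simp
  next
    case 3
    define s where "s = (\<lambda>x. (x - a) * (b - x))"
    have s: "s x > 0" using 3 by (simp add: s_def)
    have S: "poly S (of_real x) = of_real (s x)" by (simp add: S_def s_def algebra_simps)
    have S': "poly (pderiv S) (of_real x) = of_real (a + b - 2 * x)" by (simp add: S_def pderiv_pCons algebra_simps)
    have d1: "((\<lambda>x. poly r (of_real x)) has_vector_derivative poly (pderiv r) (of_real x)) (at x)"
      by (rule has_vector_derivative_real_field) (rule poly_DERIV)
    have ds: "(s has_real_derivative (a + b - 2 * x)) (at x)" unfolding s_def
      by (auto intro!: derivative_eq_intros)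
    have d2: "((\<lambda>x. exp (- c / s x) / s x ^ k) has_real_derivative
        (c * (a + b - 2 * x) - real k * s x * (a + b - 2 * x)) * exp (- c / s x) / s x ^ (k + 2)) (at x)"
    proof -
      have "((\<lambda>x. exp (- c / s x) / s x ^ k) has_real_derivative
        (exp (- c / s x) * (c * (a + b - 2 * x) / (s x)\<^sup>2) * s x ^ k - exp (- c / s x) * (real k * (a + b - 2 * x) * s x ^ (k - 1))) / (s x ^ k * s x ^ k)) (at x)"
        using s by (auto intro!: derivative_eq_intros ds simp: power2_eq_square)
      moreover have "(exp (- c / s x) * (c * (a + b - 2 * x) / (s x)\<^sup>2) * s x ^ k - exp (- c / s x) * (real k * (a + b - 2 * x) * s x ^ (k - 1))) / (s x ^ k * s x ^ k)
         = (c * (a + b - 2 * x) - real k * s x * (a + b - 2 * x)) * exp (- c / s x) / s x ^ (k + 2)"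
        using s by (cases k) (simp_all add: divide_simps power_add power2_eq_square, simp_all add: algebra_simps)
      ultimately show ?thesis by simp
    qed
    have "((\<lambda>x. poly r (of_real x) * of_real (exp (- c / s x) / s x ^ k)) has_vector_derivative
       poly r (of_real x) * of_real ((c * (a + b - 2 * x) - real k * s x * (a + b - 2 * x)) * exp (- c / s x) / s x ^ (k + 2))
       + poly (pderiv r) (of_real x) * of_real (exp (- c / s x) / s x ^ k)) (at x)"
      by (intro has_vector_derivative_mult d1 has_vector_derivative_of_real)
         (use d2 in \<open>simp add: has_real_derivative_iff_has_vector_derivative\<close>)
    moreover have "poly r (of_real x) * of_real ((c * (a + b - 2 * x) - real k * s x * (a + b - 2 * x)) * exp (- c / s x) / s x ^ (k + 2))
       + poly (pderiv r) (of_real x) * of_real (exp (- c / s x) / s x ^ k) =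
       poly ?q (of_real x) * of_real (exp (- c / s x) / s x ^ (k + 2))"
    proof -
      have "complex_of_real (exp (- c / s x) / s x ^ k) = of_real ((s x)\<^sup>2) * of_real (exp (- c / s x) / s x ^ (k + 2))"
      proof -
        have "exp (- c / s x) / s x ^ k = (s x)\<^sup>2 * (exp (- c / s x) / s x ^ (k + 2))"
          using s by (simp add: power_add power2_eq_square)
        then show ?thesis by (metis of_real_mult)
      qed
      moreover have "complex_of_real ((c * (a + b - 2 * x) - real k * s x * (a + b - 2 * x)) * exp (- c / s x) / s x ^ (k + 2))
         = of_real (c * (a + b - 2 * x) - real k * s x * (a + b - 2 * x)) * of_real (exp (- c / s x) / s x ^ (k + 2))"
        by (simp only: of_real_mult[symmetric] times_divide_eq_right)
      moreover define E where "E = complex_of_real (exp (- c / s x) / s x ^ (k + 2))"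
      ultimately show ?thesis
        unfolding E_def[symmetric]
        by (simp only: poly_add poly_diff poly_mult poly_smult poly_power S S') (simp add: algebra_simps)
    qed
    ultimately have "((\<lambda>x. poly r (of_real x) * of_real (exp (- c / s x) / s x ^ k)) has_vector_derivative
       bump a b c ?q (k + 2) x) (at x)" using 3 by (simp add: bump_def s_def)
    then show ?thesis
      by (rule has_vector_derivative_transform_within_open[where S = "{a<..<b}"]) (use 3 in \<open>auto simp: bump_def s_def\<close>)
  next
    case 4
    have "((\<lambda>x. 0) has_vector_derivative bump a b c ?q (k + 2) x) (at x)" using 4 by (auto simp: bump_def)
    then show ?thesis
      by (rule has_vector_derivative_transform_within_open[where S = "{..<a} \<union> {b<..}"]) (use 4 in \<open>auto simp: bump_def\<close>)
  qed
qed

lemma smooth_bump: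
  assumes "a < b" "c > 0"
  shows "((vderiv ^^ n) (bump a b c r k)) differentiable (at x)"
proof (rule smooth_coinduct[where S = "{bump a b c r k | r k. True}"])
  fix g x assume "g \<in> {bump a b c r k | r k. True}"
  then show "g differentiable (at x)"
    using bump_has_vector_derivative[OF assms] by (auto intro: differentiableI_vector)
next
  fix g assume "g \<in> {bump a b c r k | r k. True}"
  then obtain r k where g: "g = bump a b c r k" by auto
  show "vderiv g \<in> {bump a b c r k | r k. True}"
    using vector_derivative_at[OF bump_has_vector_derivative[OF assms]] unfolding g vderiv_def by blast
qed auto

lemma bump_test_function:
  assumes "a < b" "c > 0" "{a..b} \<subseteq> I"
  shows "bump a b c r k \<in> test_functions I"
  unfolding test_functions_def
  using smooth_bump[OF assms(1,2)] assms(3) by (auto simp: bump_def intro!: exI[of _ "{a..b}"])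

section \<open>Integrals over open intervals and the fundamental lemma of the calculus of
  variations\<close>

lemma norm_diff_power2_le:
  "(norm (x - z))\<^sup>2 \<le> 2 * (norm (x - y))\<^sup>2 + 2 * (norm (y - z))\<^sup>2" for x :: "'a::real_normed_vector"
proof -
  have "(norm (x - z))\<^sup>2 \<le> (norm (x - y) + norm (y - z))\<^sup>2"
    using norm_triangle_ineq[of "x - y" "y - z"] by (intro power_mono) auto
  then show ?thesis using sum_squares_bound[of "norm (x - y)" "norm (y - z)"] by (simp add: power2_sum)
qed

text \<open>A bridge between the Lebesgue integrals on open intervals, in which the problem is
  stated, and the gauge integrals on closed ones, in which the fundamental theorem of calculus is
  applied.\<close>

lemma LINT_open_interval:
  fixes f :: "real \<Rightarrow> 'a::euclidean_space"
  assumes "continuous_on {a..b} f"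
  shows "integrable (lebesgue_on {a<..<b}) f" "(LINT x|lebesgue_on {a<..<b}. f x) = integral {a..b} f"
proof -
  have "set_integrable lebesgue {a..b} f"
    using absolutely_integrable_continuous_real[OF assms] by simp
  then have "set_integrable lebesgue {a<..<b} f" by (rule set_integrable_subset) auto
  then show 1: "integrable (lebesgue_on {a<..<b}) f"
    by (simp add: absolutely_integrable_imp_integrable)
  show "(LINT x|lebesgue_on {a<..<b}. f x) = integral {a..b} f"
    using lebesgue_integral_eq_integral[OF 1] by (simp add: integral_open_interval_real)
qed

text \<open>Lebesgue measure is complete. This is needed because \<open>weak_deriv\<close> is a
  choice and is known only up to null sets.\<close>

lemma borel_measurable_lebesgue_on_AE_eq:
  fixes f g :: "real \<Rightarrow> 'a::euclidean_space"
  assumes f: "f \<in> borel_measurable (lebesgue_on S)" and S: "S \<in> sets lebesgue"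
    and ae: "AE x in lebesgue_on S. f x = g x"
  shows "g \<in> borel_measurable (lebesgue_on S)"
proof -
  have "AE x in lebesgue. x \<in> S \<longrightarrow> f x = g x" using ae S by (simp add: AE_restrict_space_iff)
  then have neg: "negligible {x. \<not> (x \<in> S \<longrightarrow> f x = g x)}"
    unfolding negligible_iff_null_sets by (subst (asm) completion.AE_iff_null_sets) simp
  have "f measurable_on S" using f S by (simp add: measurable_on_iff_borel_measurable)
  then have "g measurable_on S" by (rule measurable_on_spike[OF _ neg]) auto
  then show ?thesis using S by (simp add: measurable_on_iff_borel_measurable)
qed

lemma bump_tendsto_one:
  assumes "a < x" "x < b"
  shows "(\<lambda>n. bump a b (1 / real (Suc n)) 1 0 x) \<longlonglongrightarrow> 1"
proof -
  have "(\<lambda>n. complex_of_real (exp (- (1 / real (Suc n)) / ((x - a) * (b - x))))) \<longlonglongrightarrow> of_real (exp (- 0 / ((x - a) * (b - x))))"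
    using assms by (intro tendsto_intros LIMSEQ_Suc lim_1_over_n) auto
  then show ?thesis using assms by (simp add: bump_def)
qed

lemma norm_bump_le:
  assumes "c > 0" "a < b"
  shows "norm (bump a b c r 0 x) \<le> norm (poly r (of_real x))"
  using assms by (auto simp: bump_def norm_mult intro!: mult_right_le_one_le)

text \<open>Cutoffs on \<open>(p, q)\<close> with exponent tending to \<open>0\<close> converge
  boundedly to the indicator, so \<open>g\<close> has integral zero over every compact subinterval.
  Lebesgue differentiation makes \<open>g\<close> vanish almost everywhere on each of them, and
  countably many exhaust \<open>J\<close>.\<close>

lemma locally_integrable_zero_of_test:
  assumes g: "locally_integrable J g"
    and z: "\<And>\<phi>. \<phi> \<in> test_functions J \<Longrightarrow> (LINT x|lebesgue_on J. g x * \<phi> x) = 0"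
  shows "AE x in lebesgue_on J. g x = 0"
proof -
  have int0: "integral {p..q} g = 0" if pq: "p < q" "{p..q} \<subseteq> J" for p q
  proof -
    have gi: "integrable (lebesgue_on {p..q}) g"
      using g pq by (auto simp: locally_integrable_def)
    define \<phi> where "\<phi> = (\<lambda>n. bump p q (1 / real (Suc n)) 1 0)"
    have test: "\<phi> n \<in> test_functions J" for n unfolding \<phi>_def by (intro bump_test_function) (use pq in auto)
    have cont: "continuous_on {p..q} (\<phi> n)" for n
    proof -
      have "\<phi> n differentiable at x" for x using smooth_bump[of p q "1 / real (Suc n)" 0 1 0 x] pq by (simp add: \<phi>_def)
      then show ?thesis by (simp add: continuous_at_imp_continuous_on differentiable_imp_continuous_within)
    qed
    have "(\<lambda>n. LINT x|lebesgue_on {p..q}. g x * \<phi> n x) \<longlonglongrightarrow> (LINT x|lebesgue_on {p..q}. g x)"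
    proof (rule integral_dominated_convergence[where w = "\<lambda>x. norm (g x)"])
      show "g \<in> borel_measurable (lebesgue_on {p..q})" using gi by auto
      show "integrable (lebesgue_on {p..q}) (\<lambda>x. norm (g x))" using gi by auto
      show "(\<lambda>x. g x * \<phi> n x) \<in> borel_measurable (lebesgue_on {p..q})" for n
        using gi continuous_imp_measurable_on_sets_lebesgue[OF cont[of n]] by (intro borel_measurable_times) auto
      have ae: "AE x in lebesgue_on {p..q}. x \<noteq> p \<and> x \<noteq> q"
      proof -
        have "{p, q} \<in> null_sets lebesgue" by (simp add: negligible_iff_null_sets[symmetric])
        from AE_not_in[OF this] have "AE x in lebesgue. x \<in> {p..q} \<longrightarrow> x \<noteq> p \<and> x \<noteq> q" by (rule AE_mp) (intro AE_I2, auto)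
        then show ?thesis by (subst AE_restrict_space_iff) auto
      qed
      then show "AE x in lebesgue_on {p..q}. (\<lambda>n. g x * \<phi> n x) \<longlonglongrightarrow> g x"
      proof (rule AE_mp, intro AE_I2 impI)
        fix x assume "x \<in> space (lebesgue_on {p..q})" "x \<noteq> p \<and> x \<noteq> q"
        then have "(\<lambda>n. g x * \<phi> n x) \<longlonglongrightarrow> g x * 1" unfolding \<phi>_def
          by (intro tendsto_intros bump_tendsto_one) auto
        then show "(\<lambda>n. g x * \<phi> n x) \<longlonglongrightarrow> g x" by simp
      qed
      show "AE x in lebesgue_on {p..q}. norm (g x * \<phi> n x) \<le> norm (g x)" for n
        using norm_bump_le[of "1 / real (Suc n)" p q 1] pq
        by (intro AE_I2) (auto simp: \<phi>_def norm_mult intro!: mult_right_le_one_le)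
    qed
    moreover have "(LINT x|lebesgue_on {p..q}. g x * \<phi> n x) = 0" for n
    proof -
      have "(LINT x|lebesgue_on J. g x * \<phi> n x) = (LINT x|lebesgue. indicator J x *\<^sub>R (g x * \<phi> n x))"
        by (rule integral_restrict_space) auto
      also have "\<dots> = (LINT x|lebesgue. indicator {p..q} x *\<^sub>R (g x * \<phi> n x))"
      proof (rule Bochner_Integration.integral_cong)
        fix x
        have "\<phi> n x = 0" if "x \<notin> {p..q}" using that by (auto simp: \<phi>_def bump_def)
        then show "indicator J x *\<^sub>R (g x * \<phi> n x) = indicator {p..q} x *\<^sub>R (g x * \<phi> n x)"
          using pq(2) by (cases "x \<in> {p..q}") (auto simp: indicator_def subset_iff)
      qed simp
      also have "\<dots> = (LINT x|lebesgue_on {p..q}. g x * \<phi> n x)"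
        by (rule integral_restrict_space[symmetric]) auto
      finally show ?thesis using z[OF test] by simp
    qed
    ultimately have "(LINT x|lebesgue_on {p..q}. g x) = 0" by (simp add: LIMSEQ_const_iff)
    then show ?thesis using lebesgue_integral_eq_integral[OF gi] by simp
  qed
  have neg: "negligible {x. p < x \<and> x < q \<and> g x \<noteq> 0}" if pq: "p < q" "{p..q} \<subseteq> J" for p q
  proof -
    have gi: "g integrable_on {p..q}"
      using g pq by (auto simp: locally_integrable_def intro!: integrable_on_lebesgue_on)
    \<comment> \<open>Extension by zero makes the function integrable on every box, as the
      differentiation theorem requires; for small \<open>h\<close> the averages from
      \<open>x\<close> to \<open>x + h\<close> still see only \<open>g\<close>.\<close>
    define G where "G = (\<lambda>x. if x \<in> {p..q} then g x else 0)"
    have "G integrable_on UNIV" using gi unfolding G_def by (simp only: integrable_restrict_UNIV)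
    then have "G integrable_on cbox a b" for a b by (rule integrable_on_subcbox) auto
    then obtain N where N: "negligible N" 
      "\<And>x e. x \<notin> N \<Longrightarrow> 0 < e \<Longrightarrow> \<exists>d>0. \<forall>h. 0 < h \<and> h < d \<longrightarrow>
             norm (integral (cbox x (x + h *\<^sub>R One)) G /\<^sub>R h ^ DIM(real) - G x) < e"
      using integrable_ccontinuous_explicit[of G] by metis
    have "g x = 0" if x: "x \<notin> N" "p < x" "x < q" for x
    proof (rule ccontr)
      assume "g x \<noteq> 0"
      then obtain d where d: "d > 0" "\<And>h. 0 < h \<and> h < d \<Longrightarrow>
             norm (integral (cbox x (x + h *\<^sub>R One)) G /\<^sub>R h ^ DIM(real) - G x) < norm (g x)"
        using N(2)[OF x(1), of "norm (g x)"] by auto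
      define h where "h = min d (q - x) / 2"
      have h: "0 < h" "h < d" "x + h < q" using d x by (auto simp: h_def min_def field_simps)
      have "integral (cbox x (x + h *\<^sub>R One)) G = integral {x..x + h} g"
        unfolding cbox_interval using h x by (simp, intro Henstock_Kurzweil_Integration.integral_cong) (auto simp: G_def)
      also have "\<dots> = 0" using h x by (intro int0 order_trans[OF _ pq(2)]) auto
      finally show False using d(2)[of h] h x by (simp add: G_def)
    qed
    then show ?thesis by (intro negligible_subset[OF N(1)]) auto
  qed
  have "negligible (\<Union>n. {x. 1 / real (Suc n) < x \<and> x < pi - 1 / real (Suc n) \<and> g x \<noteq> 0})"
  proof (rule negligible_countable_Union, safe)
    fix n
    show "negligible {x. 1 / real (Suc n) < x \<and> x < pi - 1 / real (Suc n) \<and> g x \<noteq> 0}"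
    proof (cases "1 / real (Suc n) < pi - 1 / real (Suc n)")
      case True
      have "{1 / real (Suc n)..pi - 1 / real (Suc n)} \<subseteq> J" 
      proof
        fix x assume "x \<in> {1 / real (Suc n)..pi - 1 / real (Suc n)}"
        moreover have "1 / real (Suc n) > 0" by simp
        ultimately show "x \<in> J" unfolding atLeastAtMost_iff greaterThanLessThan_iff by linarith
      qed
      then show ?thesis by (rule neg[OF True])
    next
      case False
      then have "{x. 1 / real (Suc n) < x \<and> x < pi - 1 / real (Suc n) \<and> g x \<noteq> 0} = {}" by auto
      then show ?thesis by (metis negligible_empty)
    qed
  qed auto
  moreover have "{x \<in> J. g x \<noteq> 0} \<subseteq> (\<Union>n. {x. 1 / real (Suc n) < x \<and> x < pi - 1 / real (Suc n) \<and> g x \<noteq> 0})"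
  proof safe
    fix x assume x: "x \<in> J" "g x \<noteq> 0"
    then obtain n where "1 / real (Suc n) < min x (pi - x)"
      using nat_approx_posE[of "min x (pi - x)"] by auto
    then show "x \<in> (\<Union>n. {x. 1 / real (Suc n) < x \<and> x < pi - 1 / real (Suc n) \<and> g x \<noteq> 0})"
      using x by auto
  qed
  ultimately have "negligible {x \<in> J. g x \<noteq> 0}" by (rule negligible_subset)
  then have "{x \<in> J. g x \<noteq> 0} \<in> null_sets lebesgue" by (simp only: negligible_iff_null_sets)
  from AE_not_in[OF this] have "AE x in lebesgue. x \<in> J \<longrightarrow> g x = 0" by (rule AE_mp) (intro AE_I2, auto)
  then show ?thesis by (subst AE_restrict_space_iff) auto
qed

subsection \<open>Weak derivatives of classically differentiable functions\<close>

abbreviation sq_integral :: "(real \<Rightarrow> complex) \<Rightarrow> real" where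
  "sq_integral f \<equiv> integral {0..pi} (\<lambda>x. (cmod (f x))\<^sup>2)"

text \<open>Derivatives are taken within the closed interval, hence one-sided at \<open>0\<close>
  and \<open>pi\<close>, so that boundary values of \<open>f\<close> and \<open>f'\<close> make
  sense. Functions of this kind, up to null sets, are the ones inserted into the pairings; for them
  all Sobolev notions become classical.\<close>

definition C1_on :: "(real \<Rightarrow> complex) \<Rightarrow> (real \<Rightarrow> complex) \<Rightarrow> bool" where
  "C1_on f f' \<longleftrightarrow> (\<forall>x\<in>{0..pi}. (f has_vector_derivative f' x) (at x within {0..pi})) \<and> continuous_on {0..pi} f'"

lemma C1_on_continuous: "C1_on f f' \<Longrightarrow> continuous_on {0..pi} f"
  unfolding C1_on_def by (meson continuous_on_vector_derivative)

lemma C1_on_integral: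
  assumes "C1_on f f'" "x \<in> {0..pi}"
  shows "integral {0..x} f' = f x - f 0"
  using assms unfolding C1_on_def
  by (intro integral_unique fundamental_theorem_of_calculus)
     (auto intro: has_vector_derivative_within_subset[where S = "{0..pi}"])

lemma C1_on_diff: "C1_on f f' \<Longrightarrow> C1_on g g' \<Longrightarrow> C1_on (\<lambda>x. f x - g x) (\<lambda>x. f' x - g' x)"
  unfolding C1_on_def by (auto intro!: derivative_intros continuous_intros)

lemma C1_on_cmult: "C1_on f f' \<Longrightarrow> C1_on (\<lambda>x. c * f x) (\<lambda>x. c * f' x)"
  unfolding C1_on_def by (auto intro!: has_vector_derivative_mult_right continuous_intros)

lemma C1_on_zero: "C1_on (\<lambda>x. 0) (\<lambda>x. 0)"
  unfolding C1_on_def by (auto intro!: derivative_intros continuous_intros)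

lemma test_functionD:
  assumes "\<phi> \<in> test_functions J"
  shows "(\<phi> has_vector_derivative vderiv \<phi> x) (at x)" "C1_on \<phi> (vderiv \<phi>)" "x \<notin> J \<Longrightarrow> \<phi> x = 0"
    "continuous_on A \<phi>" "continuous_on A (vderiv \<phi>)"
proof -
  have d0: "\<phi> differentiable at x" for x using assms unfolding test_functions_def by (auto dest: spec[of _ 0])
  have d1: "vderiv \<phi> differentiable at x" for x using assms unfolding test_functions_def by (auto dest: spec[of _ "Suc 0"])
  show 1: "(\<phi> has_vector_derivative vderiv \<phi> x) (at x)" for x
    using d0 unfolding vderiv_def by (simp add: vector_derivative_works)
  show 2: "continuous_on A (vderiv \<phi>)" for A
    by (simp add: continuous_at_imp_continuous_on differentiable_imp_continuous_within d1)
  show "continuous_on A \<phi>" 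
    by (simp add: continuous_at_imp_continuous_on differentiable_imp_continuous_within d0)
  show "C1_on \<phi> (vderiv \<phi>)" unfolding C1_on_def using 1 2 by (auto intro: has_vector_derivative_at_within)
  show "x \<notin> J \<Longrightarrow> \<phi> x = 0" using assms by (auto simp: test_functions_def)
qed

lemma locally_integrable_AE_eq:
  assumes f: "locally_integrable J f" and ae: "AE x in lebesgue_on J. f x = g x"
  shows "locally_integrable J g"
  unfolding locally_integrable_def
proof safe
  fix K :: "real set" assume K: "compact K" "K \<subseteq> J"
  have fi: "integrable (lebesgue_on K) f" using f K by (auto simp: locally_integrable_def)
  have "AE x in lebesgue. x \<in> J \<longrightarrow> f x = g x" using ae by (simp add: AE_restrict_space_iff)
  then have ae': "AE x in lebesgue_on K. f x = g x"
    using K compact_imp_closed[OF K(1)] by (subst AE_restrict_space_iff) (auto elim!: eventually_mono)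
  have "g \<in> borel_measurable (lebesgue_on K)"
    by (rule borel_measurable_lebesgue_on_AE_eq[OF _ _ ae']) (use fi K compact_imp_closed[OF K(1)] in auto)
  then show "integrable (lebesgue_on K) g" using fi ae' by (subst integrable_cong_AE[symmetric, of f]) auto
qed

lemma continuous_locally_integrable:
  assumes "continuous_on {0..pi} f"
  shows "locally_integrable J f"
  unfolding locally_integrable_def
proof safe
  fix K :: "real set" assume K: "compact K" "K \<subseteq> J"
  have "set_integrable lebesgue {0..pi} f" using absolutely_integrable_continuous_real[OF assms] .
  then have "set_integrable lebesgue K f" by (rule set_integrable_subset) (use K compact_imp_closed[OF K(1)] in auto)
  then show "integrable (lebesgue_on K) f" using K compact_imp_closed[OF K(1)]
    by (simp add: absolutely_integrable_imp_integrable)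
qed

lemma integrable_times_test:
  assumes f: "locally_integrable J f" and h: "continuous_on UNIV h" and z: "\<And>x. x \<notin> K \<Longrightarrow> h x = 0" and K: "compact K" "K \<subseteq> J"
  shows "integrable (lebesgue_on J) (\<lambda>x. f x * h x :: complex)"
proof -
  have fi: "integrable (lebesgue_on K) f" using f K by (auto simp: locally_integrable_def)
  have Ks: "K \<in> sets lebesgue" using compact_imp_closed[OF K(1)] by auto
  have "bounded (h ` K)" by (intro compact_imp_bounded compact_continuous_image continuous_on_subset[OF h] K) auto
  then obtain B where B: "\<And>x. x \<in> K \<Longrightarrow> norm (h x) \<le> B" by (auto simp: bounded_iff)
  have "integrable (lebesgue_on K) (\<lambda>x. f x * h x)"
  proof (rule Bochner_Integration.integrable_bound)
    show "integrable (lebesgue_on K) (\<lambda>x. B *\<^sub>R f x)" using fi by auto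
    show "(\<lambda>x. f x * h x) \<in> borel_measurable (lebesgue_on K)"
      using fi continuous_imp_measurable_on_sets_lebesgue[OF continuous_on_subset[OF h], of K] Ks by (intro borel_measurable_times) auto
    show "AE x in lebesgue_on K. norm (f x * h x) \<le> norm (B *\<^sub>R f x)"
    proof (intro AE_I2)
      fix x assume "x \<in> space (lebesgue_on K)"
      then have "norm (h x) \<le> B" using B by simp
      then show "norm (f x * h x) \<le> norm (B *\<^sub>R f x)"
        by (simp add: norm_mult) (metis abs_ge_self mult.commute mult_right_mono norm_ge_zero order_trans)
    qed
  qed
  then have "integrable lebesgue (\<lambda>x. indicator K x *\<^sub>R (f x * h x))"
    using Ks by (subst (asm) integrable_restrict_space) auto
  moreover have "(\<lambda>x. indicator K x *\<^sub>R (f x * h x)) = (\<lambda>x. indicator J x *\<^sub>R (f x * h x))"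
    using z K by (auto simp: indicator_def fun_eq_iff)
  ultimately show ?thesis by (subst integrable_restrict_space) auto
qed

text \<open>The difference of the two weak derivatives annihilates all test functions, so the
  fundamental lemma applies. Here \<open>f\<close> and \<open>f'\<close> are two representatives of
  one class; the prime does not denote a derivative.\<close>

lemma has_weak_deriv_unique:
  assumes 1: "has_weak_deriv J f g" and 2: "has_weak_deriv J f' g'" and ae: "AE x in lebesgue_on J. f x = f' x"
  shows "AE x in lebesgue_on J. g x = g' x"
proof -
  have li: "locally_integrable J f" "locally_integrable J f'" "locally_integrable J g" "locally_integrable J g'"
    using 1 2 by (auto simp: has_weak_deriv_def)
  have "AE x in lebesgue_on J. g x - g' x = 0"
  proof (rule locally_integrable_zero_of_test)
    show "locally_integrable J (\<lambda>x. g x - g' x)" using li by (auto simp: locally_integrable_def)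
    fix \<phi> assume \<phi>: "\<phi> \<in> test_functions J"
    then obtain K where K: "compact K" "K \<subseteq> J" "\<And>x. x \<notin> K \<Longrightarrow> \<phi> x = 0" by (auto simp: test_functions_def)
    have dz: "vderiv \<phi> x = 0" if "x \<notin> K" for x
    proof -
      have "((\<lambda>x. 0) has_vector_derivative 0) (at x)" by simp
      then have "(\<phi> has_vector_derivative 0) (at x)"
        by (rule has_vector_derivative_transform_within_open[where S = "- K"])
           (use K that compact_imp_closed[OF K(1)] in auto)
      then show ?thesis unfolding vderiv_def by (rule vector_derivative_at)
    qed
    note c = test_functionD(4,5)[OF \<phi>, of UNIV]
    have i: "integrable (lebesgue_on J) (\<lambda>x. g x * \<phi> x)" "integrable (lebesgue_on J) (\<lambda>x. g' x * \<phi> x)"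
      by (rule integrable_times_test[OF _ c(1) K(3) K(1,2)]; use li in auto)+
    have j: "integrable (lebesgue_on J) (\<lambda>x. f x * vderiv \<phi> x)" "integrable (lebesgue_on J) (\<lambda>x. f' x * vderiv \<phi> x)"
      by (rule integrable_times_test[OF _ c(2) dz K(1,2)]; use li in auto)+
    have "(LINT x|lebesgue_on J. f x * vderiv \<phi> x) = (LINT x|lebesgue_on J. f' x * vderiv \<phi> x)"
      by (rule integral_cong_AE) (use j ae in \<open>auto elim!: eventually_mono\<close>)
    then have "(LINT x|lebesgue_on J. g x * \<phi> x) = (LINT x|lebesgue_on J. g' x * \<phi> x)"
      using 1 2 \<phi> by (auto simp: has_weak_deriv_def)
    then show "(LINT x|lebesgue_on J. (g x - g' x) * \<phi> x) = 0"
      using i by (simp add: left_diff_distrib)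
  qed
  then show ?thesis by auto
qed

lemma C1_on_has_weak_deriv:
  assumes c: "C1_on f f'" and g: "AE x in lebesgue_on J. f x = g x" and g': "AE x in lebesgue_on J. f' x = g' x"
  shows "has_weak_deriv J g g'"
  unfolding has_weak_deriv_def
proof (intro conjI ballI)
  have cf: "continuous_on {0..pi} f" "continuous_on {0..pi} f'"
    using C1_on_continuous[OF c] c by (auto simp: C1_on_def)
  show l1: "locally_integrable J g" by (rule locally_integrable_AE_eq[OF _ g]) (rule continuous_locally_integrable[OF cf(1)])
  show l2: "locally_integrable J g'" by (rule locally_integrable_AE_eq[OF _ g']) (rule continuous_locally_integrable[OF cf(2)])
  fix \<phi> assume \<phi>: "\<phi> \<in> test_functions J"
  have cp: "continuous_on {0..pi} \<phi>" "continuous_on {0..pi} (vderiv \<phi>)" by (rule test_functionD[OF \<phi>])+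
  have g_m: "g \<in> borel_measurable (lebesgue_on J)" "g' \<in> borel_measurable (lebesgue_on J)"
    by (rule borel_measurable_lebesgue_on_AE_eq[OF _ _ g]; use LINT_open_interval[OF cf(1)] in auto)
       (rule borel_measurable_lebesgue_on_AE_eq[OF _ _ g']; use LINT_open_interval[OF cf(2)] in auto)
  have p_m: "\<phi> \<in> borel_measurable (lebesgue_on J)" "vderiv \<phi> \<in> borel_measurable (lebesgue_on J)"
    using LINT_open_interval[OF cp(1)] LINT_open_interval[OF cp(2)] by auto
  have f_m: "f \<in> borel_measurable (lebesgue_on J)" "f' \<in> borel_measurable (lebesgue_on J)"
    using LINT_open_interval[OF cf(1)] LINT_open_interval[OF cf(2)] by auto
  have "((\<lambda>x. f x * vderiv \<phi> x + f' x * \<phi> x) has_integral (f pi * \<phi> pi - f 0 * \<phi> 0)) {0..pi}"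
    using c test_functionD(2)[OF \<phi>] unfolding C1_on_def
    by (intro fundamental_theorem_of_calculus has_vector_derivative_mult) auto
  then have "integral {0..pi} (\<lambda>x. f x * vderiv \<phi> x + f' x * \<phi> x) = 0"
    using test_functionD(3)[OF \<phi>, of 0] test_functionD(3)[OF \<phi>, of pi] by (simp add: integral_unique)
  then have "integral {0..pi} (\<lambda>x. f x * vderiv \<phi> x) + integral {0..pi} (\<lambda>x. f' x * \<phi> x) = 0"
    using cf cp by (subst (asm) Henstock_Kurzweil_Integration.integral_add) (auto intro!: integrable_continuous_real continuous_intros)
  moreover have "(LINT x|lebesgue_on J. g x * vderiv \<phi> x) = (LINT x|lebesgue_on J. f x * vderiv \<phi> x)"
    using g g_m p_m f_m by (intro integral_cong_AE) (auto elim!: eventually_mono)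
  moreover have "(LINT x|lebesgue_on J. g' x * \<phi> x) = (LINT x|lebesgue_on J. f' x * \<phi> x)"
    using g' g_m p_m f_m by (intro integral_cong_AE) (auto elim!: eventually_mono)
  ultimately show "(LINT x|lebesgue_on J. g x * vderiv \<phi> x) = - (LINT x|lebesgue_on J. g' x * \<phi> x)"
    using cf cp by (simp add: LINT_open_interval continuous_intros eq_neg_iff_add_eq_0)
qed

text \<open>Once some weak derivative exists, the choice operator picks a genuine one, and
  uniqueness identifies it with the classical derivative.\<close>

lemma C1_on_weak_deriv:
  assumes c: "C1_on f f'" and g: "AE x in lebesgue_on J. f x = g x"
  shows "AE x in lebesgue_on J. f' x = weak_deriv J g x"
proof -
  have w: "has_weak_deriv J g f'" by (rule C1_on_has_weak_deriv[OF c g]) auto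
  then have "has_weak_deriv J g (weak_deriv J g)" unfolding weak_deriv_def by (rule someI[of "has_weak_deriv J g"])
  from has_weak_deriv_unique[OF w this] show ?thesis by simp
qed

lemma C1_on_sobolev_norm:
  assumes c: "C1_on f f'" and g: "AE x in lebesgue_on J. f x = g x"
  shows "sobolev_norm J g = sqrt (sq_integral f + sq_integral f')"
proof -
  have cf: "continuous_on {0..pi} f" "continuous_on {0..pi} f'"
    using C1_on_continuous[OF c] c by (auto simp: C1_on_def)
  have f_m: "f \<in> borel_measurable (lebesgue_on J)" "f' \<in> borel_measurable (lebesgue_on J)"
    using LINT_open_interval[OF cf(1)] LINT_open_interval[OF cf(2)] by auto
  note w = C1_on_weak_deriv[OF c g]
  have m: "g \<in> borel_measurable (lebesgue_on J)" "weak_deriv J g \<in> borel_measurable (lebesgue_on J)"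
    by (rule borel_measurable_lebesgue_on_AE_eq[OF f_m(1) _ g] borel_measurable_lebesgue_on_AE_eq[OF f_m(2) _ w]; simp)+
  have "(LINT x|lebesgue_on J. (cmod (g x))\<^sup>2) = (LINT x|lebesgue_on J. (cmod (f x))\<^sup>2)"
    using g m f_m by (intro integral_cong_AE) (auto elim!: eventually_mono)
  moreover have "(LINT x|lebesgue_on J. (cmod (weak_deriv J g x))\<^sup>2) = (LINT x|lebesgue_on J. (cmod (f' x))\<^sup>2)"
    using w m f_m by (intro integral_cong_AE) (auto elim!: eventually_mono)
  ultimately show ?thesis using cf by (simp add: sobolev_norm_def LINT_open_interval continuous_intros)
qed

lemma continuous_L2:
  fixes f g :: "real \<Rightarrow> complex"
  assumes c: "continuous_on {0..pi} f" and g: "AE x in lebesgue_on J. f x = g x"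
  shows "g \<in> L2 J"
proof -
  have f_m: "f \<in> borel_measurable (lebesgue_on J)" using LINT_open_interval[OF c] by auto
  have m: "g \<in> borel_measurable (lebesgue_on J)"
    by (rule borel_measurable_lebesgue_on_AE_eq[OF f_m _ g]) simp
  have "integrable (lebesgue_on J) (\<lambda>x. (cmod (f x))\<^sup>2)"
    by (intro LINT_open_interval continuous_intros c)
  then have "integrable (lebesgue_on J) (\<lambda>x. (cmod (g x))\<^sup>2)"
    using g m f_m by (subst integrable_cong_AE[where g = "\<lambda>x. (cmod (f x))\<^sup>2"]) (auto elim!: eventually_mono)
  then show ?thesis using m by (simp add: L2_def)
qed

section \<open>Polynomial approximation and density of test functions\<close>

lemma Weierstrass_real_poly:
  assumes "continuous_on {a..b} f" "e > 0"
  obtains p :: "real poly" where "\<And>x. x \<in> {a..b} \<Longrightarrow> \<bar>f x - poly p x\<bar> < e"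
proof -
  obtain g where g: "polynomial_function g" "\<And>x. x \<in> {a..b} \<Longrightarrow> norm (f x - g x) < e"
    using Stone_Weierstrass_polynomial_function[OF _ assms] by auto
  then have "real_polynomial_function g" by (simp add: real_polynomial_function_eq)
  then obtain c n where "g = (\<lambda>x. \<Sum>i\<le>n. c i * x ^ i)" by (auto simp: real_polynomial_function_iff_sum)
  then have "g x = poly (\<Sum>i\<le>n. monom (c i) i) x" for x by (simp add: poly_sum poly_monom)
  then show ?thesis using that g by auto
qed

lemma Weierstrass_complex_poly:
  fixes f :: "real \<Rightarrow> complex"
  assumes "continuous_on {a..b} f" "e > 0"
  obtains p :: "complex poly" where "\<And>x. x \<in> {a..b} \<Longrightarrow> norm (f x - poly p (of_real x)) < e"
proof -
  obtain p where p: "\<And>x. x \<in> {a..b} \<Longrightarrow> \<bar>Re (f x) - poly p x\<bar> < e / 2"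
    using Weierstrass_real_poly[of a b "\<lambda>x. Re (f x)" "e / 2"] assms by (auto intro: continuous_intros)
  obtain q where q: "\<And>x. x \<in> {a..b} \<Longrightarrow> \<bar>Im (f x) - poly q x\<bar> < e / 2"
    using Weierstrass_real_poly[of a b "\<lambda>x. Im (f x)" "e / 2"] assms by (auto intro: continuous_intros)
  define P where "P = map_poly of_real p + [:\<i>:] * map_poly of_real q"
  have "poly (map_poly of_real p) (of_real x) = complex_of_real (poly p x)" for p x
    by (induction p) (auto simp: map_poly_pCons)
  then have "poly P (of_real x) = Complex (poly p x) (poly q x)" for x
    by (simp add: P_def complex_eq_iff)
  then have "norm (f x - poly P (of_real x)) < e" if "x \<in> {a..b}" for x
    using p[OF that] q[OF that] cmod_le[of "f x - poly P (of_real x)"] by simp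
  then show ?thesis using that by blast
qed

text \<open>Cauchy-Schwarz against the constant \<open>1\<close>, obtained by expanding the
  nonnegative variance of \<open>norm (h x)\<close> about its mean \<open>m\<close>.\<close>

lemma integral_norm_power2_le:
  fixes h :: "real \<Rightarrow> complex"
  assumes h: "continuous_on {a..b} h" and ab: "a \<le> b"
  shows "(integral {a..b} (\<lambda>x. norm (h x)))\<^sup>2 \<le> (b - a) * integral {a..b} (\<lambda>x. (norm (h x))\<^sup>2)"
proof (cases "a = b")
  case False
  define m where "m = integral {a..b} (\<lambda>x. norm (h x)) / (b - a)"
  have i: "(\<lambda>x. norm (h x)) integrable_on {a..b}" "(\<lambda>x. (norm (h x))\<^sup>2) integrable_on {a..b}"
    using h by (auto intro!: integrable_continuous_real continuous_intros)
  have "0 \<le> integral {a..b} (\<lambda>x. (norm (h x) - m)\<^sup>2)"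
    by (intro integral_nonneg integrable_continuous_real continuous_intros h) auto
  also have "\<dots> = integral {a..b} (\<lambda>x. (norm (h x))\<^sup>2 - (2 * m) * norm (h x) + m\<^sup>2)"
    by (simp add: power2_diff algebra_simps)
  also have "\<dots> = integral {a..b} (\<lambda>x. (norm (h x))\<^sup>2) - 2 * m * integral {a..b} (\<lambda>x. norm (h x)) + m\<^sup>2 * (b - a)"
    using i ab by (subst Henstock_Kurzweil_Integration.integral_add Henstock_Kurzweil_Integration.integral_diff Henstock_Kurzweil_Integration.integral_mult_right;
       (intro integrable_diff integrable_on_mult_right integrable_const_ivl)?; simp)+
  also have "\<dots> = integral {a..b} (\<lambda>x. (norm (h x))\<^sup>2) - (integral {a..b} (\<lambda>x. norm (h x)))\<^sup>2 / (b - a)"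
  proof -
    have "m * (b - a) = integral {a..b} (\<lambda>x. norm (h x))" using False ab by (simp add: m_def)
    then have "2 * m * integral {a..b} (\<lambda>x. norm (h x)) - m\<^sup>2 * (b - a) = m * integral {a..b} (\<lambda>x. norm (h x))"
      by (simp add: power2_eq_square algebra_simps)
    also have "\<dots> = (integral {a..b} (\<lambda>x. norm (h x)))\<^sup>2 / (b - a)" by (simp add: m_def power2_eq_square)
    finally show ?thesis by simp
  qed
  finally show ?thesis using False ab by (simp add: field_simps)
qed simp

text \<open>A uniform polynomial approximation is cut off near the ends. The product of polynomial
  and cutoff is itself a \<open>bump\<close>, so its smoothness is already available, and dominated
  convergence removes the cutoff.\<close>

lemma test_approx_L2:
  assumes f: "continuous_on {0..pi} f" and e: "e > 0"
  obtains \<eta> where "\<eta> \<in> test_functions J" "sq_integral (\<lambda>x. f x - \<eta> x) < e"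
proof -
  \<comment> \<open>The uniform error contributes \<open>2 * d\<^sup>2 * pi = e / 4\<close>, the
    cutoff less than \<open>2 * (e / 4)\<close>; together they stay below \<open>e\<close>.\<close>
  define d where "d = sqrt (e / (8 * pi))"
  have d: "d > 0" "d\<^sup>2 = e / (8 * pi)" using e by (auto simp: d_def)
  obtain p where p: "\<And>x. x \<in> {0..pi} \<Longrightarrow> norm (f x - poly p (of_real x)) < d"
    using Weierstrass_complex_poly[OF f d(1)] by metis
  define P where "P = (\<lambda>x. poly p (complex_of_real x))"
  \<comment> \<open>One sequence serves both as the margin of the support and as the exponent of the
    cutoff. Its values are at most \<open>1 / 2\<close>, so the support never degenerates.\<close>
  define \<epsilon> where "\<epsilon> = (\<lambda>n. 1 / real (Suc n + 1))"
  have \<epsilon>: "\<epsilon> n > 0" "\<epsilon> n \<le> 1 / 2" for n by (auto simp: \<epsilon>_def field_simps)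
  define \<eta> where "\<eta> = (\<lambda>n. bump (\<epsilon> n) (pi - \<epsilon> n) (\<epsilon> n) p 0)"
  have lt: "\<epsilon> n < pi - \<epsilon> n" for n using \<epsilon>(2)[of n] pi_gt3 by linarith
  have test: "\<eta> n \<in> test_functions J" for n
    unfolding \<eta>_def by (intro bump_test_function) (use \<epsilon>(1)[of n] lt in auto)
  have cP: "continuous_on A P" for A unfolding P_def by (intro continuous_intros)
  have "compact (P ` {0..pi})" by (intro compact_continuous_image cP) auto
  then obtain M where M: "\<And>x. x \<in> {0..pi} \<Longrightarrow> norm (P x) \<le> M"
    by (metis compact_imp_bounded bounded_iff image_eqI)
  have "(\<lambda>n. LINT x|lebesgue_on J. (cmod (P x - \<eta> n x))\<^sup>2) \<longlonglongrightarrow> (LINT x|lebesgue_on J. 0)"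
  proof (rule integral_dominated_convergence[where w = "\<lambda>x. (2 * M)\<^sup>2"])
    show "(\<lambda>x. (cmod (P x - \<eta> n x))\<^sup>2) \<in> borel_measurable (lebesgue_on J)" for n
      by (intro borel_measurable_integrable LINT_open_interval(1) continuous_intros cP test_functionD(4)[OF test])
    show "integrable (lebesgue_on J) (\<lambda>x. (2 * M)\<^sup>2)" by (rule LINT_open_interval) auto
    show "AE x in lebesgue_on J. (\<lambda>n. (cmod (P x - \<eta> n x))\<^sup>2) \<longlonglongrightarrow> 0"
    proof (intro AE_I2)
      fix x assume "x \<in> space (lebesgue_on J)"
      then have x: "0 < x" "x < pi" by auto
      have \<epsilon>0: "\<epsilon> \<longlonglongrightarrow> 0" unfolding \<epsilon>_def using LIMSEQ_Suc[OF LIMSEQ_Suc[OF lim_1_over_n]] by simp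
      have "(\<lambda>n. (cmod (P x - P x * of_real (exp (- \<epsilon> n / ((x - \<epsilon> n) * (pi - \<epsilon> n - x))))))\<^sup>2)
         \<longlonglongrightarrow> (cmod (P x - P x * of_real (exp (- 0 / ((x - 0) * (pi - 0 - x))))))\<^sup>2"
        using x by (intro tendsto_intros \<epsilon>0) auto
      moreover have "\<forall>\<^sub>F n in sequentially. \<epsilon> n < min x (pi - x)"
        using order_tendstoD(2)[OF \<epsilon>0, of "min x (pi - x)"] x by auto
      then have "\<forall>\<^sub>F n in sequentially. (cmod (P x - P x * of_real (exp (- \<epsilon> n / ((x - \<epsilon> n) * (pi - \<epsilon> n - x))))))\<^sup>2 = (cmod (P x - \<eta> n x))\<^sup>2"
        by (rule eventually_mono) (auto simp: \<eta>_def bump_def P_def)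
      ultimately have "(\<lambda>n. (cmod (P x - \<eta> n x))\<^sup>2) \<longlonglongrightarrow> (cmod (P x - P x * of_real (exp (- 0 / ((x - 0) * (pi - 0 - x))))))\<^sup>2"
        by (rule Lim_transform_eventually)
      then show "(\<lambda>n. (cmod (P x - \<eta> n x))\<^sup>2) \<longlonglongrightarrow> 0" by simp
    qed
    show "AE x in lebesgue_on J. norm ((cmod (P x - \<eta> n x))\<^sup>2) \<le> (2 * M)\<^sup>2" for n
    proof (intro AE_I2)
      fix x assume "x \<in> space (lebesgue_on J)"
      then have x: "x \<in> {0..pi}" by auto
      have "cmod (P x - \<eta> n x) \<le> cmod (P x) + cmod (\<eta> n x)" by (rule norm_triangle_ineq4)
      also have "cmod (\<eta> n x) \<le> cmod (P x)" unfolding \<eta>_def P_def using \<epsilon>(1)[of n] lt by (intro norm_bump_le) auto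
      finally have "cmod (P x - \<eta> n x) \<le> 2 * M" using M[OF x] by simp
      then have "(cmod (P x - \<eta> n x))\<^sup>2 \<le> (2 * M)\<^sup>2" by (intro power_mono) auto
      then show "norm ((cmod (P x - \<eta> n x))\<^sup>2) \<le> (2 * M)\<^sup>2" by simp
    qed
  qed auto
  then have "\<forall>\<^sub>F n in sequentially. (LINT x|lebesgue_on J. (cmod (P x - \<eta> n x))\<^sup>2) < e / 4"
    using e by (intro order_tendstoD(2)[where y = 0]) auto
  then obtain n where "(LINT x|lebesgue_on J. (cmod (P x - \<eta> n x))\<^sup>2) < e / 4"
    by (auto simp: eventually_sequentially)
  then have n: "sq_integral (\<lambda>x. P x - \<eta> n x) < e / 4"
    using test_functionD(4)[OF test] by (subst (asm) LINT_open_interval(2)) (auto intro!: continuous_intros cP)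
  have "sq_integral (\<lambda>x. f x - \<eta> n x) \<le> integral {0..pi} (\<lambda>x. 2 * d\<^sup>2 + 2 * (cmod (P x - \<eta> n x))\<^sup>2)"
  proof (rule integral_le)
    show "(\<lambda>x. (cmod (f x - \<eta> n x))\<^sup>2) integrable_on {0..pi}" "(\<lambda>x. 2 * d\<^sup>2 + 2 * (cmod (P x - \<eta> n x))\<^sup>2) integrable_on {0..pi}"
      using test_functionD(4)[OF test] by (auto intro!: integrable_continuous_real continuous_intros cP f)
    fix x assume x: "x \<in> {0..pi}"
    have "(cmod (f x - P x))\<^sup>2 \<le> d\<^sup>2" using p[OF x] by (intro power_mono) (auto simp: P_def)
    then show "(cmod (f x - \<eta> n x))\<^sup>2 \<le> 2 * d\<^sup>2 + 2 * (cmod (P x - \<eta> n x))\<^sup>2"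
      using norm_diff_power2_le[of "f x" "\<eta> n x" "P x"] by linarith
  qed
  also have "\<dots> = 2 * d\<^sup>2 * pi + 2 * sq_integral (\<lambda>x. P x - \<eta> n x)"
    using test_functionD(4)[OF test]
    by (subst Henstock_Kurzweil_Integration.integral_add) (auto intro!: integrable_continuous_real continuous_intros cP)
  also have "\<dots> < e"
  proof -
    have "2 * d\<^sup>2 * pi = e / 4" using d(2) by simp
    then show ?thesis using n e by linarith
  qed
  finally show ?thesis using that test by blast
qed

lemma test_functions_diff:
  assumes f: "f \<in> test_functions I" and g: "g \<in> test_functions I"
  shows "(\<lambda>x. f x - c * g x) \<in> test_functions I"
proof -
  have d: "((vderiv ^^ n) f has_vector_derivative (vderiv ^^ Suc n) f x) (at x)"
     "((vderiv ^^ n) g has_vector_derivative (vderiv ^^ Suc n) g x) (at x)" for n x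
  proof -
    have "((vderiv ^^ n) f) differentiable (at x)" "((vderiv ^^ n) g) differentiable (at x)"
      using f g unfolding test_functions_def by blast+
    then show "((vderiv ^^ n) f has_vector_derivative (vderiv ^^ Suc n) f x) (at x)"
      "((vderiv ^^ n) g has_vector_derivative (vderiv ^^ Suc n) g x) (at x)"
      unfolding vector_derivative_works by (simp_all only: funpow.simps o_apply vderiv_def)
  qed
  have eq: "(vderiv ^^ n) (\<lambda>x. f x - c * g x) = (\<lambda>x. (vderiv ^^ n) f x - c * (vderiv ^^ n) g x)" for n
  proof (induction n)
    case (Suc n)
    have "vderiv (\<lambda>x. (vderiv ^^ n) f x - c * (vderiv ^^ n) g x) x = (vderiv ^^ Suc n) f x - c * (vderiv ^^ Suc n) g x" for x
      unfolding vderiv_def[of "\<lambda>x. (vderiv ^^ n) f x - c * (vderiv ^^ n) g x"]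
      by (intro vector_derivative_at has_vector_derivative_diff has_vector_derivative_mult_right d)
    then show ?case by (simp add: Suc fun_eq_iff del: o_apply) (simp add: Suc)
  qed simp
  have "((vderiv ^^ n) (\<lambda>x. f x - c * g x)) differentiable (at x)" for n x
    unfolding eq by (rule differentiableI_vector, rule has_vector_derivative_diff[OF d(1) has_vector_derivative_mult_right[OF d(2)]])
  moreover obtain K where K: "compact K" "K \<subseteq> I" "\<forall>x. x \<notin> K \<longrightarrow> f x = 0"
    using f unfolding test_functions_def by blast
  moreover obtain L where L: "compact L" "L \<subseteq> I" "\<forall>x. x \<notin> L \<longrightarrow> g x = 0"
    using g unfolding test_functions_def by blast
  have "compact (K \<union> L) \<and> K \<union> L \<subseteq> I \<and> (\<forall>x. x \<notin> K \<union> L \<longrightarrow> f x - c * g x = 0)" using K L by auto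
  ultimately show ?thesis unfolding test_functions_def by blast
qed

text \<open>The zero mean is what makes the support of the primitive compact: the primitive is
  constant on either side of the support of \<open>h\<close>, is \<open>0\<close> at
  \<open>0\<close>, and returns to \<open>0\<close> at \<open>pi\<close>.\<close>

lemma test_function_antiderivative:
  assumes h: "h \<in> test_functions J" and z: "integral {0..pi} h = 0"
  obtains \<phi> where "\<phi> \<in> test_functions J" "vderiv \<phi> = h"
proof -
  obtain K where K: "compact K" "K \<subseteq> J" "\<And>x. x \<notin> K \<Longrightarrow> h x = 0"
    using h by (auto simp: test_functions_def)
  have "\<exists>F. \<forall>x. -\<infinity> < ereal x \<longrightarrow> ereal x < \<infinity> \<longrightarrow> (F has_vector_derivative h x) (at x)"
    using test_functionD(4)[OF h, of UNIV]
    by (intro einterval_antiderivative) (auto simp: continuous_on_eq_continuous_at)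
  then obtain F where F: "\<And>x. (F has_vector_derivative h x) (at x)" by auto
  define \<phi> where "\<phi> = (\<lambda>x. F x - F 0)"
  have d\<phi>: "(\<phi> has_vector_derivative h x) (at x)" for x unfolding \<phi>_def
    by (auto intro!: derivative_eq_intros F)
  then have v: "vderiv \<phi> = h" by (auto simp: vderiv_def vector_derivative_at)
  obtain p q where pq: "0 < p" "p < q" "q < pi" "K \<subseteq> {p<..<q}"
  proof (cases "K = {}")
    case True
    then show ?thesis using that[of 1 2] pi_gt3 by auto
  next
    case False
    define p where "p = Inf K" define q where "q = Sup K"
    have pK: "p \<in> K" "q \<in> K" unfolding p_def q_def
      using K(1) False by (auto intro!: closed_contains_Inf closed_contains_Sup compact_imp_closed bounded_imp_bdd_below bounded_imp_bdd_above compact_imp_bounded)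
    have "K \<subseteq> {p..q}" unfolding p_def q_def
      using K(1) by (auto intro!: cInf_lower cSup_upper bounded_imp_bdd_below bounded_imp_bdd_above compact_imp_bounded)
    have J: "p \<in> J" "q \<in> J" using pK K(2) by blast+
    have "K \<subseteq> {p / 2<..<(q + pi) / 2}" by (rule order_trans[OF \<open>K \<subseteq> {p..q}\<close>]) (use J in auto)
    moreover have "p \<le> q" using pK \<open>K \<subseteq> {p..q}\<close> by auto
    ultimately show ?thesis using that[of "p / 2" "(q + pi) / 2"] J by auto
  qed
  have "(\<phi> has_vector_derivative 0) (at x within {..p})" if "x \<in> {..p}" for x
  proof -
    have "x \<notin> {p<..<q}" using that by auto
    then have "h x = 0" using K(3)[of x] pq(4) by blast
    then show ?thesis using d\<phi>[of x] by (simp add: has_vector_derivative_at_within)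
  qed
  then obtain c where c: "\<And>x. x \<in> {..p} \<Longrightarrow> \<phi> x = c"
    using has_vector_derivative_zero_constant[of "{..p}" \<phi>] by blast
  have "(\<phi> has_vector_derivative 0) (at x within {q..})" if "x \<in> {q..}" for x
  proof -
    have "x \<notin> {p<..<q}" using that by auto
    then have "h x = 0" using K(3)[of x] pq(4) by blast
    then show ?thesis using d\<phi>[of x] by (simp add: has_vector_derivative_at_within)
  qed
  then obtain c' where c': "\<And>x. x \<in> {q..} \<Longrightarrow> \<phi> x = c'"
    using has_vector_derivative_zero_constant[of "{q..}" \<phi>] by blast
  have "(h has_integral (\<phi> pi - \<phi> 0)) {0..pi}"
    by (rule fundamental_theorem_of_calculus) (use has_vector_derivative_at_within[OF d\<phi>] in auto)
  then have "\<phi> pi = \<phi> 0" using z by (simp add: has_integral_iff)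
  moreover have "\<phi> 0 = 0" by (simp add: \<phi>_def)
  ultimately have "c = 0" "c' = 0" using c[of 0] c'[of pi] pq by auto
  then have supp: "\<phi> x = 0" if "x \<notin> {p..q}" for x
    using that c[of x] c'[of x] by (cases "x \<le> p") auto
  have "((vderiv ^^ n) \<phi>) differentiable (at x)" for n x
  proof (cases n)
    case 0
    then show ?thesis using d\<phi> by (auto intro: differentiableI_vector)
  next
    case (Suc k)
    then show ?thesis using h v by (simp add: funpow_Suc_right test_functions_def del: funpow.simps)
  qed
  then have "\<phi> \<in> test_functions J"
    unfolding test_functions_def using supp pq by (auto intro!: exI[of _ "{p..q}"])
  then show ?thesis using that v by blast
qed

text \<open>The approximation is made on the derivative: \<open>f'\<close> is approximated by a test
  function in the mean square, the mean of the latter is corrected by a multiple of a fixed cutoff,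
  and the result is integrated. The boundary values enter through the zero mean of
  \<open>f'\<close>.\<close>

lemma AE_eq_sobolev_10:
  assumes c: "C1_on f f'" and z: "f 0 = 0" "f pi = 0" and g: "AE x in lebesgue_on J. f x = g x"
  shows "g \<in> sobolev_10 J"
proof -
  have cf: "continuous_on {0..pi} f" "continuous_on {0..pi} f'"
    using C1_on_continuous[OF c] c by (auto simp: C1_on_def)
  have "g \<in> sobolev 1 J"
    using continuous_L2[OF cf(1) g] continuous_L2[OF cf(2), of f'] C1_on_has_weak_deriv[OF c g, of f'] by auto
  moreover have approx: "\<exists>\<phi>\<in>test_functions J. sobolev_norm J (\<lambda>x. g x - \<phi> x) < e" if e: "e > 0" for e
  proof -
    \<comment> \<open>Any fixed test function with nonzero integral would serve for the correction
      of the mean.\<close>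
    define b where "b = bump 1 2 1 1 0"
    have b: "b \<in> test_functions J" unfolding b_def by (intro bump_test_function) (use pi_gt3 in auto)
    note cb = test_functionD(4)[OF b]
    define B where "B = integral {0..pi} b"
    define N where "N = sq_integral b"
    have "B \<noteq> 0"
    proof
      assume "B = 0"
      have "Re B = integral {0..pi} (\<lambda>x. Re (b x))" unfolding B_def
        using integral_linear[OF integrable_continuous_real[OF cb] bounded_linear_Re] by (simp add: o_def)
      moreover have "Re (b x) \<ge> 0" for x by (auto simp: b_def bump_def)
      ultimately have "\<forall>x\<in>{0..pi}. Re (b x) = 0" using \<open>B = 0\<close> cb
        by (subst integral_eq_0_iff[symmetric]) (auto intro!: continuous_intros)
      then have "Re (b (3/2)) = 0" using pi_gt3 by auto
      then show False by (simp add: b_def bump_def)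
    qed
    \<comment> \<open>\<open>A\<close> accounts for the correction of the mean and
      \<open>1 + pi\<^sup>2\<close> for the passage from the derivative to the full norm; with
      \<open>d\<close> as below the total is exactly \<open>e\<^sup>2\<close>.\<close>
    define A where "A = 1 + pi * N / (cmod B)\<^sup>2"
    have N: "N \<ge> 0" unfolding N_def by (intro integral_nonneg integrable_continuous_real continuous_intros cb) auto
    have "A > 0" using N by (auto simp: A_def intro!: add_pos_nonneg)
    define d where "d = e\<^sup>2 / ((1 + pi\<^sup>2) * (2 * A))"
    have d: "d > 0" using e \<open>A > 0\<close> by (auto simp: d_def intro!: divide_pos_pos mult_pos_pos add_pos_pos)
    obtain \<eta> where \<eta>: "\<eta> \<in> test_functions J" "sq_integral (\<lambda>x. f' x - \<eta> x) < d"
      using test_approx_L2[OF cf(2) d] .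
    note c\<eta> = test_functionD(4)[OF \<eta>(1)]
    define m where "m = integral {0..pi} \<eta>"
    define h where "h = (\<lambda>x. \<eta> x - (m / B) * b x)"
    have h: "h \<in> test_functions J" unfolding h_def by (rule test_functions_diff[OF \<eta>(1) b])
    have "integral {0..pi} h = 0"
      unfolding h_def using cb c\<eta> \<open>B \<noteq> 0\<close>
      by (subst Henstock_Kurzweil_Integration.integral_diff)
         (auto intro!: integrable_continuous_real continuous_intros simp: B_def[symmetric] m_def[symmetric])
    then obtain \<phi> where \<phi>: "\<phi> \<in> test_functions J" "vderiv \<phi> = h"
      using test_function_antiderivative[OF h] by metis
    have ch: "continuous_on S h" for S by (rule test_functionD(4)[OF h])
    have c': "C1_on (\<lambda>x. f x - \<phi> x) (\<lambda>x. f' x - h x)"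
      using C1_on_diff[OF c test_functionD(2)[OF \<phi>(1)]] \<phi>(2) by simp
    define I where "I = sq_integral (\<lambda>x. f' x - h x)"
    \<comment> \<open>Since \<open>f'\<close> has mean zero, the mean of \<open>\<eta>\<close> is
      the mean of the approximation error and is therefore small.\<close>
    have m: "(cmod m)\<^sup>2 \<le> pi * sq_integral (\<lambda>x. f' x - \<eta> x)"
    proof -
      have "integral {0..pi} f' = 0" using C1_on_integral[OF c, of pi] z by simp
      then have "m = - integral {0..pi} (\<lambda>x. f' x - \<eta> x)" unfolding m_def using cf c\<eta>
        by (subst Henstock_Kurzweil_Integration.integral_diff) (auto intro!: integrable_continuous_real)
      then have "cmod m \<le> integral {0..pi} (\<lambda>x. cmod (f' x - \<eta> x))"
        using cf c\<eta> by (auto intro!: integral_norm_bound_integral integrable_continuous_real continuous_intros)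
      then have "(cmod m)\<^sup>2 \<le> (integral {0..pi} (\<lambda>x. cmod (f' x - \<eta> x)))\<^sup>2" by (intro power_mono) auto
      also have "\<dots> \<le> (pi - 0) * sq_integral (\<lambda>x. f' x - \<eta> x)"
        by (intro integral_norm_power2_le continuous_intros cf c\<eta>) auto
      finally show ?thesis by simp
    qed
    have I: "I < 2 * A * d"
    proof -
      have "I \<le> integral {0..pi} (\<lambda>x. 2 * (cmod (f' x - \<eta> x))\<^sup>2 + 2 * (cmod m)\<^sup>2 / (cmod B)\<^sup>2 * (cmod (b x))\<^sup>2)"
        unfolding I_def
      proof (rule integral_le)
        show "(\<lambda>x. (cmod (f' x - h x))\<^sup>2) integrable_on {0..pi}"
          "(\<lambda>x. 2 * (cmod (f' x - \<eta> x))\<^sup>2 + 2 * (cmod m)\<^sup>2 / (cmod B)\<^sup>2 * (cmod (b x))\<^sup>2) integrable_on {0..pi}"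
          by (intro integrable_continuous_real continuous_intros cf c\<eta> cb ch)+
        fix x
        have "\<eta> x - h x = m / B * b x" by (simp add: h_def)
        then have "(cmod (\<eta> x - h x))\<^sup>2 = (cmod m)\<^sup>2 / (cmod B)\<^sup>2 * (cmod (b x))\<^sup>2"
          by (simp add: norm_mult norm_divide power_mult_distrib power_divide)
        then show "(cmod (f' x - h x))\<^sup>2 \<le> 2 * (cmod (f' x - \<eta> x))\<^sup>2 + 2 * (cmod m)\<^sup>2 / (cmod B)\<^sup>2 * (cmod (b x))\<^sup>2"
          using norm_diff_power2_le[of "f' x" "h x" "\<eta> x"] by simp
      qed
      also have "\<dots> = 2 * sq_integral (\<lambda>x. f' x - \<eta> x) + 2 * (cmod m)\<^sup>2 / (cmod B)\<^sup>2 * N"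
        unfolding N_def
        by (subst Henstock_Kurzweil_Integration.integral_add)
           (use \<open>B \<noteq> 0\<close> in \<open>auto intro!: integrable_continuous_real continuous_intros cf c\<eta> cb\<close>)
      also have "\<dots> \<le> 2 * sq_integral (\<lambda>x. f' x - \<eta> x) +
          2 * (pi * sq_integral (\<lambda>x. f' x - \<eta> x)) / (cmod B)\<^sup>2 * N"
        using m N by (intro add_left_mono mult_right_mono divide_right_mono mult_left_mono) auto
      also have "\<dots> = 2 * A * sq_integral (\<lambda>x. f' x - \<eta> x)" by (simp add: A_def algebra_simps)
      also have "\<dots> < 2 * A * d" using \<eta>(2) \<open>A > 0\<close> by simp
      finally show ?thesis .
    qed
    have I0: "I \<ge> 0" unfolding I_def by (intro integral_nonneg integrable_continuous_real continuous_intros cf ch) auto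
    \<comment> \<open>Poincare inequality: the difference vanishes at \<open>0\<close>, so its
      derivative controls it pointwise.\<close>
    have pt: "(cmod (f x - \<phi> x))\<^sup>2 \<le> pi * I" if x: "x \<in> {0..pi}" for x
    proof -
      have "f x - \<phi> x = integral {0..x} (\<lambda>x. f' x - h x)"
        using C1_on_integral[OF c' x] z test_functionD(3)[OF \<phi>(1), of 0] by simp
      also have "cmod \<dots> \<le> integral {0..x} (\<lambda>x. cmod (f' x - h x))"
        using x continuous_on_subset[OF cf(2), of "{0..x}"] ch by (intro integral_norm_bound_integral integrable_continuous_real continuous_intros) auto
      also have "\<dots> \<le> integral {0..pi} (\<lambda>x. cmod (f' x - h x))"
        using x continuous_on_subset[OF cf(2), of "{0..x}"] ch cf by (intro integral_subset_le integrable_continuous_real continuous_intros) auto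
      finally have "(cmod (f x - \<phi> x))\<^sup>2 \<le> (integral {0..pi} (\<lambda>x. cmod (f' x - h x)))\<^sup>2" by (intro power_mono) auto
      also have "\<dots> \<le> (pi - 0) * I" unfolding I_def by (intro integral_norm_power2_le continuous_intros cf ch) auto
      finally show ?thesis by simp
    qed
    have "sq_integral (\<lambda>x. f x - \<phi> x) \<le> integral {0..pi} (\<lambda>x. pi * I)"
      using pt by (intro integral_le integrable_continuous_real continuous_intros cf test_functionD(4)[OF \<phi>(1)]) auto
    then have "sq_integral (\<lambda>x. f x - \<phi> x) + I \<le> (1 + pi\<^sup>2) * I" by (simp add: algebra_simps power2_eq_square)
    also have "\<dots> < (1 + pi\<^sup>2) * (2 * A * d)" using I by (intro mult_strict_left_mono) (auto intro!: add_pos_nonneg)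
    also have "\<dots> = e\<^sup>2"
    proof -
      define Q where "Q = (1 + pi\<^sup>2) * (2 * A)"
      have "Q > 0" unfolding Q_def using \<open>A > 0\<close> by (intro mult_pos_pos add_pos_nonneg) auto
      moreover have "(1 + pi\<^sup>2) * (2 * A * d) = Q * (e\<^sup>2 / Q)" by (simp only: d_def Q_def mult.assoc)
      ultimately show ?thesis by simp
    qed
    finally have lt: "sq_integral (\<lambda>x. f x - \<phi> x) + I < e\<^sup>2" .
    have "sobolev_norm J (\<lambda>x. g x - \<phi> x) = sqrt (sq_integral (\<lambda>x. f x - \<phi> x) + I)"
      unfolding I_def by (rule C1_on_sobolev_norm[OF c']) (use g in auto)
    also have "\<dots> < e" using lt e by (metis real_sqrt_less_mono real_sqrt_abs abs_of_pos)
    finally show ?thesis using \<phi>(1) by blast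
  qed
  have "\<forall>n. \<exists>\<phi>. \<phi> \<in> test_functions J \<and> sobolev_norm J (\<lambda>x. g x - \<phi> x) < 1 / real (Suc n)"
    using approx by (metis of_nat_0_less_iff zero_less_Suc zero_less_divide_1_iff)
  then have "\<exists>\<phi>. \<forall>n. \<phi> n \<in> test_functions J \<and> sobolev_norm J (\<lambda>x. g x - \<phi> n x) < 1 / real (Suc n)"
    by (rule choice)
  then obtain \<phi> where \<phi>: "\<And>n. \<phi> n \<in> test_functions J" "\<And>n. sobolev_norm J (\<lambda>x. g x - \<phi> n x) < 1 / real (Suc n)" by auto
  have "(\<lambda>n. sobolev_norm J (\<lambda>x. g x - \<phi> n x)) \<longlonglongrightarrow> 0"
  proof (rule real_tendsto_sandwich[OF _ _ tendsto_const LIMSEQ_Suc[OF lim_1_over_n]])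
    show "\<forall>\<^sub>F n in sequentially. 0 \<le> sobolev_norm J (\<lambda>x. g x - \<phi> n x)"
      by (auto simp: sobolev_norm_def)
    show "\<forall>\<^sub>F n in sequentially. sobolev_norm J (\<lambda>x. g x - \<phi> n x) \<le> 1 / real (Suc n)"
      by (intro always_eventually allI less_imp_le \<phi>(2))
  qed
  ultimately show ?thesis using \<phi>(1) by (auto simp: sobolev_10_def)
qed

subsection \<open>The dual pairing and the weak formulation\<close>

lemma dual_sobolev_add:
  assumes F: "F \<in> dual_sobolev I" and "f \<in> sobolev_10 I" "g \<in> sobolev_10 I"
  shows "F (\<lambda>x. f x + g x) = F f + F g"
proof -
  from F have "\<forall>\<phi>\<in>sobolev_10 I. \<forall>\<psi>\<in>sobolev_10 I. F (\<lambda>x. \<phi> x + \<psi> x) = F \<phi> + F \<psi>"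
    unfolding dual_sobolev_def by blast
  then have "\<forall>\<psi>\<in>sobolev_10 I. F (\<lambda>x. f x + \<psi> x) = F f + F \<psi>" using assms(2) by (rule bspec)
  then show ?thesis using assms(3) by (rule bspec)
qed

text \<open>The difference of two representatives has Sobolev norm zero, and a bounded functional
  annihilates it. This allows the chosen weak derivatives in the weak formulation to be replaced by
  classical ones.\<close>

lemma dual_sobolev_AE_eq:
  assumes F: "F \<in> dual_sobolev J" and c: "C1_on f f'" and z: "f 0 = 0" "f pi = 0"
    and g: "AE x in lebesgue_on J. f x = g x"
  shows "F g = F f"
proof -
  have ae: "AE x in lebesgue_on J. 0 = g x - f x" using g by (auto elim!: eventually_mono)
  have f: "f \<in> sobolev_10 J" by (rule AE_eq_sobolev_10[OF c z]) auto
  have d: "(\<lambda>x. g x - f x) \<in> sobolev_10 J" by (rule AE_eq_sobolev_10[OF C1_on_zero _ _ ae]) auto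
  obtain C where "\<forall>\<psi>\<in>sobolev_10 J. cmod (F \<psi>) \<le> C * sobolev_norm J \<psi>"
    using F unfolding dual_sobolev_def by blast
  from bspec[OF this d] have "F (\<lambda>x. g x - f x) = 0" by (simp add: C1_on_sobolev_norm[OF C1_on_zero ae])
  moreover have "F (\<lambda>x. f x + (g x - f x)) = F f + F (\<lambda>x. g x - f x)"
    by (rule dual_sobolev_add[OF F f d])
  ultimately show ?thesis by simp
qed

text \<open>Continuity is given in the dual norm, a supremum over the unit ball. The fixed function
  is scaled into that ball, so each pairing inherits continuity.\<close>

lemma continuous_dual_valued_pairing:
  assumes w: "continuous_dual_valued J T w" and c: "C1_on f f'" and z: "f 0 = 0" "f pi = 0"
  shows "continuous_on T (\<lambda>t. w t f)"
  unfolding continuous_on_def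
proof
  fix t assume t: "t \<in> T"
  define N where "N = sobolev_norm J f"
  have N: "N \<ge> 0" by (simp add: N_def sobolev_norm_def)
  \<comment> \<open>The summand \<open>1\<close> avoids division by zero when \<open>f\<close> has
    norm zero.\<close>
  define r where "r = 1 / (N + 1)"
  have r: "r > 0" "r * N \<le> 1" using N by (auto simp: r_def field_simps)
  have f: "f \<in> sobolev_10 J" by (rule AE_eq_sobolev_10[OF c z]) auto
  have c': "C1_on (\<lambda>x. of_real r * f x) (\<lambda>x. of_real r * f' x)" by (rule C1_on_cmult[OF c])
  have f': "(\<lambda>x. of_real r * f x) \<in> sobolev_10 J" by (rule AE_eq_sobolev_10[OF c']) (use z in auto)
  have "sobolev_norm J (\<lambda>x. of_real r * f x) = sqrt (r\<^sup>2 * (sq_integral f + sq_integral f'))"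
    using r by (subst C1_on_sobolev_norm[OF c']) (auto simp: norm_mult power_mult_distrib algebra_simps)
  also have "\<dots> = r * N" unfolding N_def using r by (subst C1_on_sobolev_norm[OF c]) (auto simp: real_sqrt_mult)
  finally have n1: "sobolev_norm J (\<lambda>x. of_real r * f x) \<le> 1" using r by simp
  have bound: "norm (w s f - w t f) \<le> (1 / r) * dual_norm J (\<lambda>\<psi>. w s \<psi> - w t \<psi>)" if s: "s \<in> T" for s
  proof -
    have ws: "w s \<in> dual_sobolev J" "w t \<in> dual_sobolev J" using w s t by (auto simp: continuous_dual_valued_def)
    obtain A where A: "\<forall>\<psi>\<in>sobolev_10 J. cmod (w s \<psi>) \<le> A * sobolev_norm J \<psi>"
      using ws(1) unfolding dual_sobolev_def by blast
    obtain B where B: "\<forall>\<psi>\<in>sobolev_10 J. cmod (w t \<psi>) \<le> B * sobolev_norm J \<psi>"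
      using ws(2) unfolding dual_sobolev_def by blast
    \<comment> \<open>A real supremum bounds its members only for sets that are bounded above;
      boundedness of both functionals provides this.\<close>
    have "bdd_above ((\<lambda>\<psi>. cmod (w s \<psi> - w t \<psi>)) ` {\<psi> \<in> sobolev_10 J. sobolev_norm J \<psi> \<le> 1})"
    proof (rule bdd_aboveI2)
      fix \<psi> assume \<psi>: "\<psi> \<in> {\<psi> \<in> sobolev_10 J. sobolev_norm J \<psi> \<le> 1}"
      have n: "0 \<le> sobolev_norm J \<psi>" by (simp add: sobolev_norm_def)
      have "cmod (w s \<psi> - w t \<psi>) \<le> cmod (w s \<psi>) + cmod (w t \<psi>)" by (rule norm_triangle_ineq4)
      also have "\<dots> \<le> A * sobolev_norm J \<psi> + B * sobolev_norm J \<psi>" using \<psi> A B by (intro add_mono) auto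
      also have "\<dots> \<le> \<bar>A\<bar> * sobolev_norm J \<psi> + \<bar>B\<bar> * sobolev_norm J \<psi>" using n by (intro add_mono mult_right_mono) auto
      also have "\<dots> \<le> \<bar>A\<bar> * 1 + \<bar>B\<bar> * 1" using \<psi> by (intro add_mono mult_left_mono) auto
      finally show "cmod (w s \<psi> - w t \<psi>) \<le> \<bar>A\<bar> + \<bar>B\<bar>" by simp
    qed
    then have "cmod (w s (\<lambda>x. of_real r * f x) - w t (\<lambda>x. of_real r * f x)) \<le> dual_norm J (\<lambda>\<psi>. w s \<psi> - w t \<psi>)"
      unfolding dual_norm_def by (rule cSUP_upper[rotated]) (use f' n1 in auto)
    moreover have "w s (\<lambda>x. of_real r * f x) = cnj (of_real r) * w s f" "w t (\<lambda>x. of_real r * f x) = cnj (of_real r) * w t f"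
      using ws f unfolding dual_sobolev_def by blast+
    ultimately have "cmod (of_real r * (w s f - w t f)) \<le> dual_norm J (\<lambda>\<psi>. w s \<psi> - w t \<psi>)"
      by (simp add: right_diff_distrib)
    then have "r * cmod (w s f - w t f) \<le> dual_norm J (\<lambda>\<psi>. w s \<psi> - w t \<psi>)"
      using r(1) by (simp only: norm_mult norm_of_real abs_of_pos)
    then show ?thesis using r(1) by (simp add: field_simps)
  qed
  have "((\<lambda>s. (1 / r) * dual_norm J (\<lambda>\<psi>. w s \<psi> - w t \<psi>)) \<longlongrightarrow> (1 / r) * 0) (at t within T)"
    using w t by (intro tendsto_intros) (auto simp: continuous_dual_valued_def)
  then have "((\<lambda>s. (1 / r) * dual_norm J (\<lambda>\<psi>. w s \<psi> - w t \<psi>)) \<longlongrightarrow> 0) (at t within T)" by simp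
  moreover have "\<forall>\<^sub>F s in at t within T. norm (w s f - w t f) \<le> (1 / r) * dual_norm J (\<lambda>\<psi>. w s \<psi> - w t \<psi>)"
    unfolding eventually_at_filter by (rule always_eventually) (use bound in blast)
  ultimately have "((\<lambda>s. w s f - w t f) \<longlongrightarrow> 0) (at t within T)" by (rule Lim_null_comparison[rotated])
  then show "((\<lambda>t. w t f) \<longlongrightarrow> w t f) (at t within T)" by (rule Lim_null[THEN iffD2])
qed

text \<open>Two continuous functions that agree almost everywhere have mean-square distance zero,
  hence agree everywhere, including the endpoints. So the definite description in
  \<open>trace_at\<close> is proper.\<close>

lemma trace_at_continuous:
  assumes h: "continuous_on {0..pi} h" and ae: "AE x in lebesgue_on J. h x = g x" and p: "p \<in> {0..pi}"
  shows "trace_at 0 pi g p = h p"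
  unfolding trace_at_def
proof (rule the_equality)
  show "\<exists>k. continuous_on {0..pi} k \<and> (AE x in lebesgue_on J. k x = g x) \<and> k p = h p"
    using h ae by auto
  fix c assume "\<exists>k. continuous_on {0..pi} k \<and> (AE x in lebesgue_on J. k x = g x) \<and> k p = c"
  then obtain k where k: "continuous_on {0..pi} k" "AE x in lebesgue_on J. k x = g x" "k p = c" by auto
  have cont: "continuous_on {0..pi} (\<lambda>x. (cmod (k x - h x))\<^sup>2)" by (intro continuous_intros h k)
  have "(LINT x|lebesgue_on J. (cmod (k x - h x))\<^sup>2) = (LINT x|lebesgue_on J. 0)"
  proof (rule integral_cong_AE)
    show "(\<lambda>x. (cmod (k x - h x))\<^sup>2) \<in> borel_measurable (lebesgue_on J)" using LINT_open_interval(1)[OF cont] by auto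
    show "AE x in lebesgue_on J. (cmod (k x - h x))\<^sup>2 = 0" using ae k(2) by eventually_elim auto
  qed auto
  then have "sq_integral (\<lambda>x. k x - h x) = 0" using LINT_open_interval(2)[OF cont] by simp
  then have "(cmod (k p - h p))\<^sup>2 = 0" using p by (subst (asm) integral_eq_0_iff[OF cont]) auto
  then show "c = h p" using k by simp
qed

lemma hermite_testI:
  assumes c: "C1_on f f'" "C1_on f' f''" "C1_on f'' f'''" and z: "f 0 = 0" "f pi = 0" "f'' 0 = 0" "f'' pi = 0"
  shows "f \<in> hermite_test" and "AE x in lebesgue_on J. f' x = weak_deriv J f x"
    and "AE x in lebesgue_on J. f'' x = weak_deriv J (weak_deriv J f) x"
proof -
  show w1: "AE x in lebesgue_on J. f' x = weak_deriv J f x" by (rule C1_on_weak_deriv[OF c(1)]) auto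
  show w2: "AE x in lebesgue_on J. f'' x = weak_deriv J (weak_deriv J f) x" by (rule C1_on_weak_deriv[OF c(2) w1])
  have cf: "continuous_on {0..pi} f" "continuous_on {0..pi} f'" "continuous_on {0..pi} f''"
    using C1_on_continuous c by blast+
  have "f \<in> sobolev 2 J"
    using continuous_L2[OF cf(1), of f] continuous_L2[OF cf(2), of f'] continuous_L2[OF cf(3), of f'']
      C1_on_has_weak_deriv[OF c(1), of f f'] C1_on_has_weak_deriv[OF c(2), of f' f'']
    by (auto simp: numeral_2_eq_2)
  moreover have "f \<in> sobolev_10 J" by (rule AE_eq_sobolev_10[OF c(1) z(1,2)]) auto
  moreover have "weak_deriv J (weak_deriv J f) \<in> sobolev_10 J" by (rule AE_eq_sobolev_10[OF c(3) z(3,4) w2])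
  ultimately show "f \<in> hermite_test" by (simp add: hermite_test_def)
qed

text \<open>For such \<open>f\<close> the expression \<open>f'' - x\<^sup>2 f\<close> equals
  \<open>l f - g\<close>, which again lies in W^{1,2}_0. The weak formulation thus becomes a scalar
  integral equation for the pairing with \<open>f\<close>, with the pairing with \<open>g\<close> as
  its forcing. Since \<open>l\<close> is real, antilinearity leaves it unchanged.\<close>

lemma hermite_solution_tested:
  assumes w: "hermite_solution (\<lambda>\<psi>. 0) u w" and t: "t \<ge> 0"
    and c: "C1_on f f'" "C1_on f' f''" "C1_on f'' f'''" and z: "f 0 = 0" "f pi = 0" "f'' 0 = 0" "f'' pi = 0"
    and g: "C1_on g g'" "g 0 = 0" "g pi = 0"
    and eq: "\<And>x. x \<in> {0..pi} \<Longrightarrow> f'' x = (of_real l + of_real (x\<^sup>2)) * f x - g x"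
  shows "w t f = integral {0..t} (\<lambda>s. of_real l * w s f - w s g)
      + (LINT s|lebesgue_on {0<..<t}. fst (u s)) * cnj (f' 0) - (LINT s|lebesgue_on {0<..<t}. snd (u s)) * cnj (f' pi)"
proof -
  note h = hermite_testI[OF c z]
  have cd: "continuous_dual_valued J {0..} w" using w by (simp add: hermite_solution_def)
  have tr: "trace_at 0 pi (weak_deriv J f) 0 = f' 0" "trace_at 0 pi (weak_deriv J f) pi = f' pi"
    by (rule trace_at_continuous[OF C1_on_continuous[OF c(2)] h(2)]; simp)+
  have src: "w s (\<lambda>x. weak_deriv J (weak_deriv J f) x - complex_of_real (x\<^sup>2) * f x) = of_real l * w s f - w s g"
    if s: "s \<ge> 0" for s
  proof -
    have ws: "w s \<in> dual_sobolev J" using cd s by (auto simp: continuous_dual_valued_def)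
    have c': "C1_on (\<lambda>x. of_real l * f x - g x) (\<lambda>x. of_real l * f' x - g' x)"
      by (intro C1_on_diff C1_on_cmult c g)
    have "AE x in lebesgue_on J. of_real l * f x - g x = weak_deriv J (weak_deriv J f) x - complex_of_real (x\<^sup>2) * f x"
      using h(3)
    proof (rule AE_mp, intro AE_I2 impI)
      fix x assume "x \<in> space (lebesgue_on J)" and x: "f'' x = weak_deriv J (weak_deriv J f) x"
      then have "x \<in> {0..pi}" by auto
      then show "of_real l * f x - g x = weak_deriv J (weak_deriv J f) x - complex_of_real (x\<^sup>2) * f x"
        unfolding x[symmetric] by (simp add: eq algebra_simps)
    qed
    from dual_sobolev_AE_eq[OF ws c' _ _ this]
    have "w s (\<lambda>x. weak_deriv J (weak_deriv J f) x - complex_of_real (x\<^sup>2) * f x) = w s (\<lambda>x. of_real l * f x - g x)"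
      using z g by simp
    also have "\<dots> = w s (\<lambda>x. of_real l * f x + (-1) * g x)" by simp
    also have "\<dots> = w s (\<lambda>x. of_real l * f x) + w s (\<lambda>x. (-1) * g x)"
    proof -
      have "(\<lambda>x. of_real l * f x) \<in> sobolev_10 J" by (rule AE_eq_sobolev_10[OF C1_on_cmult[OF c(1)]]) (use z in auto)
      moreover have "(\<lambda>x. (-1) * g x) \<in> sobolev_10 J" by (rule AE_eq_sobolev_10[OF C1_on_cmult[OF g(1), of "-1"]]) (use g in auto)
      ultimately show ?thesis by (rule dual_sobolev_add[OF ws])
    qed
    also have "w s (\<lambda>x. of_real l * f x) = cnj (of_real l) * w s f"
    proof -
      have "f \<in> sobolev_10 J" by (rule AE_eq_sobolev_10[OF c(1) z(1,2)]) auto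
      then show ?thesis using ws unfolding dual_sobolev_def by blast
    qed
    also have "w s (\<lambda>x. (-1) * g x) = cnj (-1) * w s g"
    proof -
      have "g \<in> sobolev_10 J" by (rule AE_eq_sobolev_10[OF g]) auto
      then show ?thesis using ws unfolding dual_sobolev_def by blast
    qed
    finally show ?thesis by simp
  qed
  have cont: "continuous_on {0..t} (\<lambda>s. of_real l * w s f - w s g)"
    using continuous_on_subset[OF continuous_dual_valued_pairing[OF cd c(1) z(1,2)], of "{0..t}"]
      continuous_on_subset[OF continuous_dual_valued_pairing[OF cd g], of "{0..t}"] by (auto intro!: continuous_intros)
  have "(LINT s|lebesgue_on {0<..<t}. w s (\<lambda>x. weak_deriv J (weak_deriv J f) x - complex_of_real (x\<^sup>2) * f x))
     = (LINT s|lebesgue_on {0<..<t}. of_real l * w s f - w s g)"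
    by (rule Bochner_Integration.integral_cong) (use src in auto)
  also have "\<dots> = integral {0..t} (\<lambda>s. of_real l * w s f - w s g)" by (rule LINT_open_interval(2)[OF cont])
  finally show ?thesis
    using w t h(1) unfolding hermite_solution_def by (simp add: tr)
qed

subsection \<open>Solutions of the stationary equation and the resolvent\<close>

text \<open>Power series coefficients of the solution of \<open>Y'' = (z\<^sup>2 + l) Y\<close> with
  \<open>Y 0 = a\<close> and \<open>Y' 0 = b\<close>. The term \<open>z\<^sup>2 Y\<close>
  contributes only from degree 2 on, so the coefficients of index 2 and 3 have a shorter
  recursion.\<close>

fun hermite_coeff :: "real \<Rightarrow> real \<Rightarrow> real \<Rightarrow> nat \<Rightarrow> real" where
  "hermite_coeff l a b 0 = a"
| "hermite_coeff l a b (Suc 0) = b"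
| "hermite_coeff l a b (Suc (Suc 0)) = l * a / 2"
| "hermite_coeff l a b (Suc (Suc (Suc 0))) = l * b / 6"
| "hermite_coeff l a b (Suc (Suc (Suc (Suc n)))) =
    (l * hermite_coeff l a b (Suc (Suc n)) + hermite_coeff l a b n) / (real (n + 4) * real (n + 3))"

text \<open>For every radius \<open>R\<close> the denominators of the recursion eventually exceed
  \<open>\<bar>l\<bar> * R\<^sup>2 + R ^ 4\<close>; from then on the weighted coefficients cannot
  exceed the maximum already reached. As \<open>R\<close> is arbitrary, the series is
  entire.\<close>

lemma hermite_coeff_bound:
  assumes R: "R > 0"
  obtains M where "\<And>n. \<bar>hermite_coeff l a b n\<bar> * R ^ n \<le> M"
proof -
  let ?c = "hermite_coeff l a b"
  define N where "N = nat \<lceil>\<bar>l\<bar> * R\<^sup>2 + R ^ 4\<rceil>"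
  have N: "\<bar>l\<bar> * R\<^sup>2 + R ^ 4 \<le> real N" unfolding N_def by linarith
  \<comment> \<open>Indices up to \<open>N + 3\<close> are absorbed into \<open>M\<close>; a larger
    index \<open>n\<close> has \<open>n - 4 \<ge> N\<close>, so the denominator is large
    enough.\<close>
  define M where "M = (\<Sum>i\<le>N + 3. \<bar>?c i\<bar> * R ^ i)"
  have M0: "M \<ge> 0" unfolding M_def using R by (intro sum_nonneg) auto
  have "\<bar>?c n\<bar> * R ^ n \<le> M" for n
  proof (induction n rule: less_induct)
    case (less n)
    show ?case
    proof (cases "n \<le> N + 3")
      case True
      then show ?thesis unfolding M_def using R by (intro member_le_sum) auto
    next
      case False
      define m where "m = n - 4"
      have n: "n = Suc (Suc (Suc (Suc m)))" "N \<le> m" using False by (auto simp: m_def)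
      have i1: "\<bar>?c (Suc (Suc m))\<bar> * R ^ Suc (Suc m) \<le> M" and i2: "\<bar>?c m\<bar> * R ^ m \<le> M"
        by (rule less; simp add: n)+
      define q where "q = real (m + 4) * real (m + 3)"
      have "real N \<le> real m * 1" using n by simp
      also have "\<dots> \<le> q" unfolding q_def by (intro mult_mono) auto
      finally have q: "\<bar>l\<bar> * R\<^sup>2 + R ^ 4 \<le> q" "q > 0" using N by (auto simp: q_def)
      have "\<bar>?c n\<bar> \<le> (\<bar>l\<bar> * \<bar>?c (Suc (Suc m))\<bar> + \<bar>?c m\<bar>) / q"
        unfolding n hermite_coeff.simps q_def[symmetric] using q(2)
        by (simp add: divide_right_mono abs_mult[symmetric] order_trans[OF abs_triangle_ineq])
      then have "\<bar>?c n\<bar> * R ^ n \<le> (\<bar>l\<bar> * \<bar>?c (Suc (Suc m))\<bar> + \<bar>?c m\<bar>) / q * R ^ n"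
        using R by (intro mult_right_mono) auto
      also have "\<dots> = (\<bar>l\<bar> * R\<^sup>2 * (\<bar>?c (Suc (Suc m))\<bar> * R ^ Suc (Suc m)) + R ^ 4 * (\<bar>?c m\<bar> * R ^ m)) / q"
        by (simp add: n power2_eq_square eval_nat_numeral algebra_simps add_divide_distrib)
      also have "\<dots> \<le> (\<bar>l\<bar> * R\<^sup>2 * M + R ^ 4 * M) / q"
        using i1 i2 q(2) by (intro divide_right_mono add_mono mult_left_mono) auto
      also have "\<dots> = (\<bar>l\<bar> * R\<^sup>2 + R ^ 4) * M / q" by (simp add: algebra_simps)
      also have "\<dots> \<le> q * M / q" using q M0 by (intro divide_right_mono mult_right_mono) auto
      finally show ?thesis using q(2) by simp
    qed
  qed
  then show ?thesis using that by blast
qed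

lemma hermite_coeff_summable:
  fixes z :: complex
  shows "summable (\<lambda>n. of_real (hermite_coeff l a b n) * z ^ n)"
proof -
  define R where "R = norm z + 1"
  have R: "R > 0" "norm z < R" by (auto simp: R_def add_nonneg_pos)
  obtain M where M: "\<And>n. \<bar>hermite_coeff l a b n\<bar> * R ^ n \<le> M" using hermite_coeff_bound[OF R(1)] by metis
  show ?thesis
  proof (rule summable_comparison_test')
    show "summable (\<lambda>n. M * (norm z / R) ^ n)" using R by (intro summable_mult summable_geometric) auto
    fix n
    have "norm (of_real (hermite_coeff l a b n) * z ^ n) = (\<bar>hermite_coeff l a b n\<bar> * R ^ n) * (norm z / R) ^ n"
      using R by (simp add: norm_mult norm_power power_divide)
    also have "\<dots> \<le> M * (norm z / R) ^ n" using M R by (intro mult_right_mono) auto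
    finally show "norm (of_real (hermite_coeff l a b n) * z ^ n) \<le> M * (norm z / R) ^ n" .
  qed
qed

lemma hermite_coeff_nonneg:
  assumes "l \<ge> 0" "a \<ge> 0" "b \<ge> 0"
  shows "hermite_coeff l a b n \<ge> 0"
  using assms
proof (induction l a b n rule: hermite_coeff.induct)
  case (5 l a b n)
  then show ?case unfolding hermite_coeff.simps by (intro divide_nonneg_nonneg add_nonneg_nonneg mult_nonneg_nonneg) auto
qed auto

definition hermite_mode :: "real \<Rightarrow> (complex \<Rightarrow> complex) \<Rightarrow> (complex \<Rightarrow> complex) \<Rightarrow> bool" where
  "hermite_mode l Y Y' \<longleftrightarrow> (\<forall>z. (Y has_field_derivative Y' z) (at z)) \<and>
     (\<forall>z. (Y' has_field_derivative (z\<^sup>2 + of_real l) * Y z) (at z))"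

text \<open>For nonnegative \<open>l\<close> and \<open>a\<close> and positive \<open>b\<close> all
  coefficients are nonnegative, so the value at \<open>pi\<close> is at least the linear term
  \<open>b * pi\<close>. This excludes a zero at \<open>pi\<close> and makes the Dirichlet problem
  solvable.\<close>

lemma hermite_mode_initial:
  obtains Y Y' where "hermite_mode l Y Y'" "Y 0 = of_real a" "Y' 0 = of_real b"
    "l \<ge> 0 \<Longrightarrow> a \<ge> 0 \<Longrightarrow> b > 0 \<Longrightarrow> Y (of_real pi) \<noteq> 0"
proof -
  define c where "c = (\<lambda>n. complex_of_real (hermite_coeff l a b n))"
  have s0: "summable (\<lambda>n. c n * z ^ n)" for z unfolding c_def by (rule hermite_coeff_summable)
  have s1: "summable (\<lambda>n. diffs c n * z ^ n)" for z by (rule termdiff_converges_all) (rule s0)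
  define Y where "Y = (\<lambda>z. \<Sum>n. c n * z ^ n)"
  define Y' where "Y' = (\<lambda>z. \<Sum>n. diffs c n * z ^ n)"
  have d0: "(Y has_field_derivative Y' z) (at z)" for z unfolding Y_def Y'_def
    by (rule termdiffs_strong_converges_everywhere) (rule s0)
  have "(Y' has_field_derivative (\<Sum>n. diffs (diffs c) n * z ^ n)) (at z)" for z unfolding Y'_def
    by (rule termdiffs_strong_converges_everywhere) (rule s1)
  moreover have "(\<Sum>n. diffs (diffs c) n * z ^ n) = (z\<^sup>2 + of_real l) * Y z" for z
  proof -
    have rec: "diffs (diffs c) n = of_real l * c n + (if n < 2 then 0 else c (n - 2))" for n
    proof -
      consider "n = 0" | "n = 1" | m where "n = Suc (Suc m)" by (metis One_nat_def not0_implies_Suc)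
      then show ?thesis
      proof cases
        case 3
        define A B where "A = complex_of_nat (m + 4)" and "B = complex_of_nat (m + 3)"
        have AB: "A \<noteq> 0" "B \<noteq> 0" unfolding A_def B_def of_nat_eq_0_iff by auto
        have "c (Suc (Suc n)) = (of_real l * c n + c m) / (A * B)"
          unfolding c_def 3 hermite_coeff.simps of_real_divide of_real_add of_real_mult A_def B_def of_real_of_nat_eq ..
        moreover have "diffs (diffs c) n = B * (A * c (Suc (Suc n)))"
          unfolding diffs_def A_def B_def 3 by (simp add: eval_nat_numeral)
        ultimately have "diffs (diffs c) n = of_real l * c n + c m" using AB by simp
        then show ?thesis by (simp add: 3)
      qed (auto simp: diffs_def c_def eval_nat_numeral)
    qed
    define k where "k = (\<lambda>n. (if n < 2 then 0 else c (n - 2)) * z ^ n)"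
    have "(\<lambda>n. z\<^sup>2 * (c n * z ^ n)) sums (z\<^sup>2 * Y z)" unfolding Y_def by (intro sums_mult summable_sums s0)
    moreover have "(\<lambda>n. z\<^sup>2 * (c n * z ^ n)) = (\<lambda>n. k (n + 2))"
      by (auto simp: k_def power_add power2_eq_square algebra_simps)
    ultimately have "k sums (z\<^sup>2 * Y z)"
      using sums_iff_shift[of k 2 "z\<^sup>2 * Y z"] by (simp add: k_def eval_nat_numeral)
    then have "(\<lambda>n. (if n < 2 then 0 else c (n - 2)) * z ^ n) sums (z\<^sup>2 * Y z)" by (simp only: k_def)
    moreover have "(\<lambda>n. of_real l * (c n * z ^ n)) sums (of_real l * Y z)"
      unfolding Y_def by (intro sums_mult summable_sums s0)
    ultimately have "(\<lambda>n. diffs (diffs c) n * z ^ n) sums (of_real l * Y z + z\<^sup>2 * Y z)"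
      unfolding rec by (auto dest: sums_add simp: algebra_simps)
    then show ?thesis by (simp add: sums_unique[symmetric] algebra_simps)
  qed
  ultimately have "hermite_mode l Y Y'" using d0 by (auto simp: hermite_mode_def)
  moreover have "Y 0 = of_real a" "Y' 0 = of_real b" by (simp_all add: Y_def Y'_def c_def diffs_def)
  moreover have "Y (of_real pi) \<noteq> 0" if "l \<ge> 0" "a \<ge> 0" "b > 0"
  proof -
    have nn: "hermite_coeff l a b n \<ge> 0" for n using that by (intro hermite_coeff_nonneg) auto
    have eq: "c n * of_real pi ^ n = of_real (hermite_coeff l a b n * pi ^ n)" for n by (simp add: c_def)
    have sr: "summable (\<lambda>n. hermite_coeff l a b n * pi ^ n)" using s0[of "of_real pi"] unfolding eq by (simp only: summable_of_real_iff)
    have "Y (of_real pi) = of_real (\<Sum>n. hermite_coeff l a b n * pi ^ n)"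
      unfolding Y_def eq by (rule suminf_of_real[OF sr, symmetric])
    moreover have "(\<Sum>n\<in>{1}. hermite_coeff l a b n * pi ^ n) \<le> (\<Sum>n. hermite_coeff l a b n * pi ^ n)"
      by (intro sum_le_suminf sr) (use nn in auto)
    moreover have "b * pi > 0" using that by simp
    ultimately show ?thesis by auto
  qed
  ultimately show ?thesis using that by blast
qed

lemma hermite_mode_lincomb:
  assumes "hermite_mode l Y Y'" "hermite_mode l Z Z'"
  shows "hermite_mode l (\<lambda>z. c * Y z + d * Z z) (\<lambda>z. c * Y' z + d * Z' z)"
  unfolding hermite_mode_def
proof safe
  fix z
  have d: "(Y has_field_derivative Y' z) (at z)" "(Y' has_field_derivative (z\<^sup>2 + of_real l) * Y z) (at z)"
    "(Z has_field_derivative Z' z) (at z)" "(Z' has_field_derivative (z\<^sup>2 + of_real l) * Z z) (at z)"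
    using assms by (auto simp: hermite_mode_def)
  show "((\<lambda>z. c * Y z + d * Z z) has_field_derivative c * Y' z + d * Z' z) (at z)"
    by (intro DERIV_add DERIV_cmult d)
  show "((\<lambda>z. c * Y' z + d * Z' z) has_field_derivative (z\<^sup>2 + of_real l) * (c * Y z + d * Z z)) (at z)"
    using DERIV_add[OF DERIV_cmult[OF d(2), of c] DERIV_cmult[OF d(4), of d]] by (simp add: algebra_simps)
qed

text \<open>Shooting: the solution with value \<open>1\<close> and slope \<open>0\<close> at
  \<open>0\<close>, times \<open>\<alpha>\<close>, is corrected by a multiple of the one with value
  \<open>0\<close> and slope \<open>1\<close>, which does not vanish at \<open>pi\<close>.\<close>

lemma hermite_mode_boundary:
  assumes "l \<ge> 0"
  obtains Y Y' where "hermite_mode l Y Y'" "Y 0 = \<alpha>" "Y (of_real pi) = \<beta>"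
proof -
  obtain C C' where C: "hermite_mode l C C'" "C 0 = of_real 1" by (rule hermite_mode_initial[of l 1 0])
  obtain S S' where S: "hermite_mode l S S'" "S 0 = of_real 0" and nz: "S (of_real pi) \<noteq> 0"
    by (rule hermite_mode_initial[of l 0 1]) (use assms in auto)
  show ?thesis
    by (rule that[OF hermite_mode_lincomb[OF C(1) S(1), of \<alpha> "(\<beta> - \<alpha> * C (of_real pi)) / S (of_real pi)"]])
       (use C(2) S(2) nz in auto)
qed

lemma hermite_mode_real:
  assumes "hermite_mode l Y Y'"
  shows "((\<lambda>x. Y (of_real x)) has_vector_derivative Y' (of_real x)) (at x within A)"
    "((\<lambda>x. Y' (of_real x)) has_vector_derivative (of_real l + of_real (x\<^sup>2)) * Y (of_real x)) (at x within A)"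
    "continuous_on B (\<lambda>x. Y (of_real x))" "continuous_on B (\<lambda>x. Y' (of_real x))"
proof -
  have d: "(Y has_field_derivative Y' z) (at z)" "(Y' has_field_derivative (z\<^sup>2 + of_real l) * Y z) (at z)" for z
    using assms by (auto simp: hermite_mode_def)
  show 1: "((\<lambda>x. Y (of_real x)) has_vector_derivative Y' (of_real x)) (at x within A)" for x A
    by (rule has_vector_derivative_real_field[OF d(1)[THEN DERIV_subset[OF _ subset_UNIV], of _ UNIV, simplified], THEN has_vector_derivative_at_within])
  show 2: "((\<lambda>x. Y' (of_real x)) has_vector_derivative (of_real l + of_real (x\<^sup>2)) * Y (of_real x)) (at x within A)" for x A
    using has_vector_derivative_real_field[OF d(2), THEN has_vector_derivative_at_within, of x A] by (simp add: add.commute)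
  show "continuous_on B (\<lambda>x. Y (of_real x))" "continuous_on B (\<lambda>x. Y' (of_real x))"
    by (rule continuous_on_vector_derivative, rule 1, rule continuous_on_vector_derivative, rule 2)
qed

text \<open>Green's function by variation of constants, from a solution \<open>s\<close> vanishing
  at \<open>0\<close> and a solution \<open>y\<close> vanishing at \<open>pi\<close>. The energy
  bound comes from pairing the equation with \<open>f\<close>; the term in \<open>l\<close> has the
  good sign, so the bound does not involve \<open>l\<close>.\<close>

lemma hermite_resolvent:
  assumes l: "l \<ge> 1" and g: "C1_on g g'" "g 0 = 0" "g pi = 0"
  obtains f f' f'' f''' where "C1_on f f'" "C1_on f' f''" "C1_on f'' f'''" "f 0 = 0" "f pi = 0" "f'' 0 = 0" "f'' pi = 0"
    "\<And>x. f'' x = (of_real l + of_real (x\<^sup>2)) * f x - g x"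
    "sq_integral f + sq_integral f' \<le> sq_integral g"
proof -
  obtain S S' where S: "hermite_mode l S S'" "S 0 = of_real 0" "S' 0 = of_real 1" by (rule hermite_mode_initial[of l 0 1])
  obtain Y Y' where Y: "hermite_mode l Y Y'" "Y 0 = 1" "Y (of_real pi) = 0"
    by (rule hermite_mode_boundary[of l 1 0]) (use l in auto)
  define s where "s x = S (complex_of_real x)" for x
  define s' where "s' x = S' (complex_of_real x)" for x
  define y where "y x = Y (complex_of_real x)" for x
  define y' where "y' x = Y' (complex_of_real x)" for x
  note ds = hermite_mode_real[OF S(1), folded s_def s'_def]
  note dy = hermite_mode_real[OF Y(1), folded y_def y'_def]
  note cg = C1_on_continuous[OF g(1)]
  have wr: "s' x * y x - s x * y' x = 1" for x
  proof -
    have "((\<lambda>x. s' x * y x - s x * y' x) has_vector_derivative 0) (at x within UNIV)" for x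
      using has_vector_derivative_diff[OF has_vector_derivative_mult[OF ds(2) dy(1)] has_vector_derivative_mult[OF ds(1) dy(2)]]
      by (simp add: algebra_simps)
    then obtain c where "\<And>x. x \<in> UNIV \<Longrightarrow> s' x * y x - s x * y' x = c"
      using has_vector_derivative_zero_constant[OF convex_UNIV, of "\<lambda>x. s' x * y x - s x * y' x"] by blast
    then have "s' x * y x - s x * y' x = s' 0 * y 0 - s 0 * y' 0" by (metis UNIV_I)
    then show ?thesis using S Y by (simp add: s_def s'_def y_def y'_def)
  qed
  define P where "P = (\<lambda>x. integral {0..x} (\<lambda>x. s x * g x))"
  define Q where "Q = (\<lambda>x. integral {0..pi} (\<lambda>x. y x * g x) - integral {0..x} (\<lambda>x. y x * g x))"
  have dP: "(P has_vector_derivative s x * g x) (at x within {0..pi})" if "x \<in> {0..pi}" for x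
    unfolding P_def by (rule integral_has_vector_derivative[OF _ that]) (intro continuous_intros ds cg)
  have dQ: "(Q has_vector_derivative - (y x * g x)) (at x within {0..pi})" if "x \<in> {0..pi}" for x
    unfolding Q_def 
    by (rule derivative_eq_intros integral_has_vector_derivative[OF _ that] refl | intro continuous_intros dy cg | simp)+
  define f where "f = (\<lambda>x. y x * P x + s x * Q x)"
  define f' where "f' = (\<lambda>x. y' x * P x + s' x * Q x)"
  define f'' where "f'' = (\<lambda>x. (of_real l + of_real (x\<^sup>2)) * f x - g x)"
  define f''' where "f''' = (\<lambda>x. (of_real l + of_real (x\<^sup>2)) * f' x + of_real (2 * x) * f x - g' x)"
  have d1: "(f has_vector_derivative f' x) (at x within {0..pi})" if x: "x \<in> {0..pi}" for x
    unfolding f_def f'_def 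
    by (rule derivative_eq_intros ds(1) dy(1) dP[OF x] dQ[OF x] refl)+ (simp add: algebra_simps)
  have d2: "(f' has_vector_derivative f'' x) (at x within {0..pi})" if x: "x \<in> {0..pi}" for x
  proof -
    have "(f' has_vector_derivative (y' x * (s x * g x) + (of_real l + of_real (x\<^sup>2)) * y x * P x + (s' x * - (y x * g x) + (of_real l + of_real (x\<^sup>2)) * s x * Q x))) (at x within {0..pi})"
      unfolding f'_def by (rule derivative_eq_intros ds(2) dy(2) dP[OF x] dQ[OF x] refl)+
    moreover have "y' x * (s x * g x) + (of_real l + of_real (x\<^sup>2)) * y x * P x + (s' x * - (y x * g x) + (of_real l + of_real (x\<^sup>2)) * s x * Q x)
       = (of_real l + of_real (x\<^sup>2)) * f x - (s' x * y x - s x * y' x) * g x"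
      by (simp add: f_def algebra_simps)
    ultimately show ?thesis unfolding wr by (simp add: f''_def)
  qed
  have d3: "(f'' has_vector_derivative f''' x) (at x within {0..pi})" if x: "x \<in> {0..pi}" for x
  proof -
    have "((\<lambda>x. of_real l + complex_of_real (x\<^sup>2)) has_vector_derivative of_real (2 * x)) (at x within {0..pi})"
      by (rule derivative_eq_intros has_vector_derivative_of_real refl | simp add: has_real_derivative_iff_has_vector_derivative[symmetric])+
    from has_vector_derivative_diff[OF has_vector_derivative_mult[OF this d1[OF x]], of g "g' x"]
    show ?thesis unfolding f''_def f'''_def using g(1) x by (simp add: C1_on_def)
  qed
  have cf: "continuous_on {0..pi} f" "continuous_on {0..pi} f'" "continuous_on {0..pi} f''"
    using d1 d2 d3 continuous_on_vector_derivative by blast+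
  have "continuous_on {0..pi} g'" using g(1) by (simp add: C1_on_def)
  then have C: "C1_on f f'" "C1_on f' f''" "C1_on f'' f'''"
    using d1 d2 d3 cf unfolding C1_on_def f'''_def by (auto intro!: continuous_intros)
  have z: "f 0 = 0" "f pi = 0" using S Y by (auto simp: f_def P_def Q_def s_def y_def)
  then have z2: "f'' 0 = 0" "f'' pi = 0" using g by (auto simp: f''_def)
  \<comment> \<open>The integrand is the derivative of \<open>f' * cnj f\<close>, which vanishes at
    both ends. Since \<open>l \<ge> 1\<close>, half of the zero-order term absorbs the cross term
    with \<open>g\<close>.\<close>
  have "((\<lambda>x. f' x * cnj (f' x) + f'' x * cnj (f x)) has_integral (f' pi * cnj (f pi) - f' 0 * cnj (f 0))) {0..pi}"
    by (rule fundamental_theorem_of_calculus) (auto intro!: has_vector_derivative_mult d1 d2 has_vector_derivative_cnj)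
  then have h0: "((\<lambda>x. f' x * cnj (f' x) + f'' x * cnj (f x)) has_integral 0) {0..pi}" using z by simp
  have "((\<lambda>x. Re (f' x * cnj (f' x) + f'' x * cnj (f x))) has_integral 0) {0..pi}"
    using has_integral_linear[OF h0 bounded_linear_Re] by (simp add: o_def)
  moreover have "((\<lambda>x. (cmod (f' x))\<^sup>2 + (1 / 2) * (cmod (f x))\<^sup>2 - (1 / 2) * (cmod (g x))\<^sup>2) has_integral
       (sq_integral f' + (1 / 2) * sq_integral f - (1 / 2) * sq_integral g)) {0..pi}"
    by (intro has_integral_add has_integral_diff has_integral_mult_right integrable_integral integrable_continuous_real continuous_intros cf cg)
  moreover have "(cmod (f' x))\<^sup>2 + (1 / 2) * (cmod (f x))\<^sup>2 - (1 / 2) * (cmod (g x))\<^sup>2 \<le> Re (f' x * cnj (f' x) + f'' x * cnj (f x))" for x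
  proof -
    have "Re (f'' x * cnj (f x)) = (l + x\<^sup>2) * (cmod (f x))\<^sup>2 - Re (g x * cnj (f x))"
      unfolding cmod_power2 by (simp add: f''_def power2_eq_square algebra_simps)
    moreover have "1 * (cmod (f x))\<^sup>2 \<le> (l + x\<^sup>2) * (cmod (f x))\<^sup>2" using l by (intro mult_right_mono) (auto intro: add_increasing2)
    moreover have "Re (g x * cnj (f x)) \<le> cmod (g x) * cmod (f x)"
      using complex_Re_le_cmod[of "g x * cnj (f x)"] by (simp add: norm_mult)
    moreover have "2 * (cmod (g x) * cmod (f x)) \<le> (cmod (g x))\<^sup>2 + (cmod (f x))\<^sup>2"
      using sum_squares_bound[of "cmod (g x)" "cmod (f x)"] by simp
    moreover have "Re (f' x * cnj (f' x)) = (cmod (f' x))\<^sup>2" unfolding cmod_power2 by (simp add: power2_eq_square)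
    ultimately show ?thesis by simp
  qed
  ultimately have "sq_integral f' + (1 / 2) * sq_integral f - (1 / 2) * sq_integral g \<le> 0"
    using has_integral_le by blast
  moreover have "sq_integral f' \<ge> 0"
    by (intro integral_nonneg integrable_continuous_real continuous_intros cf) auto
  ultimately have "sq_integral f + sq_integral f' \<le> sq_integral g"
    by linarith
  then show ?thesis using that[OF C z z2] f''_def by blast
qed

subsection \<open>The energy inequality on the square\<close>

definition diamond :: "real \<times> real \<Rightarrow> complex" where
  "diamond p = of_real (fst p) * ((1 - \<i>) / 2) + of_real (snd p) * ((1 + \<i>) / 2)"

lemma diamond_alt: "diamond (a, b) = Complex ((a + b) / 2) ((b - a) / 2)"
  by (simp add: diamond_def complex_eq_iff field_simps)

text \<open>The index starts at \<open>1\<close> because a mode constant in time would not decay at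
  minus infinity.\<close>

definition mode_sum :: "nat \<Rightarrow> (nat \<Rightarrow> complex \<Rightarrow> complex) \<Rightarrow> real \<Rightarrow> complex \<Rightarrow> complex" where
  "mode_sum n Z t z = (\<Sum>j\<in>{1..n}. of_real (exp (real j * t)) * Z j z)"

text \<open>There is no Jacobian factor: in the coordinates \<open>(a, b)\<close> this is twice the
  squared Bergman norm over \<open>D\<close>.\<close>

definition diamond_energy :: "(complex \<Rightarrow> complex) \<Rightarrow> real" where
  "diamond_energy h = integral (cbox (0, 0) (pi, pi)) (\<lambda>p. (cmod (h (diamond p)))\<^sup>2)"

lemma integral_mixed_derivative:
  fixes F :: "real \<Rightarrow> real \<Rightarrow> real"
  assumes "A \<le> B" "C \<le> E"
    and d1: "\<And>a b. ((\<lambda>a. F a b) has_vector_derivative G a b) (at a)"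
    and d2: "\<And>a b. ((\<lambda>b. G a b) has_vector_derivative H a b) (at b)"
    and c: "continuous_on (cbox (A, C) (B, E)) (\<lambda>p. H (fst p) (snd p))"
  shows "integral (cbox (A, C) (B, E)) (\<lambda>p. H (fst p) (snd p)) = F B E - F A E - F B C + F A C"
proof -
  have "integral (cbox (A, C) (B, E)) (\<lambda>p. H (fst p) (snd p)) = integral {A..B} (\<lambda>a. integral {C..E} (\<lambda>b. H a b))"
    using integral_prod_continuous[OF c] by simp
  also have "\<dots> = integral {A..B} (\<lambda>a. G a E - G a C)"
    by (intro Henstock_Kurzweil_Integration.integral_cong integral_unique fundamental_theorem_of_calculus has_vector_derivative_at_within[OF d2] assms)
  also have "((\<lambda>a. G a E - G a C) has_integral (F B E - F B C) - (F A E - F A C)) {A..B}"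
    by (rule fundamental_theorem_of_calculus[of A B "\<lambda>a. F a E - F a C"])
       (auto intro!: assms has_vector_derivative_diff has_vector_derivative_at_within[OF d1])
  then have "integral {A..B} (\<lambda>a. G a E - G a C) = (F B E - F B C) - (F A E - F A C)" by (rule integral_unique)
  finally show ?thesis by simp
qed

lemma has_vector_derivative_cmod_power2:
  assumes "(f has_vector_derivative f') (at x within S)"
  shows "((\<lambda>x. (cmod (f x))\<^sup>2) has_vector_derivative 2 * Re (f' * cnj (f x))) (at x within S)"
proof -
  have "((\<lambda>x. Re (f x * cnj (f x))) has_vector_derivative Re (f x * cnj f' + f' * cnj (f x))) (at x within S)"
    by (intro bounded_linear.has_vector_derivative[OF bounded_linear_Re] has_vector_derivative_mult has_vector_derivative_cnj assms)
  moreover have "Re (f x * cnj (f x)) = (cmod (f x))\<^sup>2" for x unfolding cmod_power2 by (simp add: power2_eq_square)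
  ultimately show ?thesis by (simp add: algebra_simps)
qed

text \<open>
  In the coordinates \<open>z = diamond (a, b)\<close> one has \<open>\<partial>\<^sub>a = (1 - \<i>)/2 \<partial>\<^sub>z\<close> and \<open>\<partial>\<^sub>b = (1 + \<i>)/2 \<partial>\<^sub>z\<close> on holomorphic
  functions, so the first-order contribution \<open>W\<^sub>a cnj W\<^sub>b\<close> to \<open>\<partial>\<^sub>a \<partial>\<^sub>b \<bar>W\<bar>\<^sup>2\<close> is purely imaginary.
\<close>
lemma integral_diamond_second_derivative:
  assumes W: "\<And>z. (W has_field_derivative W' z) (at z)" "\<And>z. (W' has_field_derivative W'' z) (at z)"
    and c: "continuous_on UNIV W''"
  shows "integral (cbox (0, 0) (pi, pi)) (\<lambda>p. Re (W'' (diamond p) * cnj (W (diamond p))))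
     \<le> (cmod (W 0))\<^sup>2 + (cmod (W (of_real pi)))\<^sup>2"
proof -
  define u v :: complex where "u = (1 - \<i>) / 2" and "v = (1 + \<i>) / 2"
  have dz: "((\<lambda>a. diamond (a, b)) has_vector_derivative u) (at a)" "((\<lambda>b. diamond (a, b)) has_vector_derivative v) (at b)" for a b
    unfolding diamond_def u_def v_def by (auto intro!: derivative_eq_intros)
  have da: "((\<lambda>a. h (diamond (a, b))) has_vector_derivative u * h' (diamond (a, b))) (at a)"
    and db: "((\<lambda>b. h (diamond (a, b))) has_vector_derivative v * h' (diamond (a, b))) (at b)"
    if "\<And>z. (h has_field_derivative h' z) (at z)" for h h' a b
    using field_vector_diff_chain_at[OF dz(1) that] field_vector_diff_chain_at[OF dz(2) that] by (simp_all add: o_def mult.commute)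
  define F where "F = (\<lambda>a b. (cmod (W (diamond (a, b))))\<^sup>2)"
  define G where "G = (\<lambda>a b. 2 * Re (u * W' (diamond (a, b)) * cnj (W (diamond (a, b)))))"
  define H where "H = (\<lambda>a b. Re (W'' (diamond (a, b)) * cnj (W (diamond (a, b)))))"
  have "((\<lambda>a. F a b) has_vector_derivative G a b) (at a)" for a b
    unfolding F_def G_def by (rule has_vector_derivative_cmod_power2) (rule da[OF W(1)])
  moreover have "((\<lambda>b. G a b) has_vector_derivative H a b) (at b)" for a b
  proof -
    let ?z = "diamond (a, b)"
    have "((\<lambda>b. u * W' (diamond (a, b)) * cnj (W (diamond (a, b)))) has_vector_derivative
       u * W' ?z * cnj (v * W' ?z) + u * (v * W'' ?z) * cnj (W ?z)) (at b)"
      by (intro has_vector_derivative_mult has_vector_derivative_cnj has_vector_derivative_mult_right db W)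
    then have "((\<lambda>b. Re (u * W' (diamond (a, b)) * cnj (W (diamond (a, b))))) has_vector_derivative
       Re (u * W' ?z * cnj (v * W' ?z) + u * (v * W'' ?z) * cnj (W ?z))) (at b)"
      by (rule bounded_linear.has_vector_derivative[OF bounded_linear_Re])
    then have "((\<lambda>b. 2 * Re (u * W' (diamond (a, b)) * cnj (W (diamond (a, b))))) has_vector_derivative
       2 * Re (u * W' ?z * cnj (v * W' ?z) + u * (v * W'' ?z) * cnj (W ?z))) (at b)"
      by (rule has_vector_derivative_mult_right)
    \<comment> \<open>\<open>u * v = 1 / 2\<close> cancels the factor 2, and
      \<open>u * cnj v\<close> is -i/2, so the first-order term has real part zero.\<close>
    moreover have "2 * Re (u * W' ?z * cnj (v * W' ?z) + u * (v * W'' ?z) * cnj (W ?z)) = H a b"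
      by (simp add: u_def v_def H_def field_simps)
    ultimately show ?thesis by (simp add: G_def)
  qed
  moreover have cW: "continuous_on UNIV W" using W(1) by (meson DERIV_isCont continuous_at_imp_continuous_on)
  have "continuous_on (cbox (0, 0) (pi, pi)) (\<lambda>p. H (fst p) (snd p))"
    unfolding H_def diamond_def
    by (intro continuous_intros continuous_on_compose2[OF c] continuous_on_compose2[OF cW]) auto
  ultimately have "integral (cbox (0, 0) (pi, pi)) (\<lambda>p. H (fst p) (snd p)) = F pi pi - F 0 pi - F pi 0 + F 0 0"
    by (intro integral_mixed_derivative) auto
  \<comment> \<open>The two non-real corners of \<open>D\<close> enter with a minus sign and are
    dropped; the remaining corners are the endpoints \<open>0\<close> and \<open>pi\<close>, where
    the controls act.\<close>
  also have "\<dots> \<le> F pi pi + F 0 0" by (simp add: F_def)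
  also have "F pi pi = (cmod (W (of_real pi)))\<^sup>2" by (simp add: F_def diamond_alt complex_of_real_def)
  also have "F 0 0 = (cmod (W 0))\<^sup>2" by (simp add: F_def diamond_alt complex_of_real_def[symmetric])
  finally show ?thesis by (simp add: H_def)
qed

text \<open>The time derivative is \<open>2 * Re (Wt * cnj W)\<close> integrated over the square.
  Adding the nonnegative potential term \<open>a * b * \<bar>W\<bar>\<^sup>2\<close> turns
  \<open>Wt\<close> into the second derivative in z, to which the corner identity applies.\<close>

lemma diamond_energy_derivative:
  assumes Z: "\<And>j. hermite_mode (real j) (Z j) (Z' j)"
  obtains E' where "\<And>t. ((\<lambda>t. diamond_energy (mode_sum n Z t)) has_field_derivative E' t) (at t)"
    "\<And>t. E' t \<le> 2 * ((cmod (mode_sum n Z t 0))\<^sup>2 + (cmod (mode_sum n Z t (of_real pi)))\<^sup>2)"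
proof -
  have dZ: "(Z j has_field_derivative Z' j z) (at z)" "(Z' j has_field_derivative (z\<^sup>2 + of_real (real j)) * Z j z) (at z)" for j z
    using Z[of j] by (auto simp: hermite_mode_def)
  have cZ: "continuous_on UNIV (Z j)" for j using dZ(1) by (meson DERIV_isCont continuous_at_imp_continuous_on)
  define W where "W = mode_sum n Z"
  define W' where "W' = mode_sum n Z'"
  define Wt where "Wt = mode_sum n (\<lambda>j z. of_real (real j) * Z j z)"
  have dW: "(W t has_field_derivative W' t z) (at z)" for t z
    unfolding W_def W'_def mode_sum_def by (intro DERIV_sum DERIV_cmult dZ)
  have dW': "(W' t has_field_derivative z\<^sup>2 * W t z + Wt t z) (at z)" for t z
  proof -
    have "(W' t has_field_derivative (\<Sum>j\<in>{1..n}. of_real (exp (real j * t)) * ((z\<^sup>2 + of_real (real j)) * Z j z))) (at z)"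
      unfolding W'_def mode_sum_def by (intro DERIV_sum DERIV_cmult dZ)
    then show ?thesis by (simp add: W_def Wt_def mode_sum_def sum_distrib_left sum.distrib[symmetric] algebra_simps)
  qed
  have cd: "continuous_on A diamond" for A unfolding diamond_def by (intro continuous_intros) auto
  have c2: "continuous_on UNIV (\<lambda>(t, p). W t (diamond p))" "continuous_on UNIV (\<lambda>(t, p). Wt t (diamond p))"
  proof -
    have cZd: "continuous_on UNIV (\<lambda>p::real \<times> real \<times> real. Z j (diamond (snd p)))" for j
      by (intro continuous_on_compose2[OF cZ] continuous_on_compose2[OF cd[of UNIV]] continuous_on_snd continuous_on_id) auto
    show "continuous_on UNIV (\<lambda>(t, p). W t (diamond p))" "continuous_on UNIV (\<lambda>(t, p). Wt t (diamond p))"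
      unfolding W_def Wt_def mode_sum_def split_def
      by (intro continuous_on_sum continuous_on_mult continuous_on_of_real continuous_on_exp continuous_on_const
         continuous_on_fst continuous_on_id cZd)+
  qed
  have cW: "continuous_on UNIV (W t)" "continuous_on UNIV (Wt t)" for t
    unfolding W_def Wt_def mode_sum_def by (intro continuous_on_sum continuous_on_mult continuous_on_const cZ)+
  have cWd: "continuous_on A (\<lambda>p. W t (diamond p))" "continuous_on A (\<lambda>p. Wt t (diamond p))" for t A
    by (rule continuous_on_compose2[OF cW(1) cd], simp, rule continuous_on_compose2[OF cW(2) cd], simp)
  define e where "e = (\<lambda>t p. 2 * Re (Wt t (diamond p) * cnj (W t (diamond p))))"
  have dt: "((\<lambda>t. (cmod (W t z))\<^sup>2) has_field_derivative 2 * Re (Wt t z * cnj (W t z))) (at t)" for t z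
  proof -
    have "((\<lambda>t. W t z) has_vector_derivative Wt t z) (at t)"
      unfolding W_def Wt_def mode_sum_def
    proof (rule has_vector_derivative_sum)
      fix j
      have "((\<lambda>t. exp (real j * t)) has_real_derivative real j * exp (real j * t)) (at t)"
        by (auto intro!: derivative_eq_intros)
      from has_vector_derivative_mult_left[OF has_vector_derivative_of_real[OF this], of "Z j z"]
      show "((\<lambda>t. of_real (exp (real j * t)) * Z j z) has_vector_derivative of_real (exp (real j * t)) * (of_real (real j) * Z j z)) (at t)"
        by (simp add: mult_ac)
    qed
    from has_vector_derivative_cmod_power2[OF this] show ?thesis
      by (simp add: has_real_derivative_iff_has_vector_derivative)
  qed
  have deriv: "((\<lambda>t. integral (cbox (0, 0) (pi, pi)) (\<lambda>p. (cmod (W t (diamond p)))\<^sup>2)) has_field_derivative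
      integral (cbox (0, 0) (pi, pi)) (e t)) (at t within UNIV)" for t
  proof (rule leibniz_rule_field_derivative)
    show "((\<lambda>t. (cmod (W t (diamond p)))\<^sup>2) has_field_derivative e t p) (at t within UNIV)" for t p
      unfolding e_def using dt by simp
    show "(\<lambda>p. (cmod (W t (diamond p)))\<^sup>2) integrable_on cbox (0, 0) (pi, pi)" for t
      by (intro integrable_continuous continuous_intros cWd)
    show "continuous_on (UNIV \<times> cbox (0, 0) (pi, pi)) (\<lambda>(t, p). e t p)"
      unfolding e_def split_def using c2[unfolded split_def]
      by (intro continuous_intros) (auto elim: continuous_on_subset)
  qed auto
  have bound: "integral (cbox (0, 0) (pi, pi)) (e t) \<le> 2 * ((cmod (W t 0))\<^sup>2 + (cmod (W t (of_real pi)))\<^sup>2)" for t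
  proof -
    let ?H = "\<lambda>p. Re ((diamond p)\<^sup>2 * W t (diamond p) * cnj (W t (diamond p)) + Wt t (diamond p) * cnj (W t (diamond p)))"
    have "integral (cbox (0, 0) (pi, pi)) (e t) \<le> integral (cbox (0, 0) (pi, pi)) (\<lambda>p. 2 * ?H p)"
    proof (rule integral_le)
      show "e t integrable_on cbox (0, 0) (pi, pi)" "(\<lambda>p. 2 * ?H p) integrable_on cbox (0, 0) (pi, pi)"
        unfolding e_def
        by (intro integrable_continuous continuous_intros cWd cd)+
      fix p :: "real \<times> real" assume p: "p \<in> cbox (0, 0) (pi, pi)"
      obtain a b where ab: "p = (a, b)" by (cases p)
      have "a \<ge> 0" "b \<ge> 0" using p by (auto simp: ab)
      moreover have "Re ((diamond p)\<^sup>2 * W t (diamond p) * cnj (W t (diamond p))) = a * b * (cmod (W t (diamond p)))\<^sup>2"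
      proof -
        have "W t (diamond p) * cnj (W t (diamond p)) = of_real ((cmod (W t (diamond p)))\<^sup>2)"
          by (simp only: complex_norm_square)
        moreover have "Re ((diamond p)\<^sup>2) = a * b" 
          unfolding ab diamond_alt power2_eq_square
          by (simp add: add_divide_distrib diff_divide_distrib algebra_simps)
        ultimately show ?thesis by (simp add: mult.assoc del: of_real_power)
      qed
      ultimately have "Re ((diamond p)\<^sup>2 * W t (diamond p) * cnj (W t (diamond p))) \<ge> 0" by simp
      then show "e t p \<le> 2 * ?H p" by (simp add: e_def)
    qed
    also have "\<dots> = 2 * integral (cbox (0, 0) (pi, pi)) ?H" by (rule Henstock_Kurzweil_Integration.integral_mult_right)
    also have "integral (cbox (0, 0) (pi, pi)) ?H \<le> (cmod (W t 0))\<^sup>2 + (cmod (W t (of_real pi)))\<^sup>2"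
    proof -
      have "continuous_on UNIV (\<lambda>z. z\<^sup>2 * W t z + Wt t z)"
        by (intro continuous_on_add continuous_on_mult continuous_on_power continuous_on_id cW)
      from integral_diamond_second_derivative[OF dW dW' this] show ?thesis by (simp only: distrib_right)
    qed
    finally show ?thesis by simp
  qed
  show ?thesis
    using that[of "\<lambda>t. integral (cbox (0, 0) (pi, pi)) (e t)"] deriv bound
    unfolding diamond_energy_def W_def by simp
qed

text \<open>The derivative bound is integrated from minus infinity, where the energy tends to
  \<open>0\<close>. The weight \<open>\<delta> * exp (2 * s)\<close> on the negative half-line
  integrates, with the factor 2 of the derivative bound, to exactly \<open>\<delta>\<close>.\<close>

lemma diamond_energy_bound:
  assumes Z: "\<And>j. hermite_mode (real j) (Z j) (Z' j)"
    and \<delta>: "\<And>s. s \<le> 0 \<Longrightarrow> (cmod (mode_sum n Z s 0))\<^sup>2 + (cmod (mode_sum n Z s (of_real pi)))\<^sup>2 \<le> \<delta> * exp (2 * s)"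
  shows "diamond_energy (mode_sum n Z 0) \<le> \<delta>"
    and "t \<ge> 0 \<Longrightarrow> diamond_energy (mode_sum n Z t) \<le> \<delta> +
      2 * integral {0..t} (\<lambda>s. (cmod (mode_sum n Z s 0))\<^sup>2 + (cmod (mode_sum n Z s (of_real pi)))\<^sup>2)"
proof -
  define E where "E = (\<lambda>t. diamond_energy (mode_sum n Z t))"
  define \<beta> where "\<beta> = (\<lambda>s. (cmod (mode_sum n Z s 0))\<^sup>2 + (cmod (mode_sum n Z s (of_real pi)))\<^sup>2)"
  obtain E' where E': "\<And>t. (E has_field_derivative E' t) (at t)" "\<And>t. E' t \<le> 2 * \<beta> t"
    unfolding E_def \<beta>_def using diamond_energy_derivative[OF Z] by metis
  have FTC: "(E' has_integral E b - E a) {a..b}" if "a \<le> b" for a b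
    using that E'(1) by (intro fundamental_theorem_of_calculus) 
      (auto simp: has_real_derivative_iff_has_vector_derivative intro: has_vector_derivative_at_within)
  have cZ: "continuous_on UNIV (Z j)" for j
    using Z[of j] unfolding hermite_mode_def by (meson DERIV_isCont continuous_at_imp_continuous_on)
  have cd: "continuous_on A diamond" for A unfolding diamond_def by (intro continuous_intros) auto
  have cZd: "continuous_on A (\<lambda>p. Z j (diamond p))" for j A
    by (rule continuous_on_compose2[OF cZ cd]) simp
  have step: "E 0 \<le> \<delta> + E s" if s: "s \<le> 0" for s
  proof -
    have "((\<lambda>r. 2 * \<delta> * exp (2 * r)) has_integral (\<delta> * exp (2 * 0) - \<delta> * exp (2 * s))) {s..0}"
      using s by (intro fundamental_theorem_of_calculus)
        (auto simp: has_real_derivative_iff_has_vector_derivative[symmetric] intro!: derivative_eq_intros)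
    from FTC[OF s] this have "E 0 - E s \<le> \<delta> * exp (2 * 0) - \<delta> * exp (2 * s)"
    proof (rule has_integral_le)
      fix r assume "r \<in> {s..0}"
      then show "E' r \<le> 2 * \<delta> * exp (2 * r)" using E'(2)[of r] \<delta>[of r] by (simp add: \<beta>_def)
    qed
    then have "E 0 - E s \<le> \<delta> - \<delta> * exp (2 * s)" by simp
    moreover have "\<delta> \<ge> 0" using \<delta>[of 0] by (auto intro: order_trans[rotated])
    ultimately show ?thesis by (smt (verit) exp_ge_zero mult_nonneg_nonneg)
  qed
  define K where "K = integral (cbox (0, 0) (pi, pi)) (\<lambda>p. (\<Sum>j\<in>{1..n}. cmod (Z j (diamond p)))\<^sup>2)"
  have Es: "E s \<le> exp (2 * s) * K" if s: "s \<le> 0" for s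
  proof -
    have "E s \<le> integral (cbox (0, 0) (pi, pi)) (\<lambda>p. exp (2 * s) * (\<Sum>j\<in>{1..n}. cmod (Z j (diamond p)))\<^sup>2)"
      unfolding E_def diamond_energy_def
    proof (rule integral_le)
      show "(\<lambda>p. (cmod (mode_sum n Z s (diamond p)))\<^sup>2) integrable_on cbox (0, 0) (pi, pi)"
        "(\<lambda>p. exp (2 * s) * (\<Sum>j\<in>{1..n}. cmod (Z j (diamond p)))\<^sup>2) integrable_on cbox (0, 0) (pi, pi)"
        unfolding mode_sum_def by (intro integrable_continuous continuous_intros cZd)+
      fix p
      have "cmod (mode_sum n Z s (diamond p)) \<le> (\<Sum>j\<in>{1..n}. exp s * cmod (Z j (diamond p)))"
        unfolding mode_sum_def
      proof (rule sum_norm_le)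
        fix j assume "j \<in> {1..n}"
        \<comment> \<open>For negative time every mode with \<open>j \<ge> 1\<close> decays at least
          as fast as the first.\<close>
        then have "real j * s \<le> 1 * s" using s by (intro mult_right_mono_neg) auto
        then show "cmod (complex_of_real (exp (real j * s)) * Z j (diamond p)) \<le> exp s * cmod (Z j (diamond p))"
          by (simp add: norm_mult mult_right_mono)
      qed
      then have "cmod (mode_sum n Z s (diamond p)) \<le> exp s * (\<Sum>j\<in>{1..n}. cmod (Z j (diamond p)))"
        by (simp add: sum_distrib_left)
      then have "(cmod (mode_sum n Z s (diamond p)))\<^sup>2 \<le> (exp s * (\<Sum>j\<in>{1..n}. cmod (Z j (diamond p))))\<^sup>2"
        by (intro power_mono) auto
      then show "(cmod (mode_sum n Z s (diamond p)))\<^sup>2 \<le> exp (2 * s) * (\<Sum>j\<in>{1..n}. cmod (Z j (diamond p)))\<^sup>2"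
        by (simp add: power_mult_distrib exp_double)
    qed
    then show ?thesis by (simp add: K_def)
  qed
  have "E 0 \<le> \<delta> + 0"
  proof (rule tendsto_lowerbound)
    show "((\<lambda>s. \<delta> + exp (2 * s) * K) \<longlongrightarrow> \<delta> + 0) at_bot"
    proof -
      have "((\<lambda>s::real. exp (2 * s)) \<longlongrightarrow> 0) at_bot"
        by (rule filterlim_compose[OF exp_at_bot]) (auto intro!: filterlim_tendsto_pos_mult_at_bot[OF tendsto_const _ filterlim_ident])
      from tendsto_add[OF tendsto_const[of \<delta>] tendsto_mult_right[OF this, of K]] show ?thesis
        by (simp add: mult.commute)
    qed
    show "\<forall>\<^sub>F s in at_bot. E 0 \<le> \<delta> + exp (2 * s) * K"
      using eventually_le_at_bot[of 0]
    proof eventually_elim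
      case (elim s)
      show ?case using step[OF elim] Es[OF elim] by linarith
    qed
  qed auto
  then show 0: "diamond_energy (mode_sum n Z 0) \<le> \<delta>" by (simp add: E_def)
  show "diamond_energy (mode_sum n Z t) \<le> \<delta> +
      2 * integral {0..t} (\<lambda>s. (cmod (mode_sum n Z s 0))\<^sup>2 + (cmod (mode_sum n Z s (of_real pi)))\<^sup>2)" if t: "t \<ge> 0"
  proof -
    have "continuous_on {0..t} \<beta>" unfolding \<beta>_def mode_sum_def by (intro continuous_intros)
    then have "((\<lambda>s. 2 * \<beta> s) has_integral 2 * integral {0..t} \<beta>) {0..t}"
      by (intro has_integral_mult_right integrable_integral integrable_continuous_real)
    from has_integral_le[OF FTC[OF t] this E'(2)] 0 show ?thesis by (simp add: E_def \<beta>_def)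
  qed
qed

subsection \<open>The Bergman space of the square\<close>

text \<open>Lebesgue measure is determined by its values on boxes. The product form makes Tonelli's
  theorem available in the real and imaginary parts.\<close>

lemma lborel_complex_eq_distr: "(lborel :: complex measure) = distr (lborel \<Otimes>\<^sub>M lborel) borel (\<lambda>p. Complex (fst p) (snd p))"
proof (rule lborel_eqI)
  have meas: "(\<lambda>p. Complex (fst p) (snd p)) \<in> borel_measurable (lborel \<Otimes>\<^sub>M lborel)"
  proof -
    have "continuous_on UNIV (\<lambda>p::real\<times>real. Complex (fst p) (snd p))"
      unfolding Complex_eq by (intro continuous_intros)
    then show ?thesis by (simp add: lborel_prod borel_measurable_continuous_onI)
  qed
  fix l u :: complex assume le: "\<And>b. b \<in> Basis \<Longrightarrow> l \<bullet> b \<le> u \<bullet> b"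
  have le': "Re l \<le> Re u" "Im l \<le> Im u" using le[of 1] le[of \<i>] by (auto simp: Basis_complex_def)
  have "(\<lambda>p. Complex (fst p) (snd p)) -` box l u \<inter> space (lborel \<Otimes>\<^sub>M lborel) = {Re l<..<Re u} \<times> {Im l<..<Im u}"
    by (auto simp: box_def Basis_complex_def space_pair_measure)
  then have "emeasure (distr (lborel \<Otimes>\<^sub>M lborel) borel (\<lambda>p. Complex (fst p) (snd p))) (box l u)
      = emeasure (lborel \<Otimes>\<^sub>M lborel) ({Re l<..<Re u} \<times> {Im l<..<Im u})"
    by (subst emeasure_distr[OF meas]) auto
  also have "\<dots> = ennreal (Re u - Re l) * ennreal (Im u - Im l)"
    using le' by (subst lborel.emeasure_pair_measure_Times) auto
  also have "\<dots> = (\<Prod>b\<in>Basis. (u - l) \<bullet> b)"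
    using le' by (simp add: Basis_complex_def ennreal_mult)
  finally show "emeasure (distr (lborel \<Otimes>\<^sub>M lborel) borel (\<lambda>p. Complex (fst p) (snd p))) (box l u) = (\<Prod>b\<in>Basis. (u - l) \<bullet> b)" .
qed simp

text \<open>The linear change of variables is split into one-dimensional substitutions:
  \<open>x = a + y\<close> for fixed \<open>y\<close>, then \<open>y = (b - a) / 2\<close> for fixed
  \<open>a\<close>. The second gives the factor \<open>1 / 2\<close>.\<close>

lemma nn_integral_lborel_diamond:
  fixes f :: "complex \<Rightarrow> ennreal"
  assumes f[measurable]: "f \<in> borel_measurable borel"
  shows "(\<integral>\<^sup>+z. f z \<partial>lborel) = ennreal (1 / 2) * (\<integral>\<^sup>+p. f (diamond p) \<partial>lborel)"
proof -
  have C: "(\<lambda>p. Complex (g p) (h p)) \<in> borel_measurable M"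
    if [measurable]: "g \<in> borel_measurable M" "h \<in> borel_measurable M" for g h and M :: "'a measure"
    unfolding Complex_eq by measurable
  have [measurable]: "(\<lambda>p. Complex (fst p) (snd p)) \<in> borel_measurable (lborel \<Otimes>\<^sub>M lborel)" by (intro C) auto
  have "(\<integral>\<^sup>+z. f z \<partial>lborel) = (\<integral>\<^sup>+p. f (Complex (fst p) (snd p)) \<partial>(lborel \<Otimes>\<^sub>M lborel))"
    by (subst lborel_complex_eq_distr) (simp add: nn_integral_distr)
  also have "\<dots> = (\<integral>\<^sup>+y. (\<integral>\<^sup>+x. f (Complex x y) \<partial>lborel) \<partial>lborel)"
    by (subst lborel_pair.nn_integral_snd[symmetric]) (auto intro!: measurable_compose[OF _ f])
  also have "\<dots> = (\<integral>\<^sup>+y. (\<integral>\<^sup>+a. f (Complex (a + y) y) \<partial>lborel) \<partial>lborel)"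
  proof (rule nn_integral_cong)
    fix y :: real
    have "(\<lambda>x. f (Complex x y)) \<in> borel_measurable borel" by (intro measurable_compose[OF _ f] C) auto
    from nn_integral_real_affine[OF this, of 1 y]
    show "(\<integral>\<^sup>+x. f (Complex x y) \<partial>lborel) = (\<integral>\<^sup>+a. f (Complex (a + y) y) \<partial>lborel)"
      by (simp add: add.commute)
  qed
  also have "\<dots> = (\<integral>\<^sup>+a. (\<integral>\<^sup>+y. f (Complex (a + y) y) \<partial>lborel) \<partial>lborel)"
    by (rule lborel_pair.Fubini') (unfold split_def, intro measurable_compose[OF _ f] C, measurable)
  also have "\<dots> = (\<integral>\<^sup>+a. ennreal (1 / 2) * (\<integral>\<^sup>+b. f (diamond (a, b)) \<partial>lborel) \<partial>lborel)"
  proof (rule nn_integral_cong)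
    fix a :: real
    have "(\<lambda>y. f (Complex (a + y) y)) \<in> borel_measurable borel" by (intro measurable_compose[OF _ f] C) auto
    from nn_integral_real_affine[OF this, of "1 / 2" "- a / 2"]
    have "(\<integral>\<^sup>+y. f (Complex (a + y) y) \<partial>lborel) = ennreal (1 / 2) * (\<integral>\<^sup>+b. f (Complex (a + (- a / 2 + 1 / 2 * b)) (- a / 2 + 1 / 2 * b)) \<partial>lborel)"
      by simp
    moreover have "Complex (a + (- a / 2 + 1 / 2 * b)) (- a / 2 + 1 / 2 * b) = diamond (a, b)" for b
      by (simp add: diamond_alt field_simps)
    ultimately show "(\<integral>\<^sup>+y. f (Complex (a + y) y) \<partial>lborel) = ennreal (1 / 2) * (\<integral>\<^sup>+b. f (diamond (a, b)) \<partial>lborel)"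
      by simp
  qed
  also have "\<dots> = ennreal (1 / 2) * (\<integral>\<^sup>+a. (\<integral>\<^sup>+b. f (diamond (a, b)) \<partial>lborel) \<partial>lborel)"
    by (rule nn_integral_cmult) (unfold diamond_alt, measurable, intro measurable_compose[OF _ f] C, measurable)
  also have "(\<integral>\<^sup>+a. (\<integral>\<^sup>+b. f (diamond (a, b)) \<partial>lborel) \<partial>lborel) = (\<integral>\<^sup>+p. f (diamond p) \<partial>lborel)"
    unfolding lborel_prod[symmetric]
    by (rule lborel.nn_integral_fst) (unfold diamond_def, intro measurable_compose[OF _ f], measurable)
  finally show ?thesis .
qed

lemma open_D: "open D"
  unfolding D_def by (intro open_Collect_less continuous_intros)

lemma diamond_in_D_iff: "diamond p \<in> D \<longleftrightarrow> p \<in> box (0, 0) (pi, pi)"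
proof -
  obtain a b where p: "p = (a, b)" by (cases p)
  show ?thesis unfolding p diamond_alt D_def
    by (auto simp: mem_box Basis_prod_def field_simps abs_if split: if_splits)
qed

text \<open>Extended-valued, so that Tonelli's theorem and Fatou's lemma apply before finiteness is
  known.\<close>

definition bergman_energy :: "(complex \<Rightarrow> complex) \<Rightarrow> ennreal" where
  "bergman_energy h = (\<integral>\<^sup>+z. indicator D z * ennreal ((cmod (h z))\<^sup>2) \<partial>lborel)"

lemma borel_measurable_indicator_D:
  assumes "continuous_on D h"
  shows "(\<lambda>z. indicator D z * ennreal ((cmod (h z))\<^sup>2)) \<in> borel_measurable borel"
proof -
  have "continuous_on D (\<lambda>z. (cmod (h z))\<^sup>2)" by (intro continuous_intros assms)
  then have "(\<lambda>z. indicator D z *\<^sub>R ((cmod (h z))\<^sup>2)) \<in> borel_measurable borel"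
    using open_D by (intro borel_measurable_continuous_on_indicator) auto
  then have "(\<lambda>z. ennreal (indicator D z *\<^sub>R ((cmod (h z))\<^sup>2))) \<in> borel_measurable borel" by measurable
  moreover have "(\<lambda>z. ennreal (indicator D z *\<^sub>R ((cmod (h z))\<^sup>2))) = (\<lambda>z. indicator D z * ennreal ((cmod (h z))\<^sup>2))"
    by (auto simp: indicator_def)
  ultimately show ?thesis by (simp only:)
qed

lemma bergman_energy_eq_diamond_energy:
  assumes h: "continuous_on UNIV h"
  shows "bergman_energy h = ennreal (diamond_energy h / 2)"
proof -
  have cd: "continuous_on A diamond" for A unfolding diamond_def by (intro continuous_intros) auto
  have c: "continuous_on A (\<lambda>p. (cmod (h (diamond p)))\<^sup>2)" for A
    by (intro continuous_intros continuous_on_compose2[OF h cd]) auto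
  then have "((\<lambda>p. (cmod (h (diamond p)))\<^sup>2) has_integral diamond_energy h) (cbox (0, 0) (pi, pi))"
    unfolding diamond_energy_def by (intro integrable_integral integrable_continuous)
  then have hi: "((\<lambda>p. (cmod (h (diamond p)))\<^sup>2) has_integral diamond_energy h) (box (0, 0) (pi, pi))"
    by (simp add: has_integral_open_interval)
  have "bergman_energy h = ennreal (1 / 2) * (\<integral>\<^sup>+p. indicator D (diamond p) * ennreal ((cmod (h (diamond p)))\<^sup>2) \<partial>lborel)"
    unfolding bergman_energy_def
    by (rule nn_integral_lborel_diamond) (rule borel_measurable_indicator_D[OF continuous_on_subset[OF h]], simp)
  also have "(\<integral>\<^sup>+p. indicator D (diamond p) * ennreal ((cmod (h (diamond p)))\<^sup>2) \<partial>lborel)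
     = (\<integral>\<^sup>+p. ennreal ((cmod (h (diamond p)))\<^sup>2) * indicator (box (0, 0) (pi, pi)) p \<partial>lborel)"
    by (intro nn_integral_cong) (auto simp: indicator_def diamond_in_D_iff)
  also have "\<dots> = ennreal (diamond_energy h)"
    by (rule nn_integral_has_integral_lebesgue'[OF _ hi]) simp
  also have "ennreal (1 / 2) * \<dots> = ennreal (1 / 2 * diamond_energy h)" by (rule ennreal_mult'[symmetric]) simp
  finally show ?thesis by simp
qed

text \<open>
  Cauchy's formula for \<open>h\<^sup>2\<close> at \<open>z\<close> on the circle of radius \<open>\<rho>\<close> about \<open>z + c\<close>, averaged over small \<open>c\<close>: by
  translation invariance this replaces polar coordinates.
\<close>
lemma bergman_pointwise_bound:
  assumes h: "h holomorphic_on D" and \<rho>: "\<rho> > 0" and sub: "ball z (2 * \<rho>) \<subseteq> D"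
  shows "ennreal ((cmod (h z))\<^sup>2 * (pi * \<rho>\<^sup>2 / 4)) \<le> 2 * bergman_energy h"
proof -
  define k where "k = (\<lambda>z. indicator D z * ennreal ((cmod (h z))\<^sup>2))"
  define e where "e = (\<lambda>x. of_real \<rho> * exp (2 * of_real pi * \<i> * of_real x))"
  have [measurable]: "k \<in> borel_measurable borel"
    unfolding k_def by (rule borel_measurable_indicator_D[OF holomorphic_on_imp_continuous_on[OF h]])
  have ce: "continuous_on A e" for A unfolding e_def by (intro continuous_intros)
  have [measurable]: "e \<in> borel_measurable borel" using ce by (rule borel_measurable_continuous_onI)
  have ne: "cmod (e x) = \<rho>" for x using \<rho> by (simp add: e_def norm_mult norm_exp_eq_Re)
  have pt: "ennreal ((cmod (h z))\<^sup>2) \<le> 2 * (\<integral>\<^sup>+x. indicator {0..1} x * k (z + c + e x) \<partial>lborel)" if c: "c \<in> ball 0 (\<rho> / 2)" for c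
  proof -
    have c': "cmod c < \<rho> / 2" using c by simp
    have inD: "w \<in> D" if "cmod (w - (z + c)) \<le> \<rho>" for w
    proof -
      have "cmod (w - z) \<le> cmod (w - (z + c)) + cmod c"
        using norm_triangle_ineq[of "w - (z + c)" c] by (simp add: algebra_simps)
      then have "w \<in> ball z (2 * \<rho>)" using that c' \<rho> by (simp add: dist_norm norm_minus_commute)
      then show ?thesis using sub by blast
    qed
    \<comment> \<open>Taking \<open>h\<^sup>2\<close> in place of \<open>h\<close> produces the
      squared modulus directly, without a Cauchy-Schwarz step on the circle.\<close>
    have hol: "(\<lambda>w. (h w)\<^sup>2) holomorphic_on cball (z + c) \<rho>"
      by (intro holomorphic_intros holomorphic_on_subset[OF h]) (auto simp: dist_norm norm_minus_commute intro: inD)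
    have "((\<lambda>w. (h w)\<^sup>2 / (w - z)) has_contour_integral (2 * of_real pi * \<i> * (h z)\<^sup>2)) (circlepath (z + c) \<rho>)"
      by (rule Cauchy_integral_circlepath_simple[OF hol]) (use c' \<rho> in simp)
    then have I1: "((\<lambda>x. (h (z + c + e x))\<^sup>2 / (c + e x) * (2 * of_real pi * \<i> * e x)) has_integral 2 * of_real pi * \<i> * (h z)\<^sup>2) {0..1}"
      unfolding has_contour_integral_def
    proof (rule has_integral_eq[rotated])
      fix x :: real assume "x \<in> {0..1}"
      then have "vector_derivative (circlepath (z + c) \<rho>) (at x within {0..1}) = 2 * of_real pi * \<i> * e x"
        by (subst vector_derivative_circlepath01) (auto simp: e_def)
      moreover have "circlepath (z + c) \<rho> x = z + c + e x" by (simp add: circlepath e_def)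
      ultimately show "(h (circlepath (z + c) \<rho> x))\<^sup>2 / (circlepath (z + c) \<rho> x - z) * vector_derivative (circlepath (z + c) \<rho>) (at x within {0..1})
        = (h (z + c + e x))\<^sup>2 / (c + e x) * (2 * of_real pi * \<i> * e x)" by simp
    qed
    define F where "F = (\<lambda>x. (cmod (h (z + c + e x)))\<^sup>2)"
    have cF: "continuous_on {0..1} F" unfolding F_def
      by (intro continuous_intros continuous_on_compose2[OF holomorphic_on_imp_continuous_on[OF h]] ce) (auto intro!: inD simp: ne)
    then have iF: "((\<lambda>x. 4 * pi * F x) has_integral 4 * pi * integral {0..1} F) {0..1}"
      by (intro has_integral_mult_right integrable_integral integrable_continuous_real)
    have le: "cmod ((h (z + c + e x))\<^sup>2 / (c + e x) * (2 * of_real pi * \<i> * e x)) \<le> 4 * pi * F x" for x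
    proof -
      \<comment> \<open>The shifted circle keeps distance at least \<open>\<rho> / 2\<close> from
        \<open>z\<close>, so the Cauchy kernel costs at most a factor 2.\<close>
      have "\<rho> / 2 \<le> cmod (c + e x)" using norm_triangle_ineq2[of "e x" "- c"] c' ne[of x] by (simp add: add.commute)
      moreover from this have "0 < cmod (c + e x) * (\<rho> / 2)" using \<rho> by (intro mult_pos_pos) linarith+
      ultimately have "cmod (h (z + c + e x)) ^ 2 / cmod (c + e x) \<le> cmod (h (z + c + e x)) ^ 2 / (\<rho> / 2)"
        by (intro divide_left_mono) auto
      then have "cmod (h (z + c + e x)) ^ 2 / cmod (c + e x) * (2 * pi * \<rho>) \<le> cmod (h (z + c + e x)) ^ 2 / (\<rho> / 2) * (2 * pi * \<rho>)"
        using \<rho> by (intro mult_right_mono) auto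
      then show ?thesis using \<rho> by (simp add: norm_mult norm_divide norm_power ne F_def mult_ac)
    qed
    from integral_norm_bound_integral[OF has_integral_integrable[OF I1] has_integral_integrable[OF iF] le]
    have "cmod (2 * of_real pi * \<i> * (h z)\<^sup>2) \<le> 4 * pi * integral {0..1} F"
      unfolding integral_unique[OF I1] integral_unique[OF iF] .
    then have "(cmod (h z))\<^sup>2 \<le> 2 * integral {0..1} F" by (simp add: norm_mult norm_power)
    then have "ennreal ((cmod (h z))\<^sup>2) \<le> ennreal (2 * integral {0..1} F)" by (rule ennreal_leI)
    also have "\<dots> = 2 * ennreal (integral {0..1} F)" by (simp add: ennreal_mult')
    also have "ennreal (integral {0..1} F) = (\<integral>\<^sup>+x. ennreal (F x) * indicator {0..1} x \<partial>lborel)"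
      by (rule nn_integral_has_integral_lebesgue'[symmetric]) (use cF in \<open>auto simp: F_def intro!: integrable_integral integrable_continuous_real\<close>)
    also have "\<dots> = (\<integral>\<^sup>+x. indicator {0..1} x * k (z + c + e x) \<partial>lborel)"
      by (intro nn_integral_cong) (auto simp: F_def k_def indicator_def ne intro!: inD)
    finally show ?thesis .
  qed
  have "emeasure lborel (ball (0::complex) (\<rho> / 2)) = ennreal (pi * \<rho>\<^sup>2 / 4)"
    using \<rho> by (simp add: emeasure_ball unit_ball_vol_2 power2_eq_square)
  then have "ennreal ((cmod (h z))\<^sup>2 * (pi * \<rho>\<^sup>2 / 4)) = ennreal ((cmod (h z))\<^sup>2) * emeasure lborel (ball (0::complex) (\<rho> / 2))"
    by (simp only: ennreal_mult' zero_le_power2)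
  also have "\<dots> = (\<integral>\<^sup>+c. ennreal ((cmod (h z))\<^sup>2) * indicator (ball 0 (\<rho> / 2)) (c::complex) \<partial>lborel)"
    by (subst nn_integral_cmult_indicator) auto
  also have "\<dots> \<le> (\<integral>\<^sup>+c. 2 * (\<integral>\<^sup>+x. indicator {0..1} x * k (z + c + e x) \<partial>lborel) \<partial>lborel)"
    by (intro nn_integral_mono) (use pt in \<open>auto simp: indicator_def\<close>)
  also have "\<dots> = 2 * (\<integral>\<^sup>+c. (\<integral>\<^sup>+x. indicator {0..1} x * k (z + c + e x) \<partial>lborel) \<partial>lborel)"
    by (rule nn_integral_cmult) measurable
  also have "(\<integral>\<^sup>+c. (\<integral>\<^sup>+x. indicator {0..1} x * k (z + c + e x) \<partial>lborel) \<partial>lborel)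
     = (\<integral>\<^sup>+x. (\<integral>\<^sup>+c. indicator {0..1} x * k (z + c + e x) \<partial>lborel) \<partial>lborel)"
    by (rule lborel_pair.Fubini') measurable
  also have "\<dots> = (\<integral>\<^sup>+x. indicator {0..1::real} x * bergman_energy h \<partial>lborel)"
  proof (rule nn_integral_cong)
    fix x :: real
    have "bergman_energy h = (\<integral>\<^sup>+z. k z \<partial>distr lborel borel ((+) (z + e x)))"
      unfolding bergman_energy_def k_def lborel_distr_plus ..
    also have "\<dots> = (\<integral>\<^sup>+c. k (z + e x + c) \<partial>lborel)" by (rule nn_integral_distr) measurable
    finally have "bergman_energy h = (\<integral>\<^sup>+c. k (z + c + e x) \<partial>lborel)" by (simp add: add_ac)
    moreover have "(\<integral>\<^sup>+c. indicator {0..1} x * k (z + c + e x) \<partial>lborel) = indicator {0..1} x * (\<integral>\<^sup>+c. k (z + c + e x) \<partial>lborel)"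
      by (rule nn_integral_cmult) measurable
    ultimately show "(\<integral>\<^sup>+c. indicator {0..1} x * k (z + c + e x) \<partial>lborel) = indicator {0..1} x * bergman_energy h" by simp
  qed
  also have "\<dots> = bergman_energy h" by (subst nn_integral_multc) auto
  finally show ?thesis .
qed

lemma bergman_energy_diff_le:
  "bergman_energy f \<le> 2 * bergman_energy (\<lambda>z. f z - g z) + 2 * bergman_energy g"
  if c: "continuous_on D f" "continuous_on D g"
proof -
  have m: "(\<lambda>z. indicator D z * ennreal ((cmod (f z - g z))\<^sup>2)) \<in> borel_measurable borel"
     "(\<lambda>z. indicator D z * ennreal ((cmod (g z))\<^sup>2)) \<in> borel_measurable borel"
    by (intro borel_measurable_indicator_D continuous_intros c)+
  have "bergman_energy f \<le> (\<integral>\<^sup>+z. 2 * (indicator D z * ennreal ((cmod (f z - g z))\<^sup>2)) + 2 * (indicator D z * ennreal ((cmod (g z))\<^sup>2)) \<partial>lborel)"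
    unfolding bergman_energy_def
  proof (rule nn_integral_mono)
    fix z
    have "(cmod (f z))\<^sup>2 \<le> 2 * (cmod (f z - g z))\<^sup>2 + 2 * (cmod (g z))\<^sup>2"
      using norm_diff_power2_le[of "f z" 0 "g z"] by simp
    then have "ennreal ((cmod (f z))\<^sup>2) \<le> ennreal (2 * (cmod (f z - g z))\<^sup>2 + 2 * (cmod (g z))\<^sup>2)" by (rule ennreal_leI)
    also have "\<dots> = 2 * ennreal ((cmod (f z - g z))\<^sup>2) + 2 * ennreal ((cmod (g z))\<^sup>2)"
      by (simp add: ennreal_plus ennreal_mult' del: ennreal_power)
    finally show "indicator D z * ennreal ((cmod (f z))\<^sup>2) \<le> 2 * (indicator D z * ennreal ((cmod (f z - g z))\<^sup>2)) + 2 * (indicator D z * ennreal ((cmod (g z))\<^sup>2))"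
      by (auto simp: indicator_def)
  qed
  also have "\<dots> = 2 * bergman_energy (\<lambda>z. f z - g z) + 2 * bergman_energy g"
    unfolding bergman_energy_def using m by (subst nn_integral_add) (auto simp: nn_integral_cmult)
  finally show ?thesis .
qed

text \<open>Completeness of the Bergman space: the pointwise bound turns the Cauchy property in
  energy into uniform convergence on compact sets, which keeps holomorphy, and Fatou's lemma bounds
  the energy of the limit.\<close>

lemma bergman_cauchy_limit:
  assumes h: "\<And>k. h k holomorphic_on D" and fin: "\<And>k. bergman_energy (h k) < \<infinity>"
    and cauchy: "\<And>e. e > 0 \<Longrightarrow> \<exists>N. \<forall>k\<ge>N. \<forall>l\<ge>N. bergman_energy (\<lambda>z. h k z - h l z) \<le> ennreal e"
  obtains H where "H \<in> bergman_space D" "\<And>K. compact K \<Longrightarrow> K \<subseteq> D \<Longrightarrow> uniform_limit K h H sequentially"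
proof -
  have hd: "(\<lambda>z. h k z - h l z) holomorphic_on D" for k l by (intro holomorphic_intros h)
  have uc: "uniformly_Cauchy_on K h" if K: "compact K" "K \<subseteq> D" for K
  proof -
    obtain d where d: "d > 0" "\<And>z. z \<in> K \<Longrightarrow> ball z d \<subseteq> D"
    proof (cases "K = {}")
      case False
      then obtain d where "0 < d" "(\<Union>z\<in>K. ball z d) \<subseteq> D"
        using compact_subset_open_imp_ball_epsilon_subset[OF K(1) open_D K(2)] by auto
      then show ?thesis using that by blast
    qed (use that[of 1] in auto)
    \<comment> \<open>Half of \<open>d\<close>, because the pointwise bound uses a disc of radius
      \<open>2 * \<rho>\<close>.\<close>
    define \<rho> where "\<rho> = d / 2"
    define c where "c = pi * \<rho>\<^sup>2 / 4"
    have \<rho>: "\<rho> > 0" "c > 0" using d by (auto simp: \<rho>_def c_def)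
    show ?thesis unfolding uniformly_Cauchy_on_def
    proof safe
      fix e :: real assume e: "e > 0"
      then have "e\<^sup>2 * c / 4 > 0" using \<rho> by simp
      then obtain N where N: "\<And>k l. k \<ge> N \<Longrightarrow> l \<ge> N \<Longrightarrow> bergman_energy (\<lambda>z. h k z - h l z) \<le> ennreal (e\<^sup>2 * c / 4)"
        using cauchy by meson
      have "dist (h k z) (h l z) < e" if z: "z \<in> K" and kl: "k \<ge> N" "l \<ge> N" for z k l
      proof -
        have "ennreal ((cmod (h k z - h l z))\<^sup>2 * c) \<le> 2 * bergman_energy (\<lambda>z. h k z - h l z)"
          unfolding c_def by (rule bergman_pointwise_bound[OF hd \<rho>(1)]) (use d z in \<open>auto simp: \<rho>_def\<close>)
        also have "\<dots> \<le> 2 * ennreal (e\<^sup>2 * c / 4)" by (intro mult_left_mono N kl) auto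
        also have "\<dots> = ennreal (e\<^sup>2 * c / 2)" by (subst ennreal_numeral[symmetric], subst ennreal_mult'[symmetric]) (auto simp: mult.commute)
        finally have "(cmod (h k z - h l z))\<^sup>2 * c \<le> e\<^sup>2 * c / 2" using \<rho> by (simp add: ennreal_le_iff)
        then have "(cmod (h k z - h l z))\<^sup>2 \<le> e\<^sup>2 / 2" using \<rho>(2) by (simp add: field_simps)
        also have "\<dots> < e\<^sup>2" using e by simp
        finally show ?thesis using e by (simp add: dist_norm power_less_imp_less_base[of _ 2])
      qed
      then show "\<exists>M. \<forall>x\<in>K. \<forall>m\<ge>M. \<forall>n\<ge>M. dist (h m x) (h n x) < e" by blast
    qed
  qed
  define H where "H = (\<lambda>z. lim (\<lambda>k. h k z))"
  have ul: "uniform_limit K h H sequentially" if "compact K" "K \<subseteq> D" for K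
  proof -
    have "uniformly_convergent_on K h" using uc[OF that] by (rule Cauchy_uniformly_convergent)
    then show ?thesis unfolding H_def by (simp add: uniformly_convergent_uniform_limit_iff)
  qed
  have "H holomorphic_on D"
  proof (rule holomorphic_uniform_sequence[OF open_D h])
    fix z assume "z \<in> D"
    then obtain d where "d > 0" "cball z d \<subseteq> D" using open_D open_contains_cball by blast
    then show "\<exists>d>0. cball z d \<subseteq> D \<and> uniform_limit (cball z d) h H sequentially"
      using ul[OF compact_cball[of z d]] by blast
  qed
  have lim: "(\<lambda>k. h k z) \<longlonglongrightarrow> H z" if "z \<in> D" for z
    by (rule tendsto_uniform_limitI[OF ul[of "{z}"]]) (use that in auto)
  obtain N where N: "\<And>k. k \<ge> N \<Longrightarrow> bergman_energy (\<lambda>z. h k z - h N z) \<le> ennreal 1" 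
    using cauchy[OF zero_less_one] by blast
  define B where "B = 2 * ennreal 1 + 2 * bergman_energy (h N)"
  have B: "bergman_energy (h k) \<le> B" if "k \<ge> N" for k
  proof -
    have "bergman_energy (h k) \<le> 2 * bergman_energy (\<lambda>z. h k z - h N z) + 2 * bergman_energy (h N)"
      by (intro bergman_energy_diff_le holomorphic_on_imp_continuous_on h)
    also have "\<dots> \<le> B" unfolding B_def by (intro add_mono mult_left_mono N that order_refl) simp
    finally show ?thesis .
  qed
  have meas: "(\<lambda>z. indicator D z * ennreal ((cmod (h k z))\<^sup>2)) \<in> borel_measurable borel" for k
    by (intro borel_measurable_indicator_D holomorphic_on_imp_continuous_on h)
  have "bergman_energy H = (\<integral>\<^sup>+z. liminf (\<lambda>k. indicator D z * ennreal ((cmod (h k z))\<^sup>2)) \<partial>lborel)"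
    unfolding bergman_energy_def
  proof (rule nn_integral_cong)
    fix z
    show "indicator D z * ennreal ((cmod (H z))\<^sup>2) = liminf (\<lambda>k. indicator D z * ennreal ((cmod (h k z))\<^sup>2))"
    proof (cases "z \<in> D")
      case True
      have "(\<lambda>k. ennreal ((cmod (h k z))\<^sup>2)) \<longlonglongrightarrow> ennreal ((cmod (H z))\<^sup>2)"
        by (intro tendsto_ennrealI tendsto_intros lim True)
      from lim_imp_Liminf[OF trivial_limit_sequentially this] show ?thesis using True by simp
    qed (simp add: Liminf_const)
  qed
  also have "\<dots> \<le> liminf (\<lambda>k. bergman_energy (h k))"
    unfolding bergman_energy_def by (rule nn_integral_liminf) (use meas in simp)
  also have "\<dots> \<le> B"
    by (rule Liminf_le) (use B in \<open>auto intro!: eventually_sequentiallyI[of N]\<close>)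
  also have "B < \<infinity>" using fin[of N] by (simp add: B_def ennreal_mult_less_top)
  finally have fin: "bergman_energy H < \<infinity>" .
  have "integrable (lebesgue_on D) (\<lambda>z. (cmod (H z))\<^sup>2)"
  proof (rule integrableI_bounded)
    have "continuous_on D (\<lambda>z. (cmod (H z))\<^sup>2)"
      by (intro continuous_intros holomorphic_on_imp_continuous_on \<open>H holomorphic_on D\<close>)
    then show "(\<lambda>z. (cmod (H z))\<^sup>2) \<in> borel_measurable (lebesgue_on D)"
      using open_D by (intro continuous_imp_measurable_on_sets_lebesgue) auto
    have "(\<integral>\<^sup>+z. ennreal (norm ((cmod (H z))\<^sup>2)) \<partial>lebesgue_on D) = (\<integral>\<^sup>+z. ennreal ((cmod (H z))\<^sup>2) * indicator D z \<partial>lebesgue)"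
      using open_D by (subst nn_integral_restrict_space) auto
    also have "\<dots> = bergman_energy H" by (simp add: nn_integral_completion bergman_energy_def mult.commute)
    finally show "(\<integral>\<^sup>+z. ennreal (norm ((cmod (H z))\<^sup>2)) \<partial>lebesgue_on D) < \<infinity>" using fin by simp
  qed
  then have "H \<in> bergman_space D" using \<open>H holomorphic_on D\<close> by (simp add: bergman_space_def)
  then show ?thesis using that ul by blast
qed

text \<open>
  \<open>x\<close> is at distance \<open>min x (pi - x) / sqrt 2\<close> from the boundary of \<open>D\<close>.
\<close>
lemma bergman_axis_bound:
  assumes h: "h holomorphic_on D" and x: "0 < x" "x < pi" and E: "bergman_energy h \<le> ennreal E" "E \<ge> 0"
  shows "cmod (h (of_real x)) \<le> 7 * sqrt E / min x (pi - x)"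
proof -
  define d where "d = min x (pi - x)"
  have d: "d > 0" using x by (simp add: d_def)
  \<comment> \<open>In the disc of radius \<open>d / 2\<close> both coordinates deviate by less than
    \<open>d / 2\<close>, so their sum stays below \<open>d\<close>; the pointwise bound is then
    used with radius \<open>d / 4\<close>.\<close>
  have sub: "ball (complex_of_real x) (2 * (d / 4)) \<subseteq> D"
  proof
    fix w assume w: "w \<in> ball (complex_of_real x) (2 * (d / 4))"
    then have "cmod (w - of_real x) < d / 2" by (simp add: dist_norm norm_minus_commute)
    moreover have "\<bar>Re (w - of_real x)\<bar> \<le> cmod (w - of_real x)" "\<bar>Im (w - of_real x)\<bar> \<le> cmod (w - of_real x)"
      by (rule abs_Re_le_cmod abs_Im_le_cmod)+
    ultimately have "\<bar>Re w - x\<bar> + \<bar>Im w\<bar> < d" by simp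
    then show "w \<in> D" using x by (auto simp: D_def d_def min_def abs_if split: if_splits)
  qed
  have "ennreal ((cmod (h (of_real x)))\<^sup>2 * (pi * (d / 4)\<^sup>2 / 4)) \<le> 2 * bergman_energy h"
    by (rule bergman_pointwise_bound[OF h _ sub]) (use d in simp)
  also have "\<dots> \<le> 2 * ennreal E" by (intro mult_left_mono E) auto
  also have "\<dots> = ennreal (2 * E)" by (subst ennreal_numeral[symmetric], subst ennreal_mult'[symmetric]) auto
  finally have "(cmod (h (of_real x)))\<^sup>2 * (pi * (d / 4)\<^sup>2 / 4) \<le> 2 * E" using E(2) by (simp add: ennreal_le_iff)
  \<comment> \<open>The constant 7 comes from here: \<open>128 / pi < 128 / 3 < 49\<close>.\<close>
  then have "pi * (cmod (h (of_real x)) * d)\<^sup>2 \<le> 128 * E" by (simp add: power_mult_distrib power_divide field_simps)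
  moreover have "3 * (cmod (h (of_real x)) * d)\<^sup>2 \<le> pi * (cmod (h (of_real x)) * d)\<^sup>2"
    using pi_gt3 by (intro mult_right_mono) auto
  ultimately have "(cmod (h (of_real x)) * d)\<^sup>2 \<le> (7 * sqrt E)\<^sup>2" using E(2) by (simp add: power_mult_distrib)
  then have "cmod (h (of_real x)) * d \<le> 7 * sqrt E" by (rule power2_le_imp_le) (use E in simp)
  then show ?thesis using d by (simp add: d_def[symmetric] field_simps)
qed

subsection \<open>Exponential moments and exponential approximation\<close>

lemma exp_Suc_tendsto_zero:
  fixes r :: real
  assumes "r < 0"
  shows "(\<lambda>N. exp (real (Suc N) * r)) \<longlonglongrightarrow> 0"
  unfolding exp_of_nat_mult by (rule LIMSEQ_Suc[OF LIMSEQ_realpow_zero]) (use assms in auto)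

lemma exp_neg_exp_Suc_tendsto_zero:
  fixes r :: real
  assumes "r > 0"
  shows "(\<lambda>N. exp (- exp (real (Suc N) * r))) \<longlonglongrightarrow> 0"
proof (rule Lim_null_comparison)
  show "\<forall>\<^sub>F N in sequentially. norm (exp (- exp (real (Suc N) * r))) \<le> exp (real (Suc N) * (- r))"
  proof (intro always_eventually allI)
    fix N
    have "real (Suc N) * r \<le> exp (real (Suc N) * r)" using exp_ge_add_one_self[of "real (Suc N) * r"] by linarith
    then show "norm (exp (- exp (real (Suc N) * r))) \<le> exp (real (Suc N) * (- r))" by simp
  qed
qed (rule exp_Suc_tendsto_zero, use assms in simp)

text \<open>\<open>1 - exp (- exp (N * (s - \<sigma>)))\<close> is a smoothed step at
  \<open>\<sigma>\<close> and also a series in the exponentials \<open>exp (N * k * s)\<close> with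
  \<open>k \<ge> 1\<close>. Bounded moments make its pairing with the function small as
  \<open>N\<close> grows, so the integral over every final segment of reversed time vanishes. It is
  essential that \<open>C\<close> does not depend on \<open>n\<close>.\<close>

lemma continuous_zero_of_exp_moments:
  fixes f :: "real \<Rightarrow> complex"
  assumes \<tau>: "\<tau> > 0" and f: "continuous_on {0..\<tau>} f"
    and bound: "\<And>n. n \<ge> 1 \<Longrightarrow> cmod (integral {0..\<tau>} (\<lambda>t. of_real (exp (real n * (\<tau> - t))) * f t)) \<le> C"
  shows "f \<tau> = 0"
proof -
  \<comment> \<open>Time reversal turns the weights into \<open>exp (n * s)\<close> and the final
    value of \<open>f\<close> into the value of \<open>g\<close> at \<open>0\<close>.\<close>
  define g where "g = (\<lambda>s. f (\<tau> - s))"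
  have cg: "continuous_on {0..\<tau>} g" unfolding g_def by (intro continuous_on_compose2[OF f] continuous_intros) auto
  have mom: "cmod (integral {0..\<tau>} (\<lambda>s. of_real (exp (real n * s)) * g s)) \<le> C" if "n \<ge> 1" for n
  proof -
    let ?k = "\<lambda>t. of_real (exp (real n * (\<tau> - t))) * f t"
    have "(?k has_integral integral {0..\<tau>} ?k) {0..\<tau>}"
      by (intro integrable_integral integrable_continuous_real continuous_intros f)
    then have "((\<lambda>x. ?k (- x + \<tau>)) has_integral integral {0..\<tau>} ?k) {0..\<tau>}"
      using has_integral_affinity[of ?k "integral {0..\<tau>} ?k" 0 \<tau> "-1" \<tau>] by (simp add: add.commute)
    then have "integral {0..\<tau>} (\<lambda>s. of_real (exp (real n * s)) * g s) = integral {0..\<tau>} ?k"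
      by (intro integral_unique) (simp add: g_def)
    then show ?thesis using bound[OF that] by simp
  qed
  have C0: "C \<ge> 0" using order_trans[OF norm_ge_zero mom[of 1]] by simp
  \<comment> \<open>The coefficients are \<open>E ^ k / fact k\<close> in modulus with
    \<open>E = exp (- N * \<sigma>)\<close>, so the moment bounds sum to
    \<open>C * (exp E - 1)\<close>.\<close>
  have series: "cmod (integral {0..\<tau>} (\<lambda>s. of_real (1 - exp (- exp (real N * (s - \<sigma>)))) * g s)) \<le> C * (exp (exp (- real N * \<sigma>)) - 1)"
    if N: "N \<ge> 1" for N \<sigma>
  proof -
    define y where "y = (\<lambda>s. exp (real N * (s - \<sigma>)))"
    have cy: "continuous_on A y" for A unfolding y_def by (intro continuous_intros)
    define S where "S = (\<lambda>M s. \<Sum>k<M. - ((- y s) ^ Suc k / fact (Suc k)))"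
    have expy: "(\<lambda>k. z ^ k / fact k) sums exp z" for z :: real
      using exp_converges[of z] by (simp add: divide_inverse mult.commute)
    have expS: "(\<lambda>k. z ^ Suc k / fact (Suc k)) sums (exp z - 1)" for z :: real
      using expy[of z] sums_Suc_iff[of "\<lambda>k. z ^ k / fact k" "exp z - 1"] by simp
    have lim: "(\<lambda>M. S M s) \<longlonglongrightarrow> 1 - exp (- y s)" for s
      using sums_minus[OF expS[of "- y s"]] unfolding S_def sums_def by simp
    have dom: "\<bar>S M s\<bar> \<le> exp (y s) - 1" for M s
    proof -
      have "\<bar>S M s\<bar> \<le> (\<Sum>k<M. y s ^ Suc k / fact (Suc k))" unfolding S_def
        by (rule order_trans[OF sum_abs]) (simp add: abs_mult power_abs y_def)
      also have "\<dots> \<le> exp (y s) - 1"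
        using sum_le_suminf[OF sums_summable[OF expS[of "y s"]], of "{..<M}"] sums_unique[OF expS[of "y s"]]
        by (simp add: y_def)
      finally show ?thesis .
    qed
    have cS: "continuous_on A (\<lambda>s. S M s)" for A M unfolding S_def by (intro continuous_intros cy) auto
    have conv: "(\<lambda>M. integral {0..\<tau>} (\<lambda>s. of_real (S M s) * g s)) \<longlonglongrightarrow> integral {0..\<tau>} (\<lambda>s. of_real (1 - exp (- y s)) * g s)"
    proof (rule dominated_convergence(2)[where h = "\<lambda>s. (exp (y s) - 1) * cmod (g s)"])
      show "(\<lambda>s. of_real (S M s) * g s) integrable_on {0..\<tau>}" for M
        by (intro integrable_continuous_real continuous_intros cS cg)
      show "(\<lambda>s. (exp (y s) - 1) * cmod (g s)) integrable_on {0..\<tau>}"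
        by (intro integrable_continuous_real continuous_intros cy cg)
      show "norm (of_real (S M s) * g s) \<le> (exp (y s) - 1) * cmod (g s)" for M s
        using dom[of M s] by (simp add: norm_mult mult_right_mono)
      show "(\<lambda>M. of_real (S M s) * g s) \<longlonglongrightarrow> of_real (1 - exp (- y s)) * g s" for s
        by (intro tendsto_intros lim)
    qed
    have each: "cmod (integral {0..\<tau>} (\<lambda>s. of_real (S M s) * g s)) \<le> C * (exp (exp (- real N * \<sigma>)) - 1)" for M
    proof -
      define E where "E = exp (- real N * \<sigma>)"
      have "(\<lambda>s. of_real (S M s) * g s) = (\<lambda>s. \<Sum>k<M. of_real (- ((- E) ^ Suc k / fact (Suc k))) * (of_real (exp (real (N * Suc k) * s)) * g s))"
      proof
        fix s
        have "y s ^ Suc k = E ^ Suc k * exp (real (N * Suc k) * s)" for k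
          by (simp add: y_def E_def exp_of_nat_mult[symmetric] exp_add[symmetric] del: power_Suc of_nat_Suc)
             (simp add: algebra_simps)
        then have "S M s = (\<Sum>k<M. - ((- E) ^ Suc k / fact (Suc k)) * exp (real (N * Suc k) * s))"
          unfolding S_def by (intro sum.cong refl) (simp add: power_minus[of "y s"] power_minus[of E] del: power_Suc fact_Suc)
        then show "of_real (S M s) * g s = (\<Sum>k<M. of_real (- ((- E) ^ Suc k / fact (Suc k))) * (of_real (exp (real (N * Suc k) * s)) * g s))"
          by (simp only: of_real_sum of_real_mult sum_distrib_right mult.assoc)
      qed
      then have "integral {0..\<tau>} (\<lambda>s. of_real (S M s) * g s) =
         (\<Sum>k<M. of_real (- ((- E) ^ Suc k / fact (Suc k))) * integral {0..\<tau>} (\<lambda>s. of_real (exp (real (N * Suc k) * s)) * g s))"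
        by (simp only:) (subst integral_sum; (intro integrable_continuous_real continuous_intros cg sum.cong refl Henstock_Kurzweil_Integration.integral_mult_right)?; simp?)
      also have "cmod \<dots> \<le> (\<Sum>k<M. E ^ Suc k / fact (Suc k) * C)"
      proof (rule sum_norm_le)
        fix k
        have "1 \<le> N * Suc k" using N by simp
        then have le: "cmod (integral {0..\<tau>} (\<lambda>s. of_real (exp (real (N * Suc k) * s)) * g s)) \<le> C" by (rule mom)
        have eq: "cmod (of_real (- ((- E) ^ Suc k / fact (Suc k)))) = E ^ Suc k / fact (Suc k)"
          unfolding norm_of_real by (simp add: power_abs abs_mult E_def del: power_Suc fact_Suc)
        show "cmod (of_real (- ((- E) ^ Suc k / fact (Suc k))) * integral {0..\<tau>} (\<lambda>s. of_real (exp (real (N * Suc k) * s)) * g s)) \<le> E ^ Suc k / fact (Suc k) * C"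
          unfolding norm_mult eq by (rule mult_left_mono[OF le]) (simp add: E_def del: power_Suc fact_Suc)
      qed
      also have "\<dots> = (\<Sum>k<M. E ^ Suc k / fact (Suc k)) * C" by (simp only: sum_distrib_right)
      also have "\<dots> \<le> (exp E - 1) * C"
        using sum_le_suminf[OF sums_summable[OF expS[of E]], of "{..<M}"] sums_unique[OF expS[of E]] C0
        by (intro mult_right_mono) (auto simp: E_def)
      finally show ?thesis by (simp add: E_def mult.commute)
    qed
    show ?thesis
      using LIMSEQ_le_const2[OF tendsto_norm[OF conv]] each unfolding y_def by blast
  qed
  have zero: "integral {\<sigma>..\<tau>} g = 0" if \<sigma>: "0 < \<sigma>" "\<sigma> \<le> \<tau>" for \<sigma>
  proof -
    \<comment> \<open>The pointwise limit of the smoothed steps; at the jump they all equal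
      \<open>1 - exp (-1)\<close>, a single point that does not affect the integral.\<close>
    define L where "L = (\<lambda>s. if s < \<sigma> then 0 else if s = \<sigma> then of_real (1 - exp (-1)) * g s else g s)"
    let ?q = "\<lambda>N s. of_real (1 - exp (- exp (real (Suc N) * (s - \<sigma>)))) * g s"
    have "(\<lambda>N. integral {0..\<tau>} (?q N)) \<longlonglongrightarrow> integral {0..\<tau>} L"
    proof (rule dominated_convergence(2)[where h = "\<lambda>s. cmod (g s)"])
      show "?q N integrable_on {0..\<tau>}" for N by (intro integrable_continuous_real continuous_intros cg)
      show "(\<lambda>s. cmod (g s)) integrable_on {0..\<tau>}" by (intro integrable_continuous_real continuous_intros cg)
      show "norm (?q N s) \<le> cmod (g s)" for N s
        unfolding norm_mult norm_of_real by (intro mult_left_le_one_le) auto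
      show "(\<lambda>N. ?q N s) \<longlonglongrightarrow> L s" for s
      proof -
        consider "s < \<sigma>" | "s = \<sigma>" | "s > \<sigma>" by linarith
        then show ?thesis
        proof cases
          case 1
          have "(\<lambda>N. 1 - exp (- exp (real (Suc N) * (s - \<sigma>)))) \<longlonglongrightarrow> 0"
            using tendsto_diff[OF tendsto_const[of 1] tendsto_exp[OF tendsto_minus[OF exp_Suc_tendsto_zero[of "s - \<sigma>"]]]] 1 by simp
          from tendsto_mult[OF tendsto_of_real[OF this] tendsto_const[of "g s"]] show ?thesis using 1 by (simp add: L_def)
        next
          case 3
          have "(\<lambda>N. 1 - exp (- exp (real (Suc N) * (s - \<sigma>)))) \<longlonglongrightarrow> 1"
            using tendsto_diff[OF tendsto_const[of 1] exp_neg_exp_Suc_tendsto_zero[of "s - \<sigma>"]] 3 by simp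
          from tendsto_mult[OF tendsto_of_real[OF this] tendsto_const[of "g s"]] show ?thesis using 3 by (simp add: L_def)
        qed (simp add: L_def)
      qed
    qed
    moreover have "(\<lambda>N. integral {0..\<tau>} (?q N)) \<longlonglongrightarrow> 0"
    proof (rule Lim_null_comparison)
      show "\<forall>\<^sub>F N in sequentially. norm (integral {0..\<tau>} (?q N)) \<le> C * (exp (exp (- real (Suc N) * \<sigma>)) - 1)"
        by (intro always_eventually allI series) simp
      have "(\<lambda>N. exp (exp (- real (Suc N) * \<sigma>)) - 1) \<longlonglongrightarrow> 0"
        using tendsto_diff[OF tendsto_exp[OF exp_Suc_tendsto_zero[of "- \<sigma>"]] tendsto_const[of 1]] \<sigma>
        by (simp add: mult_minus_left mult_minus_right del: of_nat_Suc)
      from tendsto_mult_right[OF this, of C] show "(\<lambda>N. C * (exp (exp (- real (Suc N) * \<sigma>)) - 1)) \<longlonglongrightarrow> 0"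
        by (simp add: mult.commute)
    qed
    ultimately have L0: "integral {0..\<tau>} L = 0" by (rule LIMSEQ_unique)
    have cg': "continuous_on {\<sigma>..\<tau>} g" using cg by (rule continuous_on_subset) (use \<sigma> in auto)
    have "(L has_integral 0) {0..\<sigma>}"
      by (rule has_integral_spike_finite[where S = "{\<sigma>}" and f = "\<lambda>s. 0"]) (auto simp: L_def)
    moreover have "(L has_integral integral {\<sigma>..\<tau>} g) {\<sigma>..\<tau>}"
      by (rule has_integral_spike_finite[where S = "{\<sigma>}" and f = g])
         (auto simp: L_def intro!: integrable_integral integrable_continuous_real cg')
    ultimately have "(L has_integral (0 + integral {\<sigma>..\<tau>} g)) {0..\<tau>}"
      using \<sigma> by (intro has_integral_combine[of 0 \<sigma> \<tau>]) auto
    then show ?thesis using L0 by (simp add: has_integral_iff)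
  qed
  have "g s = 0" if s: "s \<in> {0<..<\<tau>}" for s
  proof -
    have cs: "continuous_on {s..\<tau>} g" using cg by (rule continuous_on_subset) (use s in auto)
    have z: "integral {s..x} g = 0" if x: "x \<in> {s..\<tau>}" for x
    proof -
      have "integral {s..x} g + integral {x..\<tau>} g = integral {s..\<tau>} g"
        using x by (intro Henstock_Kurzweil_Integration.integral_combine integrable_continuous_real cs) auto
      then show ?thesis using zero[of s] zero[of x] s x by auto
    qed
    have dv: "((\<lambda>x. integral {s..x} g) has_vector_derivative g s) (at s within {s..\<tau>})"
      by (rule integral_has_vector_derivative[OF cs]) (use s in auto)
    have "((\<lambda>x. 0) has_vector_derivative g s) (at s within {s..\<tau>})"
      by (rule has_vector_derivative_transform[OF _ _ dv]) (use s z in auto)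
    moreover have "((\<lambda>x. 0) has_vector_derivative 0) (at s within {s..\<tau>})" by simp
    ultimately show "g s = 0"
      using s vector_derivative_unique_within_closed_interval[of s \<tau> s "\<lambda>x. 0" "g s" 0] by auto
  qed
  then have "g 0 = 0"
    using \<tau> by (intro continuous_constant_on_closure[of "{0<..<\<tau>}" g 0 0]) (auto simp: cg)
  then show ?thesis by (simp add: g_def)
qed

section \<open>Approximation of controls by exponential polynomials\<close>

text \<open>For \<open>M > 0\<close> this is the radial projection onto the closed disc of radius
  \<open>M\<close>, in a form whose continuity needs no gluing.\<close>

definition clip :: "real \<Rightarrow> complex \<Rightarrow> complex" where
  "clip M z = z / of_real (max 1 (cmod z / M))"

lemma norm_clip:
  assumes "M > 0"
  shows "cmod (clip M z) \<le> M" "cmod (clip M z) \<le> cmod z" "cmod (z - clip M z) \<le> cmod z"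
proof -
  define m where "m = max 1 (cmod z / M)"
  have m: "m \<ge> 1" "cmod z / M \<le> m" by (auto simp: m_def)
  have n: "cmod (clip M z) = cmod z / m" using m by (simp add: clip_def m_def[symmetric] norm_divide)
  have "cmod z \<le> m * M" using m(2) assms by (simp add: pos_divide_le_eq)
  then show "cmod (clip M z) \<le> M" unfolding n using m by (simp add: pos_divide_le_eq mult.commute)
  show "cmod (clip M z) \<le> cmod z" unfolding n using m by (simp add: divide_le_eq mult_le_cancel_left1)
  have "z - clip M z = of_real (1 - 1 / m) * z" using m by (simp add: clip_def m_def[symmetric] field_simps)
  then have "cmod (z - clip M z) = (1 - 1 / m) * cmod z" using m by (simp add: norm_mult del: of_real_diff of_real_divide)
  then show "cmod (z - clip M z) \<le> cmod z" using m by (simp add: mult_left_le_one_le)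
qed

lemma continuous_on_clip: "M > 0 \<Longrightarrow> continuous_on A (clip M)"
  unfolding clip_def by (intro continuous_intros) (auto simp: max_def)

lemma clip_tendsto: "(\<lambda>n. clip (real (Suc n)) z) \<longlonglongrightarrow> z"
proof (rule tendsto_eventually)
  obtain N where "cmod z \<le> real N" using real_arch_simple by blast
  have "clip (real (Suc n)) z = z" if "n \<ge> N" for n
  proof -
    have "cmod z \<le> real (Suc n)" using \<open>cmod z \<le> real N\<close> that by linarith
    then have "max 1 (cmod z / real (Suc n)) = 1" by (intro max_absorb1) (simp add: divide_le_eq)
    then show ?thesis by (simp add: clip_def)
  qed
  then show "\<forall>\<^sub>F n in sequentially. clip (real (Suc n)) z = z" unfolding eventually_sequentially by blast
qed

text \<open>Truncation makes dominated convergence available; continuous functions converging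
  pointwise off a null set then approximate the truncated control. The value \<open>0\<close> at
  time \<open>0\<close> lets the approximant be continued by zero to negative times.\<close>

lemma L2_approx_continuous:
  fixes u :: "real \<Rightarrow> complex"
  assumes u: "u \<in> borel_measurable (lebesgue_on {0<..<\<tau>})" "integrable (lebesgue_on {0<..<\<tau>}) (\<lambda>s. (cmod (u s))\<^sup>2)"
    and e: "e > 0"
  obtains v where "continuous_on UNIV v" "v 0 = 0" "(LINT s|lebesgue_on {0<..<\<tau>}. (cmod (u s - v s))\<^sup>2) < e"
    "integrable (lebesgue_on {0<..<\<tau>}) (\<lambda>s. (cmod (u s - v s))\<^sup>2)"
proof -
  let ?M = "lebesgue_on {0<..<\<tau>}"
  note [measurable] = u(1)
  have cm: "f \<in> borel_measurable ?M" if "continuous_on UNIV f" for f :: "real \<Rightarrow> complex"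
    by (rule continuous_imp_measurable_on_sets_lebesgue[OF continuous_on_subset[OF that subset_UNIV]]) simp
  have [measurable]: "(\<lambda>s. clip M (u s)) \<in> borel_measurable ?M" if "M > 0" for M
    using borel_measurable_continuous_onI[OF continuous_on_clip[OF that, of UNIV]] u(1) by (rule measurable_compose[rotated])
  have lim1: "(\<lambda>n. LINT s|?M. (cmod (u s - clip (real (Suc n)) (u s)))\<^sup>2) \<longlonglongrightarrow> (LINT s|?M. 0)"
  proof (rule integral_dominated_convergence[where w = "\<lambda>s. (cmod (u s))\<^sup>2"])
    show "AE s in ?M. (\<lambda>n. (cmod (u s - clip (real (Suc n)) (u s)))\<^sup>2) \<longlonglongrightarrow> 0"
    proof (rule AE_I2)
      fix s
      have "(\<lambda>n. (cmod (u s - clip (real (Suc n)) (u s)))\<^sup>2) \<longlonglongrightarrow> (cmod (u s - u s))\<^sup>2"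
        by (intro tendsto_intros clip_tendsto)
      then show "(\<lambda>n. (cmod (u s - clip (real (Suc n)) (u s)))\<^sup>2) \<longlonglongrightarrow> 0" by simp
    qed
    show "AE s in ?M. norm ((cmod (u s - clip (real (Suc n)) (u s)))\<^sup>2) \<le> (cmod (u s))\<^sup>2" for n
      using norm_clip(3)[of "real (Suc n)"] by (intro AE_I2) (simp add: power_mono)
  qed (use u in \<open>auto intro!: borel_measurable_diff borel_measurable_power\<close>)
  then have "\<forall>\<^sub>F n in sequentially. (LINT s|?M. (cmod (u s - clip (real (Suc n)) (u s)))\<^sup>2) < e / 4"
    using e by (intro order_tendstoD(2)[where y = 0]) auto
  then obtain n where n: "(LINT s|?M. (cmod (u s - clip (real (Suc n)) (u s)))\<^sup>2) < e / 4"
    by (auto simp: eventually_sequentially)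
  define M where "M = real (Suc n)"
  have M: "M > 0" by (simp add: M_def)
  have i1: "integrable ?M (\<lambda>s. (cmod (u s - clip M (u s)))\<^sup>2)"
    by (rule Bochner_Integration.integrable_bound[OF u(2)])
       (use norm_clip(3)[OF M] M in \<open>auto intro!: AE_I2 power_mono\<close>)
  have "u measurable_on {0<..<\<tau>}" using u(1) by (simp add: measurable_on_iff_borel_measurable)
  then obtain N g where N: "negligible N" "\<And>k. continuous_on UNIV (g k)"
    "\<And>x. x \<notin> N \<Longrightarrow> (\<lambda>k. g k x) \<longlonglongrightarrow> (if x \<in> {0<..<\<tau>} then u x else 0)"
    unfolding measurable_on_def by metis
  \<comment> \<open>The first factor enforces the value \<open>0\<close> at \<open>0\<close> and
    tends to \<open>1\<close> at every positive time.\<close>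
  define v where "v = (\<lambda>k s. of_real (min 1 (real k * \<bar>s\<bar>)) * clip M (g k s))"
  have cv: "continuous_on UNIV (v k)" for k unfolding v_def
    by (intro continuous_intros continuous_on_compose2[OF continuous_on_clip[OF M, of UNIV] N(2)]) auto
  have nv: "cmod (v k s) \<le> M" for k s
  proof -
    have "cmod (v k s) \<le> 1 * M" unfolding v_def norm_mult by (intro mult_mono norm_clip(1) M) auto
    then show ?thesis by simp
  qed
  have nb: "(cmod (clip M (u s) - v k s))\<^sup>2 \<le> (2 * M)\<^sup>2" for s k
    using norm_triangle_ineq4[of "clip M (u s)" "v k s"] norm_clip(1)[OF M, of "u s"] nv[of k s] by (intro power_mono) auto
  have fin: "integrable ?M (\<lambda>s. (2 * M)\<^sup>2)" by (rule LINT_open_interval) auto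
  have "(\<lambda>k. LINT s|?M. (cmod (clip M (u s) - v k s))\<^sup>2) \<longlonglongrightarrow> (LINT s|?M. 0)"
  proof (rule integral_dominated_convergence[where w = "\<lambda>s. (2 * M)\<^sup>2", OF _ _ fin])
    have "N \<in> null_sets lebesgue" using N(1) by (simp add: negligible_iff_null_sets)
    from AE_not_in[OF this] have "AE s in ?M. s \<notin> N" by (subst AE_restrict_space_iff) (auto elim: eventually_mono)
    then show "AE s in ?M. (\<lambda>k. (cmod (clip M (u s) - v k s))\<^sup>2) \<longlonglongrightarrow> 0"
    proof (rule AE_mp, intro AE_I2 impI)
      fix s assume "s \<in> space ?M" and sN: "s \<notin> N"
      then have s: "s \<in> {0<..<\<tau>}" by simp
      have "isCont (clip M) (u s)" using continuous_on_clip[OF M, of UNIV] by (simp add: continuous_on_eq_continuous_at)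
      from isCont_tendsto_compose[OF this] have "(\<lambda>k. clip M (g k s)) \<longlonglongrightarrow> clip M (u s)" using N(3)[OF sN] s by simp
      moreover have "(\<lambda>k. min 1 (real k * \<bar>s\<bar>)) \<longlonglongrightarrow> 1"
      proof (rule tendsto_eventually)
        obtain K where K: "1 / \<bar>s\<bar> \<le> real K" using real_arch_simple by blast
        have "1 \<le> real k * \<bar>s\<bar>" if "k \<ge> K" for k
        proof -
          have "1 / \<bar>s\<bar> \<le> real k" using K that by (meson of_nat_mono order_trans)
          then show ?thesis using s by (simp add: divide_le_eq)
        qed
        then show "\<forall>\<^sub>F k in sequentially. min 1 (real k * \<bar>s\<bar>) = 1" by (auto simp: eventually_sequentially min_def intro!: exI[of _ K])
      qed
      ultimately have "(\<lambda>k. (cmod (clip M (u s) - v k s))\<^sup>2) \<longlonglongrightarrow> (cmod (clip M (u s) - of_real 1 * clip M (u s)))\<^sup>2"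
        unfolding v_def by (intro tendsto_intros)
      then show "(\<lambda>k. (cmod (clip M (u s) - v k s))\<^sup>2) \<longlonglongrightarrow> 0" by simp
    qed
    show "AE s in ?M. norm ((cmod (clip M (u s) - v k s))\<^sup>2) \<le> (2 * M)\<^sup>2" for k
      using nb by (intro AE_I2) simp
  qed (use M cm[OF cv] in \<open>auto intro!: borel_measurable_diff borel_measurable_power\<close>)
  then have "\<forall>\<^sub>F k in sequentially. (LINT s|?M. (cmod (clip M (u s) - v k s))\<^sup>2) < e / 4"
    using e by (intro order_tendstoD(2)[where y = 0]) auto
  then obtain k where k: "(LINT s|?M. (cmod (clip M (u s) - v k s))\<^sup>2) < e / 4"
    by (auto simp: eventually_sequentially)
  have i2: "integrable ?M (\<lambda>s. (cmod (clip M (u s) - v k s))\<^sup>2)"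
    by (rule Bochner_Integration.integrable_bound[OF fin])
       (use M cm[OF cv] nb in \<open>auto intro!: AE_I2 borel_measurable_diff borel_measurable_power\<close>)
  have le: "(cmod (u s - v k s))\<^sup>2 \<le> 2 * (cmod (u s - clip M (u s)))\<^sup>2 + 2 * (cmod (clip M (u s) - v k s))\<^sup>2" for s
    by (rule norm_diff_power2_le)
  have i3: "integrable ?M (\<lambda>s. 2 * (cmod (u s - clip M (u s)))\<^sup>2 + 2 * (cmod (clip M (u s) - v k s))\<^sup>2)"
    using i1 i2 by auto
  have i4: "integrable ?M (\<lambda>s. (cmod (u s - v k s))\<^sup>2)"
    by (rule Bochner_Integration.integrable_bound[OF i3])
       (use cm[OF cv] le in \<open>auto intro!: AE_I2 borel_measurable_diff borel_measurable_power\<close>)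
  have "(LINT s|?M. (cmod (u s - v k s))\<^sup>2) \<le> (LINT s|?M. 2 * (cmod (u s - clip M (u s)))\<^sup>2 + 2 * (cmod (clip M (u s) - v k s))\<^sup>2)"
    by (rule integral_mono[OF i4 i3]) (rule le)
  also have "\<dots> = 2 * (LINT s|?M. (cmod (u s - clip M (u s)))\<^sup>2) + 2 * (LINT s|?M. (cmod (clip M (u s) - v k s))\<^sup>2)"
    using i1 i2 by simp
  also have "\<dots> < e" using n k by (simp add: M_def)
  finally show ?thesis using that[OF cv _ _ i4] by (simp add: v_def)
qed

text \<open>With \<open>x = exp s\<close> the whole past becomes \<open>(0, 1]\<close>, whose
  closure is compact. One uniform approximation on \<open>{0..exp \<tau>}\<close> then handles past
  and control interval at once, and the prefactor \<open>exp s\<close> excludes a constant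
  mode.\<close>

lemma L2_approx_exponential_poly:
  fixes u :: "real \<Rightarrow> complex"
  assumes u: "u \<in> borel_measurable (lebesgue_on {0<..<\<tau>})" "integrable (lebesgue_on {0<..<\<tau>}) (\<lambda>s. (cmod (u s))\<^sup>2)"
    and e: "e > 0" and \<tau>: "\<tau> > 0"
  obtains p :: "complex poly" where
    "\<And>s. s \<le> 0 \<Longrightarrow> cmod (of_real (exp s) * poly p (of_real (exp s))) \<le> e * exp s"
    "(LINT s|lebesgue_on {0<..<\<tau>}. (cmod (u s - of_real (exp s) * poly p (of_real (exp s))))\<^sup>2) \<le> e"
    "integrable (lebesgue_on {0<..<\<tau>}) (\<lambda>s. (cmod (u s - of_real (exp s) * poly p (of_real (exp s))))\<^sup>2)"
proof -
  let ?M = "lebesgue_on {0<..<\<tau>}"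
  obtain v where v: "continuous_on UNIV v" "v 0 = 0" "(LINT s|?M. (cmod (u s - v s))\<^sup>2) < e / 4"
    "integrable ?M (\<lambda>s. (cmod (u s - v s))\<^sup>2)"
    using L2_approx_continuous[OF u, of "e / 4"] e by auto
  \<comment> \<open>The first bound serves the past; the second makes the squared error at most
    \<open>e / (4 * \<tau>)\<close> on the control interval even after multiplication by
    \<open>exp s\<close>.\<close>
  define \<delta> where "\<delta> = min e (sqrt (e / (4 * \<tau>)) / exp \<tau>)"
  have \<delta>: "\<delta> > 0" "\<delta> \<le> e" "\<delta> * exp \<tau> \<le> sqrt (e / (4 * \<tau>))"
    using e \<tau> by (auto simp: \<delta>_def min_def field_simps not_le less_imp_le)
  \<comment> \<open>The target after removal of the prefactor: zero for the past, continuous at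
    \<open>x = 1\<close> because \<open>v 0 = 0\<close>.\<close>
  define V where "V = (\<lambda>x. if x \<le> 1 then 0 else v (ln x) / of_real x)"
  have "continuous_on ({0..1} \<union> {1..exp \<tau>}) V" unfolding V_def
    by (rule continuous_on_cases_le)
       (auto intro!: continuous_intros continuous_on_compose2[OF v(1)] simp: v(2))
  moreover have "{0..1} \<union> {1..exp \<tau>} = {0..exp \<tau>}"
  proof -
    define E where "E = exp \<tau>"
    have "1 \<le> E" using \<tau> by (simp add: E_def)
    then show ?thesis unfolding E_def[symmetric] by auto
  qed
  ultimately have "continuous_on {0..exp \<tau>} V" by simp
  then obtain p where p: "\<And>x. x \<in> {0..exp \<tau>} \<Longrightarrow> cmod (V x - poly p (of_real x)) < \<delta>"
    using Weierstrass_complex_poly[OF _ \<delta>(1)] by blast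
  define U where "U = (\<lambda>s. of_real (exp s) * poly p (complex_of_real (exp s)))"
  have cU: "continuous_on A U" for A unfolding U_def by (intro continuous_intros)
  have neg: "cmod (U s) \<le> e * exp s" if s: "s \<le> 0" for s
  proof -
    have "exp s \<le> 1" "exp s \<le> exp \<tau>" using s \<tau> by auto
    then have "cmod (poly p (of_real (exp s))) \<le> e" using p[of "exp s"] \<delta>(2) by (simp add: V_def)
    then show ?thesis by (simp add: U_def norm_mult mult.commute mult_right_mono)
  qed
  have pos: "(cmod (v s - U s))\<^sup>2 \<le> e / (4 * \<tau>)" if s: "s \<in> {0<..<\<tau>}" for s
  proof -
    have x: "exp s \<in> {0..exp \<tau>}" "\<not> exp s \<le> 1" using s by auto
    have "v s - U s = of_real (exp s) * (V (exp s) - poly p (of_real (exp s)))"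
      using x by (simp add: V_def U_def right_diff_distrib)
    then have "cmod (v s - U s) = exp s * cmod (V (exp s) - poly p (of_real (exp s)))" by (simp add: norm_mult)
    also have "\<dots> \<le> exp \<tau> * \<delta>" using p[OF x(1)] x(1) by (intro mult_mono) auto
    also have "\<dots> \<le> sqrt (e / (4 * \<tau>))" using \<delta>(3) by (simp add: mult.commute)
    finally have "(cmod (v s - U s))\<^sup>2 \<le> (sqrt (e / (4 * \<tau>)))\<^sup>2" by (intro power_mono) auto
    then show ?thesis using e \<tau> by simp
  qed
  have le: "(cmod (u s - U s))\<^sup>2 \<le> 2 * (cmod (u s - v s))\<^sup>2 + e / (2 * \<tau>)" if "s \<in> {0<..<\<tau>}" for s
  proof -
    have "(cmod (u s - U s))\<^sup>2 \<le> 2 * (cmod (u s - v s))\<^sup>2 + 2 * (cmod (v s - U s))\<^sup>2"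
      by (rule norm_diff_power2_le)
    also have "\<dots> \<le> 2 * (cmod (u s - v s))\<^sup>2 + e / (2 * \<tau>)" using pos[OF that] by simp
    finally show ?thesis .
  qed
  have i0: "integrable ?M (\<lambda>s. e / (2 * \<tau>))" by (rule LINT_open_interval) auto
  have i3: "integrable ?M (\<lambda>s. 2 * (cmod (u s - v s))\<^sup>2 + e / (2 * \<tau>))" using v(4) i0 by auto
  have "U \<in> borel_measurable ?M" by (intro continuous_imp_measurable_on_sets_lebesgue cU) auto
  then have i4: "integrable ?M (\<lambda>s. (cmod (u s - U s))\<^sup>2)"
    by (intro Bochner_Integration.integrable_bound[OF i3])
       (use u le e \<tau> in \<open>auto intro!: AE_I2 borel_measurable_diff borel_measurable_power\<close>)
  have "(LINT s|?M. (cmod (u s - U s))\<^sup>2) \<le> (LINT s|?M. 2 * (cmod (u s - v s))\<^sup>2 + e / (2 * \<tau>))"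
    by (rule integral_mono[OF i4 i3]) (use le in auto)
  also have "\<dots> = 2 * (LINT s|?M. (cmod (u s - v s))\<^sup>2) + (LINT s|?M. e / (2 * \<tau>))" using v(4) i0 by simp
  also have "(LINT s|?M. e / (2 * \<tau>)) = e / 2" using \<tau> by (subst LINT_open_interval(2)) auto
  also have "2 * (LINT s|?M. (cmod (u s - v s))\<^sup>2) + e / 2 \<le> e" using v(3) by simp
  finally show ?thesis using that[of p] neg i4 by (simp add: U_def)
qed

subsection \<open>Pairing entire solutions with test functions\<close>

abbreviation axis_pairing :: "(complex \<Rightarrow> complex) \<Rightarrow> (real \<Rightarrow> complex) \<Rightarrow> complex" where
  "axis_pairing h f \<equiv> integral {0..pi} (\<lambda>x. h (of_real x) * cnj (f x))"

text \<open>Cauchy-Schwarz applied to the integral of \<open>f'\<close> from the left end and from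
  the right end.\<close>

lemma C1_on_sqrt_bound:
  assumes c: "C1_on f f'" and z: "f 0 = 0" "f pi = 0" and x: "x \<in> {0..pi}"
  shows "cmod (f x) \<le> sqrt x * sqrt (sq_integral f')"
    "cmod (f x) \<le> sqrt (pi - x) * sqrt (sq_integral f')"
proof -
  let ?N = "sq_integral f'"
  have c': "continuous_on {0..pi} f'" using c by (simp add: C1_on_def)
  have sub: "integral {a..b} (\<lambda>x. (cmod (f' x))\<^sup>2) \<le> ?N" if "{a..b} \<subseteq> {0..pi}" for a b
    using that continuous_on_subset[OF c' that] c'
    by (intro integral_subset_le integrable_continuous_real continuous_intros) auto
  have bd: "cmod (integral {a..b} f') \<le> sqrt (b - a) * sqrt ?N" if ab: "a \<le> b" "{a..b} \<subseteq> {0..pi}" for a b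
  proof -
    have cab: "continuous_on {a..b} f'" by (rule continuous_on_subset[OF c' ab(2)])
    have "cmod (integral {a..b} f') \<le> integral {a..b} (\<lambda>x. cmod (f' x))"
      using cab by (intro integral_norm_bound_integral integrable_continuous_real continuous_intros) auto
    then have "(cmod (integral {a..b} f'))\<^sup>2 \<le> (integral {a..b} (\<lambda>x. cmod (f' x)))\<^sup>2" by (intro power_mono) auto
    also have "\<dots> \<le> (b - a) * integral {a..b} (\<lambda>x. (cmod (f' x))\<^sup>2)" by (rule integral_norm_power2_le[OF cab ab(1)])
    also have "\<dots> \<le> (b - a) * ?N" using ab sub by (intro mult_left_mono) auto
    finally show ?thesis by (simp add: real_sqrt_mult[symmetric] real_le_rsqrt)
  qed
  have i0: "integral {0..x} f' = f x" using C1_on_integral[OF c x] z by simp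
  then show "cmod (f x) \<le> sqrt x * sqrt ?N" using bd[of 0 x] x by auto
  have "integral {0..x} f' + integral {x..pi} f' = integral {0..pi} f'"
    using x by (intro Henstock_Kurzweil_Integration.integral_combine integrable_continuous_real c') auto
  then have "integral {x..pi} f' = - f x" using i0 C1_on_integral[OF c, of pi] z by (simp add: eq_neg_iff_add_eq_0 add.commute)
  then show "cmod (f x) \<le> sqrt (pi - x) * sqrt ?N" using bd[of x pi] x by auto
qed

text \<open>With \<open>d = min x (pi - x)\<close> the bounds \<open>7 * sqrt E / d\<close> for
  \<open>h\<close> and \<open>sqrt d\<close> times the norm of \<open>f'\<close> combine to an
  integrable singularity. The integral of \<open>1 / sqrt x + 1 / sqrt (pi - x)\<close> is
  \<open>4 * sqrt pi\<close>, whence the constant 28. Continuity of \<open>h\<close> up to the ends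
  is only qualitative and does not enter the bound.\<close>

lemma bergman_axis_pairing:
  assumes h: "h holomorphic_on D" "continuous_on {0..pi} (\<lambda>x. h (of_real x))"
    and E: "bergman_energy h \<le> ennreal E" "E \<ge> 0"
    and c: "C1_on f f'" and z: "f 0 = 0" "f pi = 0"
  shows "cmod (axis_pairing h f) \<le>
    28 * sqrt pi * sqrt E * sqrt (sq_integral f')"
proof -
  define N where "N = sqrt (sq_integral f')"
  define k where "k = (\<lambda>x. 7 * sqrt E * N * (1 / sqrt x + 1 / sqrt (pi - x)))"
  have N: "N \<ge> 0" unfolding N_def using c
    by (intro real_sqrt_ge_zero integral_nonneg integrable_continuous_real continuous_intros) (auto simp: C1_on_def)
  have "((\<lambda>x. 1 / sqrt x + 1 / sqrt (pi - x)) has_integral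
     (2 * sqrt pi - 2 * sqrt (pi - pi)) - (2 * sqrt 0 - 2 * sqrt (pi - 0))) {0..pi}"
  proof (rule fundamental_theorem_of_calculus_interior)
    show "continuous_on {0..pi} (\<lambda>x. 2 * sqrt x - 2 * sqrt (pi - x))" by (intro continuous_intros)
    fix x assume x: "x \<in> {0<..<pi}"
    show "((\<lambda>x. 2 * sqrt x - 2 * sqrt (pi - x)) has_vector_derivative 1 / sqrt x + 1 / sqrt (pi - x)) (at x)"
    proof -
      have "((\<lambda>x. 2 * sqrt x - 2 * sqrt (pi - x)) has_real_derivative
          2 * (inverse (sqrt x) / 2) - 2 * (inverse (sqrt (pi - x)) / 2 * (0 - 1))) (at x)"
        by (rule DERIV_diff DERIV_cmult DERIV_real_sqrt DERIV_chain2[OF DERIV_real_sqrt] DERIV_const DERIV_ident | use x in simp)+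
      then show ?thesis by (simp add: has_real_derivative_iff_has_vector_derivative inverse_eq_divide)
    qed
  qed simp
  then have kint: "(k has_integral 7 * sqrt E * N * (4 * sqrt pi)) {0..pi}"
    unfolding k_def by (intro has_integral_mult_right) simp
  have cf: "continuous_on {0..pi} f" by (rule C1_on_continuous[OF c])
  have "cmod (axis_pairing h f) \<le> integral {0..pi} k"
  proof (rule integral_norm_bound_integral)
    show "(\<lambda>x. h (of_real x) * cnj (f x)) integrable_on {0..pi}"
      by (intro integrable_continuous_real continuous_intros h cf)
    show "k integrable_on {0..pi}" using kint by (rule has_integral_integrable)
    fix x assume x: "x \<in> {0..pi}"
    show "cmod (h (of_real x) * cnj (f x)) \<le> k x"
    proof (cases "x = 0 \<or> x = pi")
      \<comment> \<open>At the ends \<open>f\<close> vanishes, and since \<open>1 / 0 = 0\<close>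
        the majorant is still nonnegative.\<close>
      case True
      then show ?thesis using z N E(2) x by (auto simp: k_def)
    next
      case False
      then have x': "0 < x" "x < pi" using x by auto
      define d where "d = min x (pi - x)"
      have d: "d > 0" using x' by (simp add: d_def)
      have "cmod (f x) \<le> sqrt d * N" using C1_on_sqrt_bound[OF c z x] by (auto simp: d_def N_def min_def)
      then have "cmod (h (of_real x) * cnj (f x)) \<le> (7 * sqrt E / d) * (sqrt d * N)"
        unfolding norm_mult complex_mod_cnj using bergman_axis_bound[OF h(1) x' E] E(2) d
        by (intro mult_mono) (auto simp: d_def)
      also have "\<dots> = 7 * sqrt E * N * (1 / sqrt d)"
      proof -
        have "sqrt d * sqrt d = d" "sqrt d > 0" using d by auto
        then have "sqrt d / d = 1 / sqrt d" by (metis nonzero_divide_mult_cancel_left order_less_irrefl)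
        then have "7 * sqrt E * N * (sqrt d / d) = 7 * sqrt E * N * (1 / sqrt d)" by (simp only:)
        then show ?thesis by (simp add: mult_ac)
      qed
      also have "\<dots> \<le> k x" unfolding k_def
      proof (rule mult_left_mono)
        show "1 / sqrt d \<le> 1 / sqrt x + 1 / sqrt (pi - x)" using x' by (auto simp: d_def min_def)
      qed (use E N in auto)
      finally show ?thesis .
    qed
  qed
  also have "integral {0..pi} k = 7 * sqrt E * N * (4 * sqrt pi)" using kint by (rule integral_unique)
  finally show ?thesis by (simp add: N_def mult_ac)
qed

text \<open>Green's identity for \<open>Z\<close> and the conjugate of \<open>f\<close>: the terms
  with \<open>x\<^sup>2\<close> cancel, and the unknown slopes of \<open>Z\<close> at the ends
  disappear because \<open>f\<close> vanishes there.\<close>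

lemma hermite_mode_green:
  assumes Z: "hermite_mode (real j) Z Z'" and c: "C1_on f f'" "C1_on f' f''" and z: "f 0 = 0" "f pi = 0"
    and g: "continuous_on {0..pi} g"
    and eq: "\<And>x. f'' x = (of_real l + of_real (x\<^sup>2)) * f x - g x"
  shows "of_real (real j) * axis_pairing Z f =
     of_real l * axis_pairing Z f - axis_pairing Z g
     + (Z 0 * cnj (f' 0) - Z (of_real pi) * cnj (f' pi))"
proof -
  note dZ = hermite_mode_real[OF Z]
  have cf: "continuous_on {0..pi} f" by (rule C1_on_continuous[OF c(1)])
  have d: "(f has_vector_derivative f' x) (at x within {0..pi})" "(f' has_vector_derivative f'' x) (at x within {0..pi})"
    if "x \<in> {0..pi}" for x using c that by (auto simp: C1_on_def)
  have "((\<lambda>x. (Z' (of_real x) * cnj (f' x) + (of_real (real j) + of_real (x\<^sup>2)) * Z (of_real x) * cnj (f x))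
       - (Z (of_real x) * cnj (f'' x) + Z' (of_real x) * cnj (f' x))) has_integral
     (Z' (of_real pi) * cnj (f pi) - Z (of_real pi) * cnj (f' pi)) - (Z' (of_real 0) * cnj (f 0) - Z (of_real 0) * cnj (f' 0))) {0..pi}"
    by (rule fundamental_theorem_of_calculus, simp)
       (intro has_vector_derivative_diff has_vector_derivative_mult has_vector_derivative_cnj dZ d; assumption)
  then have 1: "((\<lambda>x. (of_real (real j) - of_real l) * (Z (of_real x) * cnj (f x)) + Z (of_real x) * cnj (g x)) has_integral
     Z 0 * cnj (f' 0) - Z (of_real pi) * cnj (f' pi)) {0..pi}"
    by (simp add: z eq algebra_simps)
  have 2: "((\<lambda>x. (of_real (real j) - of_real l) * (Z (of_real x) * cnj (f x)) + Z (of_real x) * cnj (g x)) has_integral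
     (of_real (real j) - of_real l) * axis_pairing Z f + axis_pairing Z g) {0..pi}"
    by (intro has_integral_add has_integral_mult_right integrable_integral integrable_continuous_real continuous_intros dZ cf g)
  from has_integral_unique[OF 1 2] show ?thesis by (simp add: algebra_simps)
qed

lemma mode_sum_pairing:
  assumes Z: "\<And>j. hermite_mode (real j) (Z j) (Z' j)" and f: "continuous_on {0..pi} f"
  shows "integral {0..pi} (\<lambda>x. mode_sum n Z t (of_real x) * cnj (f x)) =
    (\<Sum>j\<in>{1..n}. of_real (exp (real j * t)) * axis_pairing (Z j) f)"
proof -
  have "((\<lambda>x. \<Sum>j\<in>{1..n}. of_real (exp (real j * t)) * (Z j (of_real x) * cnj (f x))) has_integral
     (\<Sum>j\<in>{1..n}. of_real (exp (real j * t)) * axis_pairing (Z j) f)) {0..pi}"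
    by (intro has_integral_sum has_integral_mult_right integrable_integral integrable_continuous_real continuous_intros hermite_mode_real[OF Z] f) auto
  then show ?thesis unfolding mode_sum_def sum_distrib_right mult.assoc by (rule integral_unique)
qed

text \<open>The counterpart of \<open>hermite_solution_tested\<close> for mode sums. Its shape
  matches term by term, so the two equations can be subtracted; the only additional term is the
  initial pairing \<open>P 0\<close>.\<close>

lemma mode_sum_evolution:
  fixes n :: nat
  assumes Z: "\<And>j. hermite_mode (real j) (Z j) (Z' j)" and c: "C1_on f f'" "C1_on f' f''" and z: "f 0 = 0" "f pi = 0"
    and g: "continuous_on {0..pi} g"
    and eq: "\<And>x. f'' x = (of_real l + of_real (x\<^sup>2)) * f x - g x" and t: "t \<ge> 0"
  defines "P \<equiv> \<lambda>t. integral {0..pi} (\<lambda>x. mode_sum n Z t (of_real x) * cnj (f x))"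
    and "m \<equiv> \<lambda>t. integral {0..pi} (\<lambda>x. mode_sum n Z t (of_real x) * cnj (g x))"
  shows "P t = P 0 + integral {0..t} (\<lambda>s. of_real l * P s - m s)
      + integral {0..t} (\<lambda>s. mode_sum n Z s 0) * cnj (f' 0) - integral {0..t} (\<lambda>s. mode_sum n Z s (of_real pi)) * cnj (f' pi)"
    and "continuous_on A P" and "continuous_on A m"
proof -
  note cf = C1_on_continuous[OF c(1)]
  have Peq: "P = (\<lambda>t. \<Sum>j\<in>{1..n}. of_real (exp (real j * t)) * axis_pairing (Z j) f)"
    unfolding P_def by (rule ext) (rule mode_sum_pairing[OF Z cf])
  have meq: "m = (\<lambda>t. \<Sum>j\<in>{1..n}. of_real (exp (real j * t)) * axis_pairing (Z j) g)"
    unfolding m_def by (rule ext) (rule mode_sum_pairing[OF Z g])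
  show cP: "continuous_on A P" for A unfolding Peq by (intro continuous_intros)
  show cm: "continuous_on A m" for A unfolding meq by (intro continuous_intros)
  have cW: "continuous_on A (\<lambda>s. mode_sum n Z s z)" for A z unfolding mode_sum_def by (intro continuous_intros)
  have I1: "((\<lambda>s. (of_real l * P s - m s) + (mode_sum n Z s 0 * cnj (f' 0) - mode_sum n Z s (of_real pi) * cnj (f' pi))) has_integral P t - P 0) {0..t}"
  proof (rule fundamental_theorem_of_calculus[OF t])
    fix s
    have "(P has_vector_derivative (\<Sum>j\<in>{1..n}. of_real (real j * exp (real j * s)) * axis_pairing (Z j) f)) (at s within {0..t})"
      unfolding Peq
    proof (intro has_vector_derivative_sum has_vector_derivative_mult_left has_vector_derivative_of_real)
      fix j show "((\<lambda>s. exp (real j * s)) has_real_derivative real j * exp (real j * s)) (at s within {0..t})"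
        by (auto intro!: derivative_eq_intros)
    qed
    also have "(\<Sum>j\<in>{1..n}. of_real (real j * exp (real j * s)) * axis_pairing (Z j) f) =
       (\<Sum>j\<in>{1..n}. of_real (exp (real j * s)) * (of_real (real j) * axis_pairing (Z j) f))"
      by (intro sum.cong refl) (simp add: mult_ac)
    also have "\<dots> = (of_real l * P s - m s) + (mode_sum n Z s 0 * cnj (f' 0) - mode_sum n Z s (of_real pi) * cnj (f' pi))"
      unfolding hermite_mode_green[OF Z c z g eq] Peq meq mode_sum_def
      by (simp add: sum_distrib_left sum_distrib_right sum.distrib[symmetric] sum_subtractf[symmetric] algebra_simps)
    finally show "(P has_vector_derivative (of_real l * P s - m s) + (mode_sum n Z s 0 * cnj (f' 0) - mode_sum n Z s (of_real pi) * cnj (f' pi))) (at s within {0..t})" .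
  qed
  have I2: "((\<lambda>s. (of_real l * P s - m s) + (mode_sum n Z s 0 * cnj (f' 0) - mode_sum n Z s (of_real pi) * cnj (f' pi))) has_integral
      integral {0..t} (\<lambda>s. of_real l * P s - m s) + (integral {0..t} (\<lambda>s. mode_sum n Z s 0) * cnj (f' 0) - integral {0..t} (\<lambda>s. mode_sum n Z s (of_real pi)) * cnj (f' pi))) {0..t}"
    by (intro has_integral_add has_integral_diff has_integral_mult_left integrable_integral integrable_continuous_real continuous_intros cP cm cW)
  from has_integral_unique[OF I1 I2] show "P t = P 0 + integral {0..t} (\<lambda>s. of_real l * P s - m s)
      + integral {0..t} (\<lambda>s. mode_sum n Z s 0) * cnj (f' 0) - integral {0..t} (\<lambda>s. mode_sum n Z s (of_real pi)) * cnj (f' pi)"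
    by (simp add: algebra_simps)
qed

text \<open>Variation of constants for the growing equation \<open>y' = l y - f\<close>, read
  backwards: the weighted integral of \<open>f\<close> is what separates the initial value,
  amplified by \<open>exp (l * \<tau>)\<close>, from the final one.\<close>

lemma perturbed_growth_moment_bound:
  fixes y f G :: "real \<Rightarrow> complex"
  assumes \<tau>: "\<tau> \<ge> 0" and l: "l \<ge> 0" and y: "continuous_on {0..\<tau>} y" and f: "continuous_on {0..\<tau>} f"
    and eq: "\<And>t. t \<in> {0..\<tau>} \<Longrightarrow> y t = y 0 + integral {0..t} (\<lambda>s. of_real l * y s - f s) + G t"
    and G: "\<And>t. t \<in> {0..\<tau>} \<Longrightarrow> cmod (G t) \<le> \<gamma>"
  shows "cmod (integral {0..\<tau>} (\<lambda>t. of_real (exp (l * (\<tau> - t))) * f t)) \<le> cmod (y \<tau>) + exp (l * \<tau>) * (cmod (y 0) + \<gamma>)"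
proof -
  \<comment> \<open>\<open>G\<close> is only bounded, so the differentiable part
    \<open>z = y - G\<close> is the one that is differentiated against the weight.\<close>
  define z where "z = (\<lambda>t. y 0 + integral {0..t} (\<lambda>s. of_real l * y s - f s))"
  have cs: "continuous_on {0..\<tau>} (\<lambda>s. of_real l * y s - f s)" by (intro continuous_intros y f)
  have dz: "(z has_vector_derivative of_real l * y t - f t) (at t within {0..\<tau>})" if "t \<in> {0..\<tau>}" for t
    unfolding z_def
    using has_vector_derivative_add[OF has_vector_derivative_const integral_has_vector_derivative[OF cs that]] by simp
  have Gz: "G t = y t - z t" if "t \<in> {0..\<tau>}" for t using eq[OF that] by (simp add: z_def)
  have cz: "continuous_on {0..\<tau>} z" using dz by (rule continuous_on_vector_derivative)
  define e where "e = (\<lambda>t. complex_of_real (exp (l * (\<tau> - t))))"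
  have ce: "continuous_on A e" for A unfolding e_def by (intro continuous_intros)
  have de: "(e has_vector_derivative - of_real l * e t) (at t within {0..\<tau>})" for t
  proof -
    have "((\<lambda>t. exp (l * (\<tau> - t))) has_real_derivative - l * exp (l * (\<tau> - t))) (at t within {0..\<tau>})"
      by (auto intro!: derivative_eq_intros)
    from has_vector_derivative_of_real[OF this] show ?thesis by (simp add: e_def)
  qed
  have "((\<lambda>t. e t * (of_real l * y t - f t) + (- of_real l * e t) * z t) has_integral e \<tau> * z \<tau> - e 0 * z 0) {0..\<tau>}"
    by (rule fundamental_theorem_of_calculus[OF \<tau>]) (intro has_vector_derivative_mult dz de; assumption)
  then have 1: "((\<lambda>t. of_real l * e t * (y t - z t) - e t * f t) has_integral z \<tau> - e 0 * y 0) {0..\<tau>}"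
    by (simp add: algebra_simps e_def z_def)
  have "((\<lambda>t. of_real l * e t * (y t - z t) - e t * f t) has_integral
     integral {0..\<tau>} (\<lambda>t. of_real l * e t * (y t - z t)) - integral {0..\<tau>} (\<lambda>t. e t * f t)) {0..\<tau>}"
    by (intro has_integral_diff integrable_integral integrable_continuous_real continuous_intros ce y cz f)
  from has_integral_unique[OF 1 this]
  have eqI: "integral {0..\<tau>} (\<lambda>t. e t * f t) = integral {0..\<tau>} (\<lambda>t. of_real l * e t * (y t - z t)) - z \<tau> + e 0 * y 0"
    by (simp add: algebra_simps)
  have "cmod (integral {0..\<tau>} (\<lambda>t. of_real l * e t * (y t - z t))) \<le> integral {0..\<tau>} (\<lambda>t. l * exp (l * (\<tau> - t)) * \<gamma>)"
  proof (rule integral_norm_bound_integral)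
    show "(\<lambda>t. of_real l * e t * (y t - z t)) integrable_on {0..\<tau>}" "(\<lambda>t. l * exp (l * (\<tau> - t)) * \<gamma>) integrable_on {0..\<tau>}"
      by (intro integrable_continuous_real continuous_intros ce y cz)+
    fix t assume t: "t \<in> {0..\<tau>}"
    then show "cmod (of_real l * e t * (y t - z t)) \<le> l * exp (l * (\<tau> - t)) * \<gamma>"
      using G[OF t] l unfolding Gz[OF t] by (simp add: norm_mult e_def mult_left_mono)
  qed
  also have "((\<lambda>t. l * exp (l * (\<tau> - t)) * \<gamma>) has_integral (- exp (l * (\<tau> - \<tau>)) * \<gamma> - - exp (l * (\<tau> - 0)) * \<gamma>)) {0..\<tau>}"
    by (rule fundamental_theorem_of_calculus[OF \<tau>])
       (auto simp: has_real_derivative_iff_has_vector_derivative[symmetric] intro!: derivative_eq_intros)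
  then have "((\<lambda>t. l * exp (l * (\<tau> - t)) * \<gamma>) has_integral exp (l * \<tau>) * \<gamma> - \<gamma>) {0..\<tau>}" by simp
  then have "integral {0..\<tau>} (\<lambda>t. l * exp (l * (\<tau> - t)) * \<gamma>) = exp (l * \<tau>) * \<gamma> - \<gamma>" by (rule integral_unique)
  finally have b1: "cmod (integral {0..\<tau>} (\<lambda>t. of_real l * e t * (y t - z t))) \<le> exp (l * \<tau>) * \<gamma> - \<gamma>" .
  \<comment> \<open>The \<open>\<gamma>\<close> arising here cancels the \<open>- \<gamma>\<close>
    of the preceding integral.\<close>
  have "cmod (z \<tau>) \<le> cmod (y \<tau>) + \<gamma>"
    using G[of \<tau>] Gz[of \<tau>] \<tau> norm_triangle_ineq4[of "y \<tau>" "G \<tau>"] by simp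
  moreover have "cmod (e 0 * y 0) = exp (l * \<tau>) * cmod (y 0)" by (simp add: e_def norm_mult)
  ultimately have "cmod (integral {0..\<tau>} (\<lambda>t. e t * f t)) \<le> (exp (l * \<tau>) * \<gamma> - \<gamma>) + (cmod (y \<tau>) + \<gamma>) + exp (l * \<tau>) * cmod (y 0)"
    unfolding eqI using b1
    by (intro order_trans[OF norm_triangle_ineq] add_mono order_trans[OF norm_triangle_ineq4]) auto
  then show ?thesis by (simp add: e_def algebra_simps)
qed

section \<open>Mode sums with prescribed exponential boundary values, and their energy\<close>

lemma poly_sum_ge_degree:
  fixes p :: "complex poly"
  assumes "degree p \<le> n"
  shows "poly p x = (\<Sum>i\<le>n. coeff p i * x ^ i)"
  unfolding poly_altdef using assms by (intro sum.mono_neutral_left) (auto simp: coeff_eq_0)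

text \<open>The modes with boundary values \<open>(1, 0)\<close> and \<open>(0, 1)\<close> are fixed
  once for every \<open>j\<close>, so the state depends linearly on the polynomials. Linearity gives
  the last clause, through which differences of approximants obey the same energy bound. The shift
  to \<open>j - 1\<close> reflects the prefactor \<open>exp t\<close>.\<close>

lemma exponential_boundary_modes:
  obtains n :: "complex poly \<Rightarrow> complex poly \<Rightarrow> nat" and Z Z' where
    "\<And>(p :: complex poly) (q :: complex poly) j. hermite_mode (real j) (Z p q j) (Z' p q j)"
    "\<And>p q t. mode_sum (n p q) (Z p q) t 0 = of_real (exp t) * poly p (of_real (exp t))"
    "\<And>p q t. mode_sum (n p q) (Z p q) t (of_real pi) = of_real (exp t) * poly q (of_real (exp t))"
    "\<And>p q p' q' t z. mode_sum (n p q) (Z p q) t z - mode_sum (n p' q') (Z p' q') t z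
       = mode_sum (n (p - p') (q - q')) (Z (p - p') (q - q')) t z"
proof -
  have "\<exists>Y Y'. hermite_mode (real j) Y Y' \<and> Y 0 = 1 \<and> Y (of_real pi) = 0" for j
    by (rule hermite_mode_boundary[of "real j" 1 0]) auto
  then obtain A A' where A: "\<And>j. hermite_mode (real j) (A j) (A' j)" "\<And>j. A j 0 = 1" "\<And>j. A j (of_real pi) = 0"
    by metis
  have "\<exists>Y Y'. hermite_mode (real j) Y Y' \<and> Y 0 = 0 \<and> Y (of_real pi) = 1" for j
    by (rule hermite_mode_boundary[of "real j" 0 1]) auto
  then obtain B B' where B: "\<And>j. hermite_mode (real j) (B j) (B' j)" "\<And>j. B j 0 = 0" "\<And>j. B j (of_real pi) = 1"
    by metis
  define Z where "Z = (\<lambda>(p :: complex poly) (q :: complex poly) j z. coeff p (j - 1) * A j z + coeff q (j - 1) * B j z)"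
  define Z' where "Z' = (\<lambda>(p :: complex poly) (q :: complex poly) j z. coeff p (j - 1) * A' j z + coeff q (j - 1) * B' j z)"
  define n where "n = (\<lambda>(p :: complex poly) (q :: complex poly). Suc (max (degree p) (degree q)))"
  have mode: "hermite_mode (real j) (Z p q j) (Z' p q j)" for j and p q :: "complex poly"
    unfolding Z_def Z'_def by (rule hermite_mode_lincomb[OF A(1) B(1)])
  \<comment> \<open>Coefficients beyond the degree vanish, so sums of different lengths can be
    compared at a common length.\<close>
  have ext: "mode_sum N (Z p q) t z = mode_sum (n p q) (Z p q) t z" if "N \<ge> n p q" for N t z and p q :: "complex poly"
    unfolding mode_sum_def
  proof (rule sum.mono_neutral_right)
    show "\<forall>j\<in>{1..N} - {1..n p q}. of_real (exp (real j * t)) * Z p q j z = 0"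
      by (auto simp: Z_def n_def coeff_eq_0)
  qed (use that in auto)
  have bd: "(\<Sum>j\<in>{1..n p q}. of_real (exp (real j * t)) * coeff r (j - 1)) = of_real (exp t) * poly r (of_real (exp t))"
    if "r = p \<or> r = q" for p q r t
  proof -
    have "(\<Sum>j\<in>{1..n p q}. of_real (exp (real j * t)) * coeff r (j - 1)) = (\<Sum>i\<le>max (degree p) (degree q). of_real (exp (real (Suc i) * t)) * coeff r i)"
      unfolding n_def by (simp only: One_nat_def sum.atLeast1_atMost_eq lessThan_Suc_atMost diff_Suc_Suc diff_zero)
    also have "\<dots> = (\<Sum>i\<le>max (degree p) (degree q). of_real (exp t) * (coeff r i * of_real (exp t) ^ i))"
      unfolding exp_of_nat_mult by (intro sum.cong refl) (simp add: mult_ac)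
    also have "\<dots> = of_real (exp t) * poly r (of_real (exp t))"
      unfolding sum_distrib_left[symmetric] using that by (subst poly_sum_ge_degree) auto
    finally show ?thesis .
  qed
  have b0: "mode_sum (n p q) (Z p q) t 0 = of_real (exp t) * poly p (of_real (exp t))" for p q t
    using bd[of p p q t] by (simp add: mode_sum_def Z_def A B)
  have bpi: "mode_sum (n p q) (Z p q) t (of_real pi) = of_real (exp t) * poly q (of_real (exp t))" for p q t
    using bd[of q p q t] by (simp add: mode_sum_def Z_def A B)
  have diff: "mode_sum (n p q) (Z p q) t z - mode_sum (n p' q') (Z p' q') t z
       = mode_sum (n (p - p') (q - q')) (Z (p - p') (q - q')) t z" for p q p' q' t z
  proof -
    define N where "N = max (n p q) (max (n p' q') (n (p - p') (q - q')))"
    have N: "N \<ge> n p q" "N \<ge> n p' q'" "N \<ge> n (p - p') (q - q')" by (auto simp: N_def)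
    have "mode_sum N (Z p q) t z - mode_sum N (Z p' q') t z = mode_sum N (Z (p - p') (q - q')) t z"
      unfolding mode_sum_def sum_subtractf[symmetric] by (intro sum.cong refl) (simp add: Z_def algebra_simps)
    then show ?thesis unfolding ext[OF N(1)] ext[OF N(2)] ext[OF N(3)] .
  qed
  show ?thesis by (rule that[OF mode b0 bpi diff])
qed

lemma mode_sum_holomorphic:
  assumes Z: "\<And>j. hermite_mode (real j) (Z j) (Z' j)"
  shows "mode_sum n Z t holomorphic_on A" "continuous_on A (mode_sum n Z t)"
proof -
  have "Z j holomorphic_on A" for j
    using Z[of j] by (auto simp: hermite_mode_def holomorphic_on_def field_differentiable_def intro: has_field_derivative_at_within)
  then show "mode_sum n Z t holomorphic_on A"
    unfolding mode_sum_def by (intro holomorphic_intros)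
  then show "continuous_on A (mode_sum n Z t)" by (rule holomorphic_on_imp_continuous_on)
qed

text \<open>\<open>diamond_energy_bound\<close> with
  \<open>\<delta> = 2 * \<epsilon>\<^sup>2\<close>, halved by the Jacobian of the
  coordinates.\<close>

lemma bergman_energy_mode_sum:
  assumes Z: "\<And>j. hermite_mode (real j) (Z j) (Z' j)" and \<epsilon>: "\<epsilon> \<ge> 0"
    and n: "\<And>s. s \<le> 0 \<Longrightarrow> cmod (mode_sum n Z s 0) \<le> \<epsilon> * exp s" "\<And>s. s \<le> 0 \<Longrightarrow> cmod (mode_sum n Z s (of_real pi)) \<le> \<epsilon> * exp s"
  shows "bergman_energy (mode_sum n Z 0) \<le> ennreal (\<epsilon>\<^sup>2)"
    and "t \<in> {0..\<tau>} \<Longrightarrow> integral {0..\<tau>} (\<lambda>s. (cmod (mode_sum n Z s 0))\<^sup>2) \<le> \<kappa> \<Longrightarrow>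
      integral {0..\<tau>} (\<lambda>s. (cmod (mode_sum n Z s (of_real pi)))\<^sup>2) \<le> \<kappa> \<Longrightarrow>
      bergman_energy (mode_sum n Z t) \<le> ennreal (\<epsilon>\<^sup>2 + 2 * \<kappa>)"
proof -
  have neg: "(cmod (mode_sum n Z s 0))\<^sup>2 + (cmod (mode_sum n Z s (of_real pi)))\<^sup>2 \<le> (2 * \<epsilon>\<^sup>2) * exp (2 * s)" if "s \<le> 0" for s
  proof -
    have "(cmod (mode_sum n Z s 0))\<^sup>2 + (cmod (mode_sum n Z s (of_real pi)))\<^sup>2 \<le> (\<epsilon> * exp s)\<^sup>2 + (\<epsilon> * exp s)\<^sup>2"
      using n[OF that] by (intro add_mono power_mono) auto
    then show ?thesis by (simp add: power_mult_distrib exp_double)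
  qed
  note b = diamond_energy_bound[OF Z neg]
  have e: "bergman_energy (mode_sum n Z t) = ennreal (diamond_energy (mode_sum n Z t) / 2)" for t
    by (rule bergman_energy_eq_diamond_energy) (rule mode_sum_holomorphic[OF Z])
  show "bergman_energy (mode_sum n Z 0) \<le> ennreal (\<epsilon>\<^sup>2)" unfolding e by (rule ennreal_leI) (use b(1) in simp)
  show "bergman_energy (mode_sum n Z t) \<le> ennreal (\<epsilon>\<^sup>2 + 2 * \<kappa>)" if t: "t \<in> {0..\<tau>}"
    and k: "integral {0..\<tau>} (\<lambda>s. (cmod (mode_sum n Z s 0))\<^sup>2) \<le> \<kappa>" "integral {0..\<tau>} (\<lambda>s. (cmod (mode_sum n Z s (of_real pi)))\<^sup>2) \<le> \<kappa>"
  proof -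
    have c: "continuous_on A (\<lambda>s. (cmod (mode_sum n Z s z))\<^sup>2)" for A z unfolding mode_sum_def by (intro continuous_intros)
    have "integral {0..t} (\<lambda>s. (cmod (mode_sum n Z s z))\<^sup>2) \<le> integral {0..\<tau>} (\<lambda>s. (cmod (mode_sum n Z s z))\<^sup>2)" for z
      using t by (intro integral_subset_le integrable_continuous_real c) auto
    then have "integral {0..t} (\<lambda>s. (cmod (mode_sum n Z s 0))\<^sup>2) + integral {0..t} (\<lambda>s. (cmod (mode_sum n Z s (of_real pi)))\<^sup>2) \<le> \<kappa> + \<kappa>"
      using k by (intro add_mono) (auto intro: order_trans)
    moreover have "integral {0..t} (\<lambda>s. (cmod (mode_sum n Z s 0))\<^sup>2 + (cmod (mode_sum n Z s (of_real pi)))\<^sup>2) =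
      integral {0..t} (\<lambda>s. (cmod (mode_sum n Z s 0))\<^sup>2) + integral {0..t} (\<lambda>s. (cmod (mode_sum n Z s (of_real pi)))\<^sup>2)"
      by (intro Henstock_Kurzweil_Integration.integral_add integrable_continuous_real c)
    ultimately have "diamond_energy (mode_sum n Z t) \<le> 2 * \<epsilon>\<^sup>2 + 2 * (\<kappa> + \<kappa>)" using b(2)[of t] t by simp
    then show ?thesis unfolding e by (intro ennreal_leI) simp
  qed
qed

lemma L2_distance_triangle:
  fixes u U V :: "real \<Rightarrow> complex"
  assumes U: "continuous_on {0..\<tau>} U" "integrable (lebesgue_on {0<..<\<tau>}) (\<lambda>s. (cmod (u s - U s))\<^sup>2)"
    and V: "continuous_on {0..\<tau>} V" "integrable (lebesgue_on {0<..<\<tau>}) (\<lambda>s. (cmod (u s - V s))\<^sup>2)"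
  shows "integral {0..\<tau>} (\<lambda>s. (cmod (U s - V s))\<^sup>2) \<le>
    2 * (LINT s|lebesgue_on {0<..<\<tau>}. (cmod (u s - U s))\<^sup>2) + 2 * (LINT s|lebesgue_on {0<..<\<tau>}. (cmod (u s - V s))\<^sup>2)"
proof -
  have c: "continuous_on {0..\<tau>} (\<lambda>s. (cmod (U s - V s))\<^sup>2)" by (intro continuous_intros U V)
  have "integral {0..\<tau>} (\<lambda>s. (cmod (U s - V s))\<^sup>2) = (LINT s|lebesgue_on {0<..<\<tau>}. (cmod (U s - V s))\<^sup>2)"
    by (rule LINT_open_interval(2)[OF c, symmetric])
  also have "\<dots> \<le> (LINT s|lebesgue_on {0<..<\<tau>}. 2 * (cmod (u s - U s))\<^sup>2 + 2 * (cmod (u s - V s))\<^sup>2)"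
  proof (rule integral_mono[OF LINT_open_interval(1)[OF c]])
    show "integrable (lebesgue_on {0<..<\<tau>}) (\<lambda>s. 2 * (cmod (u s - U s))\<^sup>2 + 2 * (cmod (u s - V s))\<^sup>2)" using U V by auto
    fix s
    show "(cmod (U s - V s))\<^sup>2 \<le> 2 * (cmod (u s - U s))\<^sup>2 + 2 * (cmod (u s - V s))\<^sup>2"
      using norm_diff_power2_le[of "U s" "V s" "u s"] by (simp add: norm_minus_commute)
  qed
  also have "\<dots> = 2 * (LINT s|lebesgue_on {0<..<\<tau>}. (cmod (u s - U s))\<^sup>2) + 2 * (LINT s|lebesgue_on {0<..<\<tau>}. (cmod (u s - V s))\<^sup>2)"
    using U V by simp
  finally show ?thesis .
qed

text \<open>The inequality \<open>cmod z \<le> \<kappa> / 2 + (cmod z)\<^sup>2 / (2 *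
  \<kappa>)\<close> with \<open>\<kappa> = sqrt e\<close> plays the part of Cauchy-Schwarz; the same
  majorant also yields the integrability of \<open>u\<close> itself.\<close>

lemma L1_distance_le:
  fixes u U :: "real \<Rightarrow> complex"
  assumes u: "u \<in> borel_measurable (lebesgue_on {0<..<\<tau>})" "integrable (lebesgue_on {0<..<\<tau>}) (\<lambda>s. (cmod (u s))\<^sup>2)"
    and U: "continuous_on {0..\<tau>} U" "integrable (lebesgue_on {0<..<\<tau>}) (\<lambda>s. (cmod (u s - U s))\<^sup>2)"
    and e: "(LINT s|lebesgue_on {0<..<\<tau>}. (cmod (u s - U s))\<^sup>2) \<le> e" "e > 0" and t: "t \<in> {0..\<tau>}"
  shows "cmod ((LINT s|lebesgue_on {0<..<t}. u s) - integral {0..t} U) \<le> sqrt e * (\<tau> + 1)"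
proof -
  let ?M = "lebesgue_on {0<..<\<tau>}"
  define \<kappa> where "\<kappa> = sqrt e"
  have \<kappa>: "\<kappa> > 0" "\<kappa> * \<kappa> = e" using e by (auto simp: \<kappa>_def)
  have t0: "0 \<le> \<tau>" using t by auto
  have cut: "integrable (lebesgue_on {0<..<t}) f" if "integrable ?M f" for f :: "real \<Rightarrow> complex"
  proof -
    have "set_integrable lebesgue {0<..<\<tau>} f" using that by (simp add: set_integrable_def integrable_restrict_space)
    then have "set_integrable lebesgue {0<..<t} f" by (rule set_integrable_subset) (use t in auto)
    then show ?thesis by (simp add: absolutely_integrable_imp_integrable)
  qed
  have i1: "integrable ?M (\<lambda>s. 1 :: real)" by (rule LINT_open_interval) auto
  have am: "cmod z \<le> \<kappa> / 2 + (cmod z)\<^sup>2 / (2 * \<kappa>)" for z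
  proof -
    have "2 * \<kappa> * cmod z \<le> \<kappa>\<^sup>2 + (cmod z)\<^sup>2" using sum_squares_bound[of \<kappa> "cmod z"] by simp
    then show ?thesis using \<kappa> by (simp add: field_simps power2_eq_square)
  qed
  have Um: "U \<in> borel_measurable ?M" using LINT_open_interval(1)[OF U(1)] by auto
  have id: "integrable ?M (\<lambda>s. \<kappa> / 2 + (cmod (u s - U s))\<^sup>2 / (2 * \<kappa>))"
    using U(2) LINT_open_interval(1)[of 0 \<tau> "\<lambda>s. \<kappa> / 2"] by auto
  have iD: "integrable ?M (\<lambda>s. u s - U s)"
    by (rule Bochner_Integration.integrable_bound[OF id]) (use u Um am \<kappa> in \<open>auto intro!: AE_I2 order_trans[OF am]\<close>)
  have iU: "integrable ?M U" by (rule LINT_open_interval(1)[OF U(1)])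
  have iu: "integrable ?M u" using Bochner_Integration.integrable_add[OF iD iU] by simp
  have "integral {0..t} U = (LINT s|lebesgue_on {0<..<t}. U s)"
    using t by (intro LINT_open_interval(2)[symmetric] continuous_on_subset[OF U(1)]) auto
  then have "(LINT s|lebesgue_on {0<..<t}. u s) - integral {0..t} U = (LINT s|lebesgue_on {0<..<t}. u s - U s)"
    using cut[OF iu] cut[OF iU] by simp
  also have "cmod \<dots> \<le> (LINT s|lebesgue_on {0<..<t}. cmod (u s - U s))" by (rule integral_norm_bound)
  also have "\<dots> = (LINT s|lebesgue. indicator {0<..<t} s *\<^sub>R cmod (u s - U s))" by (rule integral_restrict_space) auto
  also have "\<dots> \<le> (LINT s|lebesgue. indicator {0<..<\<tau>} s *\<^sub>R (\<kappa> / 2 + (cmod (u s - U s))\<^sup>2 / (2 * \<kappa>)))"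
  proof (rule integral_mono)
    show "integrable lebesgue (\<lambda>s. indicator {0<..<t} s *\<^sub>R cmod (u s - U s))"
      using integrable_norm[OF cut[OF iD]] by (subst (asm) integrable_restrict_space) auto
    show "integrable lebesgue (\<lambda>s. indicator {0<..<\<tau>} s *\<^sub>R (\<kappa> / 2 + (cmod (u s - U s))\<^sup>2 / (2 * \<kappa>)))"
      using id by (subst (asm) integrable_restrict_space) auto
    show "indicator {0<..<t} s *\<^sub>R cmod (u s - U s) \<le> indicator {0<..<\<tau>} s *\<^sub>R (\<kappa> / 2 + (cmod (u s - U s))\<^sup>2 / (2 * \<kappa>))" for s
      using t am[of "u s - U s"] \<kappa> by (auto simp: indicator_def)
  qed
  also have "\<dots> = (LINT s|?M. \<kappa> / 2 + (cmod (u s - U s))\<^sup>2 / (2 * \<kappa>))" by (rule integral_restrict_space[symmetric]) auto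
  also have "\<dots> = (LINT s|?M. \<kappa> / 2) + (LINT s|?M. (cmod (u s - U s))\<^sup>2) / (2 * \<kappa>)"
    using U(2) LINT_open_interval(1)[of 0 \<tau> "\<lambda>s. \<kappa> / 2"] by simp
  also have "(LINT s|?M. \<kappa> / 2) = \<kappa> / 2 * \<tau>" using t0 by (subst LINT_open_interval(2)) auto
  also have "\<kappa> / 2 * \<tau> + (LINT s|?M. (cmod (u s - U s))\<^sup>2) / (2 * \<kappa>) \<le> \<kappa> / 2 * \<tau> + e / (2 * \<kappa>)"
    using e \<kappa> by (intro add_left_mono divide_right_mono) auto
  also have "e / (2 * \<kappa>) = \<kappa> / 2" using \<kappa> by (simp add: field_simps)
  also have "\<kappa> / 2 * \<tau> + \<kappa> / 2 \<le> \<kappa> * (\<tau> + 1)"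
  proof -
    have "0 \<le> \<kappa> / 2 * (\<tau> + 1)" using \<kappa> t0 by (intro mult_nonneg_nonneg) auto
    then show ?thesis by (simp add: algebra_simps)
  qed
  finally show ?thesis by (simp add: \<kappa>_def)
qed

subsection \<open>Identification of the final state\<close>

lemma L2_components:
  fixes u :: "real \<Rightarrow> complex \<times> complex"
  assumes "u \<in> L2 S" and S: "S \<in> sets lebesgue"
  shows "(\<lambda>s. fst (u s)) \<in> borel_measurable (lebesgue_on S)" "integrable (lebesgue_on S) (\<lambda>s. (cmod (fst (u s)))\<^sup>2)"
    "(\<lambda>s. snd (u s)) \<in> borel_measurable (lebesgue_on S)" "integrable (lebesgue_on S) (\<lambda>s. (cmod (snd (u s)))\<^sup>2)"
proof -
  have u: "u \<in> borel_measurable (lebesgue_on S)" "integrable (lebesgue_on S) (\<lambda>s. (norm (u s))\<^sup>2)"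
    using assms by (auto simp: L2_def)
  have f: "fst \<in> borel_measurable (borel :: (complex \<times> complex) measure)" "snd \<in> borel_measurable (borel :: (complex \<times> complex) measure)"
    by (intro borel_measurable_continuous_onI continuous_intros)+
  show m: "(\<lambda>s. fst (u s)) \<in> borel_measurable (lebesgue_on S)" "(\<lambda>s. snd (u s)) \<in> borel_measurable (lebesgue_on S)"
    by (rule measurable_compose[OF u(1) f(1)] measurable_compose[OF u(1) f(2)])+
  have le: "cmod (fst x) \<le> norm x" "cmod (snd x) \<le> norm x" for x :: "complex \<times> complex"
    by (simp_all add: norm_prod_def real_le_rsqrt)
  show "integrable (lebesgue_on S) (\<lambda>s. (cmod (fst (u s)))\<^sup>2)"
    by (rule Bochner_Integration.integrable_bound[OF u(2)]) (use m le in \<open>auto intro!: AE_I2 power_mono\<close>)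
  show "integrable (lebesgue_on S) (\<lambda>s. (cmod (snd (u s)))\<^sup>2)"
    by (rule Bochner_Integration.integrable_bound[OF u(2)]) (use m le in \<open>auto intro!: AE_I2 power_mono\<close>)
qed

lemma C1_on_test_function:
  assumes "g \<in> test_functions J"
  shows "C1_on g (vderiv g)" "g 0 = 0" "g pi = 0"
  using test_functionD[OF assms] by auto

text \<open>The interface between the construction of approximants and the identification of their
  limit: errors governed by \<open>\<epsilon> k\<close>, a Cauchy bound uniform in time, and a bound
  \<open>B\<close> at the final time that is uniform in \<open>k\<close>.\<close>

locale hermite_approximation =
  fixes \<tau> :: real and u :: "real \<Rightarrow> complex \<times> complex" and w :: "real \<Rightarrow> functional"
    and n :: "nat \<Rightarrow> nat" and Z Z' :: "nat \<Rightarrow> nat \<Rightarrow> complex \<Rightarrow> complex" and \<epsilon> :: "nat \<Rightarrow> real"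
    and W :: "nat \<Rightarrow> real \<Rightarrow> complex \<Rightarrow> complex" and B :: real
  assumes \<tau>: "\<tau> > 0" and u: "u \<in> L2 {0<..<\<tau>}"
    and w: "hermite_solution (\<lambda>\<psi>. 0) (\<lambda>s. if 0 < s \<and> s < \<tau> then u s else 0) w"
    and mode: "\<And>k j. hermite_mode (real j) (Z k j) (Z' k j)"
    and W: "\<And>k. W k = mode_sum (n k) (Z k)"
    and \<epsilon>: "\<And>k. \<epsilon> k > 0" "\<epsilon> \<longlonglongrightarrow> 0"
    and control_0: "\<And>k. integrable (lebesgue_on {0<..<\<tau>}) (\<lambda>s. (cmod (fst (u s) - W k s 0))\<^sup>2)"
      "\<And>k. (LINT s|lebesgue_on {0<..<\<tau>}. (cmod (fst (u s) - W k s 0))\<^sup>2) \<le> \<epsilon> k"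
    and control_pi: "\<And>k. integrable (lebesgue_on {0<..<\<tau>}) (\<lambda>s. (cmod (snd (u s) - W k s (of_real pi)))\<^sup>2)"
      "\<And>k. (LINT s|lebesgue_on {0<..<\<tau>}. (cmod (snd (u s) - W k s (of_real pi)))\<^sup>2) \<le> \<epsilon> k"
    and initial: "\<And>k. bergman_energy (W k 0) \<le> ennreal ((\<epsilon> k)\<^sup>2)"
    and cauchy: "\<And>k l t. t \<in> {0..\<tau>} \<Longrightarrow> bergman_energy (\<lambda>z. W k t z - W l t z) \<le> ennreal (10 * (\<epsilon> k + \<epsilon> l))"
    and final: "\<And>k. bergman_energy (W k \<tau>) \<le> ennreal B" "B \<ge> 0"
begin

lemma W_holomorphic: "W k t holomorphic_on A"
  unfolding W by (rule mode_sum_holomorphic(1)[OF mode])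

lemma W_axis_continuous: "continuous_on A (\<lambda>x. W k t (of_real x))"
  unfolding W by (rule continuous_on_compose2[OF mode_sum_holomorphic(2)[OF mode, of UNIV]]) (auto intro: continuous_intros)

lemma W_time_continuous: "continuous_on A (\<lambda>s. W k s z)"
  unfolding W mode_sum_def by (intro continuous_intros)

lemma continuous_dual: "continuous_dual_valued J {0..} w"
  using w by (simp add: hermite_solution_def)

text \<open>The first term on the right is free of \<open>l\<close>: it comes from the states at
  time \<open>\<tau>\<close> and the norm bound for the resolvent. The constant \<open>K\<close> may
  grow with \<open>l\<close>, but it multiplies a quantity that vanishes as \<open>k\<close>
  grows.\<close>

lemma moment_bound:
  assumes l: "l \<ge> 1" and g: "C1_on g g'" "g 0 = 0" "g pi = 0"
    and C: "\<And>\<psi>. \<psi> \<in> sobolev_10 J \<Longrightarrow> cmod (w \<tau> \<psi>) \<le> C * sobolev_norm J \<psi>"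
  obtains K where "\<And>k. cmod (integral {0..\<tau>} (\<lambda>t. of_real (exp (l * (\<tau> - t))) *
        (w t g - axis_pairing (W k t) g))) \<le>
      (\<bar>C\<bar> + 28 * sqrt pi * sqrt B) * sqrt (sq_integral g) + K * (\<epsilon> k + sqrt (\<epsilon> k))"
proof -
  let ?N = "\<lambda>f. sqrt (sq_integral f)"
  let ?v = "\<lambda>s. if 0 < s \<and> s < \<tau> then u s else 0"
  obtain f f' f'' f''' where c: "C1_on f f'" "C1_on f' f''" "C1_on f'' f'''"
    and z: "f 0 = 0" "f pi = 0" "f'' 0 = 0" "f'' pi = 0"
    and eq: "\<And>x. f'' x = (of_real l + of_real (x\<^sup>2)) * f x - g x"
    and en: "sq_integral f + sq_integral f' \<le> sq_integral g"
    by (rule hermite_resolvent[OF l g]) blast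
  have cf: "continuous_on {0..pi} f" "continuous_on {0..pi} f'" "continuous_on {0..pi} g"
    using C1_on_continuous c g by blast+
  have "sq_integral f \<ge> 0"
    by (intro integral_nonneg integrable_continuous_real continuous_intros cf) auto
  then have N': "?N f' \<le> ?N g" using en by (intro real_sqrt_le_mono) linarith
  have N0: "?N f' \<ge> 0" by (intro real_sqrt_ge_zero integral_nonneg integrable_continuous_real continuous_intros cf) auto
  have f10: "f \<in> sobolev_10 J" by (rule AE_eq_sobolev_10[OF c(1) z(1,2)]) auto
  have fn: "sobolev_norm J f \<le> ?N g"
    by (subst C1_on_sobolev_norm[OF c(1), of f]) (use en in \<open>auto intro!: real_sqrt_le_mono\<close>)
  define P where "P k t = axis_pairing (W k t) f" for k t
  define m where "m k t = axis_pairing (W k t) g" for k t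
  note ev = mode_sum_evolution[where n = "n k" and Z = "Z k" and Z' = "Z' k" for k, OF mode c(1,2) z(1,2) cf(3) eq,
    folded W, folded P_def m_def]
  note ev_cont = ev(2,3)[OF order_refl]
  \<comment> \<open>The accumulated error of the controls, weighted by the slopes of
    \<open>f\<close> at the ends.\<close>
  define G where "G = (\<lambda>k t. ((LINT s|lebesgue_on {0<..<t}. fst (?v s)) - integral {0..t} (\<lambda>s. W k s 0)) * cnj (f' 0)
      - ((LINT s|lebesgue_on {0<..<t}. snd (?v s)) - integral {0..t} (\<lambda>s. W k s (of_real pi))) * cnj (f' pi))"
  define y where "y = (\<lambda>k t. w t f - P k t)"
  define F where "F = cmod (f' 0) + cmod (f' pi)"
  have cw: "continuous_on {0..\<tau>} (\<lambda>t. w t f)" "continuous_on {0..\<tau>} (\<lambda>t. w t g)"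
    using continuous_dual_valued_pairing[OF continuous_dual c(1) z(1,2)] continuous_dual_valued_pairing[OF continuous_dual g]
    by (auto elim!: continuous_on_subset)
  note wt = hermite_solution_tested[OF w _ c z g eq]
  \<comment> \<open>The weak formulation at time \<open>0\<close> has only empty integrals, which
    gives the initial condition for \<open>w\<close>.\<close>
  have "(LINT s|lebesgue_on {0<..<(0::real)}. h s) = 0" for h :: "real \<Rightarrow> complex"
    by (subst integral_restrict_space) auto
  then have w0: "w 0 f = 0" using wt[of 0] by simp
  have yeq: "y k t = y k 0 + integral {0..t} (\<lambda>s. of_real l * y k s - (w s g - m k s)) + G k t" if t: "t \<in> {0..\<tau>}" for k t
  proof -
    have t0: "t \<ge> 0" using t by simp
    have "{0..t} \<subseteq> {0..\<tau>}" using t by auto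
    note sub = continuous_on_subset[OF cw(1) this] continuous_on_subset[OF cw(2) this]
    have "integral {0..t} (\<lambda>s. of_real l * y k s - (w s g - m k s)) =
       integral {0..t} (\<lambda>s. (of_real l * w s f - w s g) - (of_real l * P k s - m k s))"
      by (simp add: y_def algebra_simps)
    also have "\<dots> = integral {0..t} (\<lambda>s. of_real l * w s f - w s g) - integral {0..t} (\<lambda>s. of_real l * P k s - m k s)"
      by (intro Henstock_Kurzweil_Integration.integral_diff integrable_continuous_real continuous_intros sub ev_cont)
    finally have I: "integral {0..t} (\<lambda>s. of_real l * y k s - (w s g - m k s)) =
       integral {0..t} (\<lambda>s. of_real l * w s f - w s g) - integral {0..t} (\<lambda>s. of_real l * P k s - m k s)" .
    define I1 I2 where "I1 = integral {0..t} (\<lambda>s. of_real l * w s f - w s g)"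
      and "I2 = integral {0..t} (\<lambda>s. of_real l * P k s - m k s)"
    define a0 a1 where "a0 = (LINT s|lebesgue_on {0<..<t}. fst (?v s))" and "a1 = (LINT s|lebesgue_on {0<..<t}. snd (?v s))"
    define b0 b1 where "b0 = integral {0..t} (\<lambda>s. W k s 0)" and "b1 = integral {0..t} (\<lambda>s. W k s (of_real pi))"
    have "w t f = I1 + a0 * cnj (f' 0) - a1 * cnj (f' pi)" unfolding I1_def a0_def a1_def by (rule wt[OF t0])
    moreover have "P k t = P k 0 + I2 + b0 * cnj (f' 0) - b1 * cnj (f' pi)" unfolding I2_def b0_def b1_def by (rule ev(1)[OF t0])
    moreover have "G k t = (a0 - b0) * cnj (f' 0) - (a1 - b1) * cnj (f' pi)"
      unfolding G_def a0_def a1_def b0_def b1_def ..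
    moreover have "y k t = w t f - P k t" "y k 0 = - P k 0" by (simp_all add: y_def w0)
    ultimately have "y k t = y k 0 + (I1 - I2) + G k t" by (simp only:) (simp add: algebra_simps)
    then show ?thesis unfolding I I1_def I2_def .
  qed
  have uc: "(LINT s|lebesgue_on {0<..<t}. h (?v s)) = (LINT s|lebesgue_on {0<..<t}. h (u s))"
    if "t \<in> {0..\<tau>}" for t and h :: "complex \<times> complex \<Rightarrow> complex"
  proof (rule Bochner_Integration.integral_cong[OF refl])
    fix s assume "s \<in> space (lebesgue_on {0<..<t})"
    then have "0 < s \<and> s < \<tau>" using that by auto
    then show "h (?v s) = h (u s)" by simp
  qed
  note uL = L2_components[OF u, simplified]
  have G: "cmod (G k t) \<le> F * (sqrt (\<epsilon> k) * (\<tau> + 1))" if t: "t \<in> {0..\<tau>}" for k t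
  proof -
    have "cmod ((LINT s|lebesgue_on {0<..<t}. fst (?v s)) - integral {0..t} (\<lambda>s. W k s 0)) \<le> sqrt (\<epsilon> k) * (\<tau> + 1)"
      unfolding uc[OF t] by (rule L1_distance_le[OF uL(1,2) W_time_continuous control_0 \<epsilon>(1) t])
    moreover have "cmod ((LINT s|lebesgue_on {0<..<t}. snd (?v s)) - integral {0..t} (\<lambda>s. W k s (of_real pi))) \<le> sqrt (\<epsilon> k) * (\<tau> + 1)"
      unfolding uc[OF t] by (rule L1_distance_le[OF uL(3,4) W_time_continuous control_pi \<epsilon>(1) t])
    ultimately have "cmod (G k t) \<le> (sqrt (\<epsilon> k) * (\<tau> + 1)) * cmod (f' 0) + (sqrt (\<epsilon> k) * (\<tau> + 1)) * cmod (f' pi)"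
      unfolding G_def by (intro order_trans[OF norm_triangle_ineq4] add_mono) (simp_all add: norm_mult mult_right_mono)
    then show ?thesis by (simp add: F_def algebra_simps)
  qed
  have P0: "cmod (P k 0) \<le> 28 * sqrt pi * \<epsilon> k * ?N f'" for k
    using bergman_axis_pairing[OF W_holomorphic W_axis_continuous initial[of k] _ c(1) z(1,2)] \<epsilon>(1)[of k]
    by (simp add: P_def abs_of_pos)
  have P\<tau>: "cmod (P k \<tau>) \<le> 28 * sqrt pi * sqrt B * ?N f'" for k
    unfolding P_def by (rule bergman_axis_pairing[OF W_holomorphic W_axis_continuous final c(1) z(1,2)])
  have cy: "continuous_on {0..\<tau>} (y k)" for k
    unfolding y_def by (rule continuous_on_diff[OF cw(1) ev_cont(1)])
  have cm: "continuous_on {0..\<tau>} (\<lambda>t. w t g - m k t)" for k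
    by (rule continuous_on_diff[OF cw(2) ev_cont(2)])
  have y\<tau>: "cmod (y k \<tau>) \<le> (\<bar>C\<bar> + 28 * sqrt pi * sqrt B) * ?N g" for k
  proof -
    have s0: "sobolev_norm J f \<ge> 0" by (simp add: sobolev_norm_def)
    have "cmod (w \<tau> f) \<le> C * sobolev_norm J f" by (rule C[OF f10])
    also have "\<dots> \<le> \<bar>C\<bar> * sobolev_norm J f" using s0 by (intro mult_right_mono) auto
    also have "\<dots> \<le> \<bar>C\<bar> * ?N g" using fn by (intro mult_left_mono) auto
    finally have 1: "cmod (w \<tau> f) \<le> \<bar>C\<bar> * ?N g" .
    have 2: "cmod (P k \<tau>) \<le> 28 * sqrt pi * sqrt B * ?N g"
      by (rule order_trans[OF P\<tau>]) (intro mult_left_mono N', use final in auto)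
    have "cmod (y k \<tau>) \<le> cmod (w \<tau> f) + cmod (P k \<tau>)" unfolding y_def by (rule norm_triangle_ineq4)
    then show ?thesis using 1 2 by (simp add: distrib_right)
  qed
  have y0: "cmod (y k 0) \<le> 28 * sqrt pi * ?N f' * \<epsilon> k" for k using P0[of k] by (simp add: y_def w0 mult_ac)
  define K where "K = exp (l * \<tau>) * (28 * sqrt pi * ?N f' + F * (\<tau> + 1))"
  have "cmod (integral {0..\<tau>} (\<lambda>t. of_real (exp (l * (\<tau> - t))) * (w t g - m k t))) \<le>
      (\<bar>C\<bar> + 28 * sqrt pi * sqrt B) * ?N g + K * (\<epsilon> k + sqrt (\<epsilon> k))" for k
  proof -
    have "cmod (integral {0..\<tau>} (\<lambda>t. of_real (exp (l * (\<tau> - t))) * (w t g - m k t)))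
      \<le> cmod (y k \<tau>) + exp (l * \<tau>) * (cmod (y k 0) + F * (sqrt (\<epsilon> k) * (\<tau> + 1)))"
      by (rule perturbed_growth_moment_bound[OF _ _ cy cm yeq G]) (use \<tau> l in auto)
    also have "\<dots> \<le> (\<bar>C\<bar> + 28 * sqrt pi * sqrt B) * ?N g + exp (l * \<tau>) * (28 * sqrt pi * ?N f' * \<epsilon> k + F * (\<tau> + 1) * sqrt (\<epsilon> k))"
      using y\<tau>[of k] y0[of k] by (intro add_mono mult_left_mono) (auto simp: mult_ac)
    also have "exp (l * \<tau>) * (28 * sqrt pi * ?N f' * \<epsilon> k + F * (\<tau> + 1) * sqrt (\<epsilon> k)) \<le> K * (\<epsilon> k + sqrt (\<epsilon> k))"
    proof -
      define a b where "a = 28 * sqrt pi * ?N f'" and "b = F * (\<tau> + 1)"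
      have nn: "a \<ge> 0" "b \<ge> 0" using N0 \<tau> by (auto simp: F_def a_def b_def)
      then have "a * \<epsilon> k + b * sqrt (\<epsilon> k) \<le> (a + b) * \<epsilon> k + (a + b) * sqrt (\<epsilon> k)"
        using \<epsilon>(1)[of k] by (intro add_mono mult_right_mono) auto
      also have "\<dots> = (a + b) * (\<epsilon> k + sqrt (\<epsilon> k))" by (rule distrib_left[symmetric])
      finally have "exp (l * \<tau>) * (a * \<epsilon> k + b * sqrt (\<epsilon> k)) \<le> exp (l * \<tau>) * ((a + b) * (\<epsilon> k + sqrt (\<epsilon> k)))"
        by (rule mult_left_mono) simp
      then show ?thesis by (simp only: K_def a_def b_def mult.assoc)
    qed
    finally show ?thesis by simp
  qed
  then show ?thesis using that unfolding m_def by blast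
qed

text \<open>The pairings of the approximants converge uniformly on \<open>{0..\<tau>}\<close>, so
  moments and continuity pass to the limit. The difference from \<open>w t g\<close> then has
  moments bounded independently of \<open>l\<close> and must vanish at
  \<open>\<tau>\<close>.\<close>

lemma final_state_limit:
  assumes g: "C1_on g g'" "g 0 = 0" "g pi = 0"
  shows "(\<lambda>k. axis_pairing (W k \<tau>) g) \<longlonglongrightarrow> w \<tau> g"
proof -
  define m where "m k t = axis_pairing (W k t) g" for k t
  define Ng where "Ng = sqrt (sq_integral g')"
  have cg: "continuous_on {0..pi} g" by (rule C1_on_continuous[OF g(1)])
  have cm: "continuous_on A (m k)" for A k
    unfolding m_def[abs_def] W mode_sum_pairing[OF mode cg] by (intro continuous_intros)
  have diff: "cmod (m k t - m l t) \<le> 28 * sqrt pi * Ng * sqrt (10 * (\<epsilon> k + \<epsilon> l))" if t: "t \<in> {0..\<tau>}" for k l t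
  proof -
    have "m k t - m l t = integral {0..pi} (\<lambda>x. (W k t (of_real x) - W l t (of_real x)) * cnj (g x))"
      unfolding m_def left_diff_distrib
      by (intro Henstock_Kurzweil_Integration.integral_diff[symmetric] integrable_continuous_real continuous_intros W_axis_continuous cg)
    also have "cmod \<dots> \<le> 28 * sqrt pi * sqrt (10 * (\<epsilon> k + \<epsilon> l)) * Ng"
      unfolding Ng_def
      by (rule bergman_axis_pairing[OF _ _ cauchy[OF t] _ g])
         (use \<epsilon>(1)[of k] \<epsilon>(1)[of l] in \<open>auto intro!: holomorphic_intros W_holomorphic continuous_intros W_axis_continuous\<close>)
    finally show ?thesis by (simp add: mult_ac)
  qed
  have Ng: "Ng \<ge> 0" unfolding Ng_def using g(1)
    by (intro real_sqrt_ge_zero integral_nonneg integrable_continuous_real continuous_intros) (auto simp: C1_on_def)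
  have "uniformly_Cauchy_on {0..\<tau>} m"
    unfolding uniformly_Cauchy_on_def
  proof safe
    fix e :: real assume e: "e > 0"
    have "(\<lambda>k. 28 * sqrt pi * Ng * sqrt (10 * (\<epsilon> k + \<epsilon> k))) \<longlonglongrightarrow> 28 * sqrt pi * Ng * sqrt (10 * (0 + 0))"
      by (intro tendsto_intros \<epsilon>)
    then have "\<forall>\<^sub>F k in sequentially. 28 * sqrt pi * Ng * sqrt (20 * \<epsilon> k) < e"
      using e by (intro order_tendstoD(2)[where y = 0]) auto
    then obtain M where M: "\<And>k. k \<ge> M \<Longrightarrow> 28 * sqrt pi * Ng * sqrt (20 * \<epsilon> k) < e" by (auto simp: eventually_sequentially)
    have "dist (m k t) (m l t) < e" if "t \<in> {0..\<tau>}" "k \<ge> M" "l \<ge> M" for t k l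
    proof -
      have "cmod (m k t - m l t) \<le> 28 * sqrt pi * Ng * sqrt (10 * (\<epsilon> k + \<epsilon> l))" by (rule diff[OF that(1)])
      also have "\<dots> \<le> max (28 * sqrt pi * Ng * sqrt (20 * \<epsilon> k)) (28 * sqrt pi * Ng * sqrt (20 * \<epsilon> l))"
      proof (cases "\<epsilon> k \<le> \<epsilon> l")
        case True
        then have "28 * sqrt pi * Ng * sqrt (10 * (\<epsilon> k + \<epsilon> l)) \<le> 28 * sqrt pi * Ng * sqrt (20 * \<epsilon> l)"
          using Ng by (intro mult_left_mono real_sqrt_le_mono) auto
        then show ?thesis by (rule order_trans[OF _ max.cobounded2])
      next
        case False
        then have "28 * sqrt pi * Ng * sqrt (10 * (\<epsilon> k + \<epsilon> l)) \<le> 28 * sqrt pi * Ng * sqrt (20 * \<epsilon> k)"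
          using Ng by (intro mult_left_mono real_sqrt_le_mono) auto
        then show ?thesis by (rule order_trans[OF _ max.cobounded1])
      qed
      also have "\<dots> < e" using M that by simp
      finally show ?thesis by (simp add: dist_norm)
    qed
    then show "\<exists>M. \<forall>x\<in>{0..\<tau>}. \<forall>k\<ge>M. \<forall>l\<ge>M. dist (m k x) (m l x) < e" by blast
  qed
  then have "uniformly_convergent_on {0..\<tau>} m" by (rule Cauchy_uniformly_convergent)
  then obtain M where M: "uniform_limit {0..\<tau>} m M sequentially" by (auto simp: uniformly_convergent_on_def)
  have cM: "continuous_on {0..\<tau>} M"
    by (rule uniform_limit_theorem[OF _ M]) (intro always_eventually allI cm, simp)
  have cw: "continuous_on {0..\<tau>} (\<lambda>t. w t g)"
    using continuous_dual_valued_pairing[OF continuous_dual g] by (auto elim!: continuous_on_subset)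
  have "w \<tau> \<in> dual_sobolev J" using continuous_dual \<tau> by (auto simp: continuous_dual_valued_def)
  then have "\<exists>C. \<forall>\<psi>\<in>sobolev_10 J. cmod (w \<tau> \<psi>) \<le> C * sobolev_norm J \<psi>" unfolding dual_sobolev_def by blast
  then obtain C where C: "\<And>\<psi>. \<psi> \<in> sobolev_10 J \<Longrightarrow> cmod (w \<tau> \<psi>) \<le> C * sobolev_norm J \<psi>" by blast
  \<comment> \<open>This bound contains no \<open>l\<close>, as the vanishing lemma demands.\<close>
  define R where "R = (\<bar>C\<bar> + 28 * sqrt pi * sqrt B) * sqrt (sq_integral g)"
  have "(\<lambda>t. w t g - M t) \<tau> = 0"
  proof (rule continuous_zero_of_exp_moments[OF \<tau>])
    show "continuous_on {0..\<tau>} (\<lambda>t. w t g - M t)" by (intro continuous_intros cw cM)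
    fix l :: nat assume "l \<ge> 1"
    then have l: "real l \<ge> 1" by simp
    obtain K where K: "\<And>k. cmod (integral {0..\<tau>} (\<lambda>t. of_real (exp (real l * (\<tau> - t))) * (w t g - m k t))) \<le> R + K * (\<epsilon> k + sqrt (\<epsilon> k))"
      using moment_bound[OF l g C, folded m_def R_def] by blast
    have "(\<lambda>k. integral {0..\<tau>} (\<lambda>t. of_real (exp (real l * (\<tau> - t))) * (w t g - m k t))) \<longlonglongrightarrow>
        integral {0..\<tau>} (\<lambda>t. of_real (exp (real l * (\<tau> - t))) * (w t g - M t))"
    proof -
      have cb: "bounded ((\<lambda>t. complex_of_real (exp (real l * (\<tau> - t)))) ` {0..\<tau>})" "bounded ((\<lambda>t. w t g - M t) ` {0..\<tau>})"
        by (intro compact_imp_bounded compact_continuous_image continuous_intros cw cM; simp)+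
      have ul: "uniform_limit {0..\<tau>} (\<lambda>k t. of_real (exp (real l * (\<tau> - t))) * (w t g - m k t))
          (\<lambda>t. of_real (exp (real l * (\<tau> - t))) * (w t g - M t)) sequentially"
        by (intro uniform_lim_mult uniform_limit_minus uniform_limit_const M cb)
      have ci: "continuous_on {0..\<tau>} (\<lambda>t. of_real (exp (real l * (\<tau> - t))) * (w t g - m k t))" for k
        by (rule continuous_on_mult[OF _ continuous_on_diff[OF cw cm]]) (intro continuous_intros)
      obtain I I0 where
        I: "\<And>k. ((\<lambda>t. of_real (exp (real l * (\<tau> - t))) * (w t g - m k t)) has_integral I k) {0..\<tau>}"
        "((\<lambda>t. of_real (exp (real l * (\<tau> - t))) * (w t g - M t)) has_integral I0) {0..\<tau>}" "I \<longlonglongrightarrow> I0"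
        by (rule uniform_limit_integral[OF ul ci]) auto
      then show ?thesis unfolding integral_unique[OF I(1)] integral_unique[OF I(2)] by simp
    qed
    from tendsto_norm[OF this] have "(\<lambda>k. cmod (integral {0..\<tau>} (\<lambda>t. of_real (exp (real l * (\<tau> - t))) * (w t g - m k t)))) \<longlonglongrightarrow>
        cmod (integral {0..\<tau>} (\<lambda>t. of_real (exp (real l * (\<tau> - t))) * (w t g - M t)))" .
    moreover have "(\<lambda>k. R + K * (\<epsilon> k + sqrt (\<epsilon> k))) \<longlonglongrightarrow> R + K * (0 + sqrt 0)"
      by (intro tendsto_intros \<epsilon>)
    ultimately show "cmod (integral {0..\<tau>} (\<lambda>t. of_real (exp (real l * (\<tau> - t))) * (w t g - M t))) \<le> R"
      using K by (intro LIMSEQ_le[where Y = "\<lambda>k. R + K * (\<epsilon> k + sqrt (\<epsilon> k))"]) auto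
  qed
  moreover have "(\<lambda>k. m k \<tau>) \<longlonglongrightarrow> M \<tau>" by (rule tendsto_uniform_limitI[OF M]) (use \<tau> in simp)
  ultimately show ?thesis by (simp add: m_def)
qed

text \<open>A test function has compact support in \<open>J\<close>, which is a compact subset of
  \<open>D\<close>. Locally uniform convergence of the approximants therefore identifies their
  limiting pairings as integrals against the Bergman limit.\<close>

lemma final_state_in_bergman: "w \<tau> \<in> restrictions J (bergman_space D)"
proof -
  have "bergman_energy (W k \<tau>) < \<infinity>" for k
    using final(1)[of k] by (rule order.strict_trans1) simp
  moreover have "\<exists>N. \<forall>k\<ge>N. \<forall>l\<ge>N. bergman_energy (\<lambda>z. W k \<tau> z - W l \<tau> z) \<le> ennreal e" if e: "e > 0" for e
  proof -
    have "\<forall>\<^sub>F k in sequentially. \<epsilon> k < e / 20" using e by (intro order_tendstoD(2)[OF \<epsilon>(2)]) auto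
    then obtain N where N: "\<And>k. k \<ge> N \<Longrightarrow> \<epsilon> k < e / 20" by (auto simp: eventually_sequentially)
    have "bergman_energy (\<lambda>z. W k \<tau> z - W l \<tau> z) \<le> ennreal e" if "k \<ge> N" "l \<ge> N" for k l
    proof -
      have "10 * (\<epsilon> k + \<epsilon> l) \<le> e" using N[OF that(1)] N[OF that(2)] by simp
      then have "ennreal (10 * (\<epsilon> k + \<epsilon> l)) \<le> ennreal e" by (rule ennreal_leI)
      then show ?thesis using cauchy[of \<tau> k l] \<tau> by (auto intro: order_trans)
    qed
    then show ?thesis by blast
  qed
  ultimately obtain H where H: "H \<in> bergman_space D"
    "\<And>K. compact K \<Longrightarrow> K \<subseteq> D \<Longrightarrow> uniform_limit K (\<lambda>k. W k \<tau>) H sequentially"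
    using bergman_cauchy_limit[of "\<lambda>k. W k \<tau>", OF W_holomorphic] by blast
  have "w \<tau> g = (LINT x|lebesgue_on J. H (of_real x) * cnj (g x))" if g: "g \<in> test_functions J" for g
  proof -
    note cg = test_functionD(4)[OF g, of "{0..pi}"]
    obtain K where K: "compact K" "K \<subseteq> J" "\<And>x. x \<notin> K \<Longrightarrow> g x = 0" using g by (auto simp: test_functions_def)
    have KD: "complex_of_real ` K \<subseteq> D" using K(2) by (auto simp: D_def abs_if subset_iff)
    have cK: "compact (complex_of_real ` K)" by (intro compact_continuous_image continuous_intros K)
    have "bounded (g ` {0..pi})" by (intro compact_imp_bounded compact_continuous_image cg) auto
    then obtain b where b: "b > 0" "\<And>x. x \<in> {0..pi} \<Longrightarrow> cmod (g x) \<le> b" by (auto simp: bounded_pos)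
    have ul: "uniform_limit {0..pi} (\<lambda>k x. W k \<tau> (of_real x) * cnj (g x)) (\<lambda>x. H (of_real x) * cnj (g x)) sequentially"
    proof (rule uniform_limitI)
      fix e :: real assume e: "e > 0"
      have "\<forall>\<^sub>F k in sequentially. \<forall>z\<in>complex_of_real ` K. dist (W k \<tau> z) (H z) < e / b"
        using uniform_limitD[OF H(2)[OF cK KD]] e b by simp
      then show "\<forall>\<^sub>F k in sequentially. \<forall>x\<in>{0..pi}. dist (W k \<tau> (of_real x) * cnj (g x)) (H (of_real x) * cnj (g x)) < e"
      proof eventually_elim
        case (elim k)
        show ?case
        proof
          fix x assume x: "x \<in> {0..pi}"
          show "dist (W k \<tau> (of_real x) * cnj (g x)) (H (of_real x) * cnj (g x)) < e"
          proof (cases "x \<in> K")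
            case True
            then have "cmod (W k \<tau> (of_real x) - H (of_real x)) < e / b" using elim by (auto simp: dist_norm)
            then have "cmod (W k \<tau> (of_real x) - H (of_real x)) * b < e" using b by (simp add: field_simps)
            moreover have "cmod (W k \<tau> (of_real x) - H (of_real x)) * cmod (g x) \<le> cmod (W k \<tau> (of_real x) - H (of_real x)) * b"
              using b(2)[OF x] by (intro mult_left_mono) auto
            ultimately show ?thesis by (simp add: dist_norm left_diff_distrib[symmetric] norm_mult)
          qed (use K e in simp)
        qed
      qed
    qed
    have ci: "continuous_on {0..pi} (\<lambda>x. W k \<tau> (of_real x) * cnj (g x))" for k
      by (intro continuous_intros W_axis_continuous cg)
    have cH: "continuous_on {0..pi} (\<lambda>x. H (of_real x) * cnj (g x))"
      by (rule uniform_limit_theorem[OF _ ul]) (use ci in auto)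
    from uniform_limit_integral[OF ul ci] obtain I I0 where
      I: "\<And>k. ((\<lambda>x. W k \<tau> (of_real x) * cnj (g x)) has_integral I k) {0..pi}"
      "((\<lambda>x. H (of_real x) * cnj (g x)) has_integral I0) {0..pi}" "I \<longlonglongrightarrow> I0"
      by (metis trivial_limit_sequentially)
    then have "(\<lambda>k. axis_pairing (W k \<tau>) g) \<longlonglongrightarrow> axis_pairing H g"
      unfolding integral_unique[OF I(1)] integral_unique[OF I(2)] by simp
    from LIMSEQ_unique[OF final_state_limit[OF C1_on_test_function[OF g]] this]
    show ?thesis by (simp add: LINT_open_interval(2)[OF cH])
  qed
  then show ?thesis using H(1) by (auto simp: restrictions_def)
qed

end

theorem theorem1:
  fixes \<tau> :: real
  assumes "\<tau> > 0"
  shows "Range (hermite_input_to_state \<tau>) \<subseteq> restrictions {0<..<pi} (bergman_space D)"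
proof
  fix F assume "F \<in> Range (hermite_input_to_state \<tau>)"
  then obtain u w where F: "F = w \<tau>" and u: "u \<in> L2 {0<..<\<tau>}"
    and w: "hermite_solution (\<lambda>\<psi>. 0) (\<lambda>s. if 0 < s \<and> s < \<tau> then u s else 0) w"
    by (auto simp: hermite_input_to_state_def)
  note uL = L2_components[OF u, simplified]
  define \<epsilon> where "\<epsilon> k = 1 / real (Suc k)" for k
  have \<epsilon>: "\<epsilon> k > 0" "\<epsilon> k \<le> 1" "\<epsilon> \<longlonglongrightarrow> 0" for k
    using LIMSEQ_Suc[OF lim_1_over_n[where 'a = real]] by (auto simp: \<epsilon>_def [abs_def])
  let ?E = "\<lambda>p s. of_real (exp s) * poly p (complex_of_real (exp s))"
  let ?M = "lebesgue_on {0<..<\<tau>}"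
  have "\<exists>p. (\<forall>s\<le>0. cmod (?E p s) \<le> \<epsilon> k * exp s) \<and> (LINT s|?M. (cmod (fst (u s) - ?E p s))\<^sup>2) \<le> \<epsilon> k
      \<and> integrable ?M (\<lambda>s. (cmod (fst (u s) - ?E p s))\<^sup>2)" for k
    by (rule L2_approx_exponential_poly[OF uL(1,2) \<epsilon>(1)[of k] assms]) blast
  then have "\<exists>p. \<forall>k. (\<forall>s\<le>0. cmod (?E (p k) s) \<le> \<epsilon> k * exp s) \<and> (LINT s|?M. (cmod (fst (u s) - ?E (p k) s))\<^sup>2) \<le> \<epsilon> k
      \<and> integrable ?M (\<lambda>s. (cmod (fst (u s) - ?E (p k) s))\<^sup>2)" by (intro choice allI)
  then obtain p where p: "\<And>k s. s \<le> 0 \<Longrightarrow> cmod (?E (p k) s) \<le> \<epsilon> k * exp s"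
      "\<And>k. (LINT s|?M. (cmod (fst (u s) - ?E (p k) s))\<^sup>2) \<le> \<epsilon> k"
      "\<And>k. integrable ?M (\<lambda>s. (cmod (fst (u s) - ?E (p k) s))\<^sup>2)" by blast
  have "\<exists>q. (\<forall>s\<le>0. cmod (?E q s) \<le> \<epsilon> k * exp s) \<and> (LINT s|?M. (cmod (snd (u s) - ?E q s))\<^sup>2) \<le> \<epsilon> k
      \<and> integrable ?M (\<lambda>s. (cmod (snd (u s) - ?E q s))\<^sup>2)" for k
    by (rule L2_approx_exponential_poly[OF uL(3,4) \<epsilon>(1)[of k] assms]) blast
  then have "\<exists>q. \<forall>k. (\<forall>s\<le>0. cmod (?E (q k) s) \<le> \<epsilon> k * exp s) \<and> (LINT s|?M. (cmod (snd (u s) - ?E (q k) s))\<^sup>2) \<le> \<epsilon> k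
      \<and> integrable ?M (\<lambda>s. (cmod (snd (u s) - ?E (q k) s))\<^sup>2)" by (intro choice allI)
  then obtain q where q: "\<And>k s. s \<le> 0 \<Longrightarrow> cmod (?E (q k) s) \<le> \<epsilon> k * exp s"
      "\<And>k. (LINT s|?M. (cmod (snd (u s) - ?E (q k) s))\<^sup>2) \<le> \<epsilon> k"
      "\<And>k. integrable ?M (\<lambda>s. (cmod (snd (u s) - ?E (q k) s))\<^sup>2)" by blast
  obtain n :: "complex poly \<Rightarrow> complex poly \<Rightarrow> nat" and Z Z' where Z:
    "\<And>(p :: complex poly) (q :: complex poly) j. hermite_mode (real j) (Z p q j) (Z' p q j)"
    "\<And>p q t. mode_sum (n p q) (Z p q) t 0 = ?E p t"
    "\<And>p q t. mode_sum (n p q) (Z p q) t (of_real pi) = ?E q t"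
    "\<And>p q p' q' t z. mode_sum (n p q) (Z p q) t z - mode_sum (n p' q') (Z p' q') t z
       = mode_sum (n (p - p') (q - q')) (Z (p - p') (q - q')) t z"
    by (rule exponential_boundary_modes) blast
  have cE: "continuous_on A (?E r)" for A r by (intro continuous_intros)
  have Ediff: "?E (r - r') s = ?E r s - ?E r' s" for r r' s by (simp add: algebra_simps)
  have energy: "bergman_energy (\<lambda>z. mode_sum (n (p k) (q k)) (Z (p k) (q k)) t z - mode_sum (n (p l) (q l)) (Z (p l) (q l)) t z)
       \<le> ennreal (10 * (\<epsilon> k + \<epsilon> l))" if t: "t \<in> {0..\<tau>}" for k l t
  proof -
    have "bergman_energy (mode_sum (n (p k - p l) (q k - q l)) (Z (p k - p l) (q k - q l)) t)
        \<le> ennreal ((\<epsilon> k + \<epsilon> l)\<^sup>2 + 2 * (2 * \<epsilon> k + 2 * \<epsilon> l))"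
    proof (rule bergman_energy_mode_sum(2)[where Z = "Z (p k - p l) (q k - q l)" and Z' = "Z' (p k - p l) (q k - q l)",
        OF Z(1) _ _ _ t]; (unfold Z(2,3) Ediff)?)
      show "0 \<le> \<epsilon> k + \<epsilon> l" using \<epsilon>(1)[of k] \<epsilon>(1)[of l] by simp
      show "cmod (?E (p k) s - ?E (p l) s) \<le> (\<epsilon> k + \<epsilon> l) * exp s" "cmod (?E (q k) s - ?E (q l) s) \<le> (\<epsilon> k + \<epsilon> l) * exp s"
        if "s \<le> 0" for s
        unfolding distrib_right
        by (rule order_trans[OF norm_triangle_ineq4 add_mono[OF p(1)[OF that] p(1)[OF that]]]
          order_trans[OF norm_triangle_ineq4 add_mono[OF q(1)[OF that] q(1)[OF that]]])+
      show "integral {0..\<tau>} (\<lambda>s. (cmod (?E (p k) s - ?E (p l) s))\<^sup>2) \<le> 2 * \<epsilon> k + 2 * \<epsilon> l"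
        by (rule order_trans[OF L2_distance_triangle[OF cE p(3) cE p(3)]]) (intro add_mono mult_left_mono p(2), auto)
      show "integral {0..\<tau>} (\<lambda>s. (cmod (?E (q k) s - ?E (q l) s))\<^sup>2) \<le> 2 * \<epsilon> k + 2 * \<epsilon> l"
        by (rule order_trans[OF L2_distance_triangle[OF cE q(3) cE q(3)]]) (intro add_mono mult_left_mono q(2), auto)
    qed
    \<comment> \<open>Each \<open>\<epsilon> k\<close> is at most \<open>1\<close>, so the square is
      at most twice the sum; with the control terms the factor is 6, below 10.\<close>
    also have "\<dots> \<le> ennreal (10 * (\<epsilon> k + \<epsilon> l))"
    proof (rule ennreal_leI)
      have "(\<epsilon> k + \<epsilon> l)\<^sup>2 \<le> 2 * (\<epsilon> k + \<epsilon> l)"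
        unfolding power2_eq_square using \<epsilon>(1,2)[of k] \<epsilon>(1,2)[of l] by (intro mult_right_mono) auto
      then show "(\<epsilon> k + \<epsilon> l)\<^sup>2 + 2 * (2 * \<epsilon> k + 2 * \<epsilon> l) \<le> 10 * (\<epsilon> k + \<epsilon> l)"
        using \<epsilon>(1)[of k] \<epsilon>(1)[of l] by simp
    qed
    finally show ?thesis unfolding Z(4) .
  qed
  \<comment> \<open>The leading \<open>1\<close> bounds the squared initial error; the bracket
    bounds the squared norm of each approximate control by comparison with the zero control.\<close>
  define B where "B = 1 + 2 * (2 * 1 + 2 * (LINT s|?M. (cmod (fst (u s)))\<^sup>2) + 2 * (LINT s|?M. (cmod (snd (u s)))\<^sup>2))"
  have L0: "0 \<le> (LINT s|?M. (cmod (fst (u s)))\<^sup>2)" "0 \<le> (LINT s|?M. (cmod (snd (u s)))\<^sup>2)" by auto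
  interpret hermite_approximation \<tau> u w "\<lambda>k. n (p k) (q k)" "\<lambda>k. Z (p k) (q k)" "\<lambda>k. Z' (p k) (q k)" \<epsilon>
    "\<lambda>k. mode_sum (n (p k) (q k)) (Z (p k) (q k))" B
  proof (unfold_locales; (unfold Z(2,3))?)
    show "bergman_energy (mode_sum (n (p k) (q k)) (Z (p k) (q k)) 0) \<le> ennreal ((\<epsilon> k)\<^sup>2)" for k
      by (rule bergman_energy_mode_sum(1)[where Z = "Z (p k) (q k)" and Z' = "Z' (p k) (q k)", OF Z(1)]; (unfold Z(2,3))?) (use p(1) q(1) \<epsilon>(1)[of k] in auto)
    show "bergman_energy (mode_sum (n (p k) (q k)) (Z (p k) (q k)) \<tau>) \<le> ennreal B" for k
    proof -
      let ?\<kappa> = "2 * 1 + 2 * (LINT s|?M. (cmod (fst (u s)))\<^sup>2) + 2 * (LINT s|?M. (cmod (snd (u s)))\<^sup>2)"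
      have c0: "continuous_on {0..\<tau>} (\<lambda>s. 0 :: complex)" by simp
      have "bergman_energy (mode_sum (n (p k) (q k)) (Z (p k) (q k)) \<tau>) \<le> ennreal ((\<epsilon> k)\<^sup>2 + 2 * ?\<kappa>)"
      proof (rule bergman_energy_mode_sum(2)[where Z = "Z (p k) (q k)" and Z' = "Z' (p k) (q k)" and \<tau> = \<tau>, OF Z(1)];
        (unfold Z(2,3))?)
        have "integral {0..\<tau>} (\<lambda>s. (cmod (?E (p k) s - 0))\<^sup>2) \<le> 2 * (LINT s|?M. (cmod (fst (u s) - ?E (p k) s))\<^sup>2) + 2 * (LINT s|?M. (cmod (fst (u s) - 0))\<^sup>2)"
          by (rule L2_distance_triangle[OF cE p(3) c0]) (use uL in simp)
        then show "integral {0..\<tau>} (\<lambda>s. (cmod (?E (p k) s))\<^sup>2) \<le> ?\<kappa>" using p(2)[of k] \<epsilon>(2)[of k] L0 by (simp only: diff_zero)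
        have "integral {0..\<tau>} (\<lambda>s. (cmod (?E (q k) s - 0))\<^sup>2) \<le> 2 * (LINT s|?M. (cmod (snd (u s) - ?E (q k) s))\<^sup>2) + 2 * (LINT s|?M. (cmod (snd (u s) - 0))\<^sup>2)"
          by (rule L2_distance_triangle[OF cE q(3) c0]) (use uL in simp)
        then show "integral {0..\<tau>} (\<lambda>s. (cmod (?E (q k) s))\<^sup>2) \<le> ?\<kappa>" using q(2)[of k] \<epsilon>(2)[of k] L0 by (simp only: diff_zero)
      qed (use p(1) q(1) \<epsilon>(1)[of k] assms in auto)
      also have "\<dots> \<le> ennreal B" unfolding B_def
        using \<epsilon>(1,2)[of k] by (intro ennreal_leI add_right_mono) (simp add: power_le_one)
      finally show ?thesis .
    qed
    show "0 \<le> B" using L0 by (simp add: B_def)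
  qed (use assms u w Z(1) \<epsilon> p q energy in \<open>auto simp: Z(2,3)\<close>)
  show "F \<in> restrictions J (bergman_space D)" unfolding F by (rule final_state_in_bergman)
qed

end
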